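(* Let $0<\zeta_3<\zeta_2<\zeta_1$, let $u(x,t)=\phi(x+ct)$ with $$\phi(x)=\frac{2(\zeta_1+\zeta_3)(\zeta_2+\zeta_3)}{(\zeta_1+\zeta_3)-(\zeta_1-\zeta_2)\,\mathrm{sn}^2(\nu x,k)}-\zeta_1-\zeta_2-\zeta_3,\qquad c=2(\zeta_1^2+\zeta_2^2+\zeta_3^2),$$ $$\nu=\sqrt{\zeta_1^2-\zeta_3^2},\qquad k=\sqrt{\frac{\zeta_1^2-\zeta_2^2}{\zeta_1^2-\zeta_3^2}},$$ and let $\alpha\in(0,K)$ be defined by $\mathrm{sn}(\alpha)=\sqrt{(\zeta_1-\zeta_3)/(\zeta_1+\zeta_2)}$. Let $\zeta\in(0,\zeta_3)\cup(\zeta_3,\zeta_2)\cup(\zeta_2,\zeta_1)\cup(\zeta_1,\infty)$ be given and let $\gamma\in[0,K]\times[0,iK']$ be defined by $$\zeta^2=\zeta_3^2+(\zeta_1^2-\zeta_3^2)\,\mathrm{dn}^2(\gamma).$$ Then there exist two linearly independent solutions of the Lax system $\partial_x\varphi=U(\zeta,u)\varphi$, $\partial_t\varphi=V(\zeta,u)\varphi$ in the form $$\varphi(x,t)=\begin{pmatrix}p_1(x+ct)\\ q_1(x+ct)\end{pmatrix}e^{\mu t},\qquad \varphi(x,t)=\begin{pmatrix}p_2(x+ct)\\ q_2(x+ct)\end{pmatrix}e^{-\mu t},$$ where $$\begin{pmatrix}p_1(x)\\ q_1(x)\end{pmatrix}=\begin{pmatrix}-i\zeta\,\frac{H(\nu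 x+\gamma+\alpha)}{\Theta(\nu x+\alpha)}+\zeta_1\frac{\Theta(0)\Theta(2\alpha+\gamma)}{\Theta(\gamma)\Theta(2\alpha)}\frac{H(\nu x+\gamma-\alpha)}{\Theta(\nu x-\alpha)}\\[4pt] -i\zeta\,\frac{H(\nu x+\gamma+\alpha)}{\Theta(\nu x+\alpha)}-\zeta_1\frac{\Theta(0)\Theta(2\alpha+\gamma)}{\Theta(\gamma)\Theta(2\alpha)}\frac{H(\nu x+\gamma-\alpha)}{\Theta(\nu x-\alpha)}\end{pmatrix}e^{-\nu xZ(\gamma)}$$ and $$\begin{pmatrix}p_2(x)\\ q_2(x)\end{pmatrix}=\begin{pmatrix}\zeta_1\frac{\Theta(0)\Theta(2\alpha+\gamma)}{\Theta(\gamma)\Theta(2\alpha)}\frac{H(\nu x-\gamma+\alpha)}{\Theta(\nu x+\alpha)}+i\zeta\,\frac{H(\nu x-\gamma-\alpha)}{\Theta(\nu x-\alpha)}\\[4pt] \zeta_1\frac{\Theta(0)\Theta(2\alpha+\gamma)}{\Theta(\gamma)\Theta(2\alpha)}\frac{H(\nu x-\gamma+\alpha)}{\Theta(\nu x+\alpha)}-i\zeta\,\frac{H(\nu x-\gamma-\alpha)}{\Theta(\nu x-\alpha)}\end{pmatrix}e^{\nu xZ(\gamma)},$$ with $$\mu=-4\nu^3k^2\,\mathrm{sn}(\gamma)\,\mathrm{cn}(\gamma)\,\mathrm{dn}(\gamma).$$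
   Context: The Lax system for the defocusing mKdV equation $u_t-6u^2u_x+u_{xxx}=0$ has matrices $$U(\zeta,u)=\begin{pmatrix} i\zeta & u \\ u & -i\zeta \end{pmatrix},$$ $$V(\zeta,u)=\begin{pmatrix} 4i\zeta^3+2i\zeta u^2 & 4\zeta^2u-2i\zeta u_x+2u^3-u_{xx} \\ 4\zeta^2u+2i\zeta u_x+2u^3-u_{xx} & -4i\zeta^3-2i\zeta u^2 \end{pmatrix},$$ and $\varphi=\varphi(x,t)\in\mathbb{C}^2$, $(x,t)\in\mathbb{R}\times\mathbb{R}$. Jacobi elliptic functions $\mathrm{sn},\mathrm{cn},\mathrm{dn}$ all have modulus $k\in(0,1)$ given in the claim; $K=K(k)$ is the complete elliptic integral of the first kind and $K'=K(\sqrt{1-k^2})$. The notation $[0,K]\times[0,iK']$ means the closed rectangle $\{\gamma\in\mathbb{C}:0\le\mathrm{Re}\,\gamma\le K,\ 0\le\mathrm{Im}\,\gamma\le K'\}$. Theta functions: with $q=e^{-\pi K'/K}$ and $y=\frac{\pi x}{2K}$, $$H(x)=\theta_1(y)=2\sum_{n\ge1}(-1)^{n-1}q^{(n-\frac12)^2}\sin((2n-1)y),$$ $$\Theta(x)=\theta_4(y)=1+2\sum_{n\ge1}(-1)^nq^{n^2}\cos(2ny),$$ so that $\mathrm{sn}(x)=H(x)/(\sqrt{k}\,\Theta(x))$. Finally $Z(\gamma)=\Theta'(\gamma)/\Theta(\gamma)$. *)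

theory Defs
  imports "HOL-Analysis.Analysis"
begin

text \<open>
  The theta series are written for the nome \<open>q\<close> and summed from \<open>0\<close>: the index \<open>n\<close> below is
  \<open>n - 1\<close> of the customary sums over \<open>n \<ge> 1\<close>. They are polymorphic, so that the same functions
  serve for real arguments (with real values) and for complex arguments.
\<close>

definition theta1 :: "real \<Rightarrow> 'a \<Rightarrow> 'a::{real_normed_field,banach}" where
  "theta1 q y = 2 * (\<Sum>n. (-1) ^ n * of_real (q powr ((real n + 1/2)\<^sup>2)) * sin (of_nat (2 * n + 1) * y))"

definition theta2 :: "real \<Rightarrow> 'a \<Rightarrow> 'a::{real_normed_field,banach}" where
  "theta2 q y = 2 * (\<Sum>n. of_real (q powr ((real n + 1/2)\<^sup>2)) * cos (of_nat (2 * n + 1) * y))"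

definition theta3 :: "real \<Rightarrow> 'a \<Rightarrow> 'a::{real_normed_field,banach}" where
  "theta3 q y = 1 + 2 * (\<Sum>n. of_real (q ^ ((n + 1)\<^sup>2)) * cos (of_nat (2 * (n + 1)) * y))"

definition theta4 :: "real \<Rightarrow> 'a \<Rightarrow> 'a::{real_normed_field,banach}" where
  "theta4 q y = 1 + 2 * (\<Sum>n. (-1) ^ (n + 1) * of_real (q ^ ((n + 1)\<^sup>2)) * cos (of_nat (2 * (n + 1)) * y))"

definition ellK :: "real \<Rightarrow> real" where
  "ellK k = integral {0..pi/2} (\<lambda>s. 1 / sqrt (1 - k\<^sup>2 * (sin s)\<^sup>2))"

abbreviation compl_modulus :: "real \<Rightarrow> real" where
  "compl_modulus k \<equiv> sqrt (1 - k\<^sup>2)"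

definition nome :: "real \<Rightarrow> real" where
  "nome k = exp (- pi * ellK (compl_modulus k) / ellK k)"

definition jacobi_H :: "real \<Rightarrow> 'a \<Rightarrow> 'a::{real_normed_field,banach}" where
  "jacobi_H k x = theta1 (nome k) (of_real (pi / (2 * ellK k)) * x)"

definition jacobi_Theta :: "real \<Rightarrow> 'a \<Rightarrow> 'a::{real_normed_field,banach}" where
  "jacobi_Theta k x = theta4 (nome k) (of_real (pi / (2 * ellK k)) * x)"

definition jacobi_Z :: "real \<Rightarrow> 'a \<Rightarrow> 'a::{real_normed_field,banach}" where
  "jacobi_Z k x = deriv (jacobi_Theta k) x / jacobi_Theta k x"

text \<open>
  The Jacobi elliptic functions of modulus \<open>k\<close> are the classical theta quotients. At the common
  poles (the zeros of \<open>jacobi_Theta k\<close>) they take the value \<open>0\<close> by the convention for division.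
\<close>

definition jacobi_sn :: "real \<Rightarrow> 'a \<Rightarrow> 'a::{real_normed_field,banach}" where
  "jacobi_sn k x = jacobi_H k x / (of_real (sqrt k) * jacobi_Theta k x)"

definition jacobi_cn :: "real \<Rightarrow> 'a \<Rightarrow> 'a::{real_normed_field,banach}" where
  "jacobi_cn k x = of_real (sqrt (compl_modulus k / k)) *
     theta2 (nome k) (of_real (pi / (2 * ellK k)) * x) / jacobi_Theta k x"

definition jacobi_dn :: "real \<Rightarrow> 'a \<Rightarrow> 'a::{real_normed_field,banach}" where
  "jacobi_dn k x = of_real (sqrt (compl_modulus k)) *
     theta3 (nome k) (of_real (pi / (2 * ellK k)) * x) / jacobi_Theta k x"

definition lax_U :: "complex \<Rightarrow> real \<Rightarrow> complex^2^2" where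
  "lax_U \<zeta> u = vector [vector [\<i> * \<zeta>, of_real u], vector [of_real u, - \<i> * \<zeta>]]"

text \<open>The arguments \<open>u\<close>, \<open>ux\<close>, \<open>uxx\<close> are the values of \<open>u\<close> and of its first two \<open>x\<close>-derivatives.\<close>

definition lax_V :: "complex \<Rightarrow> real \<Rightarrow> real \<Rightarrow> real \<Rightarrow> complex^2^2" where
  "lax_V \<zeta> u ux uxx = vector
     [vector [4 * \<i> * \<zeta>^3 + 2 * \<i> * \<zeta> * of_real (u\<^sup>2),
              4 * \<zeta>\<^sup>2 * of_real u - 2 * \<i> * \<zeta> * of_real ux + of_real (2 * u^3 - uxx)],
      vector [4 * \<zeta>\<^sup>2 * of_real u + 2 * \<i> * \<zeta> * of_real ux + of_real (2 * u^3 - uxx),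
              - 4 * \<i> * \<zeta>^3 - 2 * \<i> * \<zeta> * of_real (u\<^sup>2)]]"

definition lax_solution ::
    "complex \<Rightarrow> (real \<Rightarrow> real \<Rightarrow> real) \<Rightarrow> (real \<Rightarrow> real \<Rightarrow> complex^2) \<Rightarrow> bool" where
  "lax_solution \<zeta> u \<phi> \<longleftrightarrow> (\<forall>x t.
     ((\<lambda>x. \<phi> x t) has_vector_derivative lax_U \<zeta> (u x t) *v \<phi> x t) (at x) \<and>
     ((\<lambda>t. \<phi> x t) has_vector_derivative
        lax_V \<zeta> (u x t) (deriv (\<lambda>y. u y t) x) (deriv (deriv (\<lambda>y. u y t)) x) *v \<phi> x t) (at t))"

text \<open>Linear independence over the complex numbers of two vector functions of \<open>(x, t)\<close>.\<close>

definition lin_indep2 ::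
    "(real \<Rightarrow> real \<Rightarrow> complex^2) \<Rightarrow> (real \<Rightarrow> real \<Rightarrow> complex^2) \<Rightarrow> bool" where
  "lin_indep2 \<phi> \<psi> \<longleftrightarrow>
     (\<forall>a b. (\<forall>x t. a *s \<phi> x t + b *s \<psi> x t = 0) \<longrightarrow> a = 0 \<and> b = 0)"

end

theory Submission
  imports Defs "HOL-Complex_Analysis.Complex_Analysis"
begin

text \<open>
  In the variables \<open>r = p + q\<close>, \<open>s = p - q\<close> the spatial equation reads \<open>r' = u r + \<i> \<zeta> s\<close>,
  \<open>s' = \<i> \<zeta> r - u s\<close>, and the profile is
  \<open>\<phi> = \<nu> (Z(X - \<alpha>) - Z(X + \<alpha>) + H'(2\<alpha>)/H(2\<alpha>))\<close> at \<open>X = \<nu> x\<close>. Both equations are then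
  instances, for \<open>\<alpha>\<close> and \<open>- \<alpha>\<close>, of one identity: if \<open>a + b + c + d = 0\<close>, then
  \<open>H'/H(a) + Z(b) + Z(c) + H'/H(d)\<close> is a quotient of products of theta functions. It follows by
  differentiation from the bilinear formulas for \<open>H(x + y) H(x - y)\<close> and \<open>\<Theta>(x + y) \<Theta>(x - y)\<close>.
  The second solution is a multiple of the first one with \<open>\<gamma>\<close> replaced by \<open>- \<gamma>\<close>. The defect in the
  time equation solves the spatial equation, so that it vanishes once it vanishes at \<open>x = 0\<close>.

  The nome is defined through elliptic integrals, hence the modulus \<open>\<theta>\<^sub>2\<^sup>2/\<theta>\<^sub>3\<^sup>2\<close> at the nome of \<open>k\<close>
  must be shown to be \<open>k\<close>. Substituting theta quotients in the integrals along the real and the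
  imaginary axis shows that the nome of that modulus is the given one, and the nome is an injective
  function of the modulus. The substitutions need the location of the zeros of \<open>\<theta>\<^sub>1\<close>, which
  Landen's transformation reduces to small nomes.
\<close>

section \<open>Theta series\<close>

text \<open>The obstacle is that \<open>jacobi_sn\<close>, \<open>jacobi_cn\<close>,
  \<open>jacobi_dn\<close> are bare theta quotients whose prefactors involve \<open>k\<close>: even
  \<open>sn^2 + cn^2 = 1\<close> is open until \<open>k\<close> is known to be the quotient of null
  values at its own nome. The only series manipulation of substance is one rearrangement of a double
  series; all other identities come by half-period shifts, algebra, differentiation, or cancelling a
  factor by the identity theorem. The value of sn(\<alpha>) makes
  \<open>1 - k^2 sn^2(\<alpha>) sn^2(X)\<close> proportional to the denominator of \<phi>, so that
  the addition formula for Z produces \<phi>. It also gives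
  \<open>\<zeta>1 sn(2\<alpha>) = \<nu>\<close>, the origin of the factor \<zeta>1 in C. Regarded as
  a function of \<gamma>, the constant C satisfies
  \<open>C(\<gamma>) C(-\<gamma>) = \<zeta>^2\<close>, which is the given relation between \<zeta>
  and dn(\<gamma>); this closes the spatial system. The excluded values \<zeta>1, \<zeta>2, \<zeta>3
  belong to zeros of sn, cn, dn at \<gamma>, that is to \<mu> = 0. Elsewhere the factors exp(\<mu>
  t) and exp(-\<mu> t) separate the two solutions.\<close>

lemma summable_gauss_powser:
  fixes y :: complex
  assumes "0 < q" "q < 1"
  shows "summable (\<lambda>n. norm (of_real (q ^ n\<^sup>2) * y ^ n))"
proof -
  have "(\<lambda>n. q ^ n * norm y) \<longlonglongrightarrow> 0 * norm y"
    using assms by (intro tendsto_intros LIMSEQ_power_zero) auto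
  then have "\<forall>\<^sub>F n in sequentially. q ^ n * norm y < 1/2"
    by (intro order_tendstoD(2)) auto
  then have "\<forall>\<^sub>F n in sequentially. norm (norm (of_real (q ^ n\<^sup>2) * y ^ n)) \<le> (1/2) ^ n"
  proof eventually_elim
    case (elim n)
    have "norm (of_real (q ^ n\<^sup>2) * y ^ n) = (q ^ n * norm y) ^ n"
      using assms by (simp add: norm_mult norm_power power_mult_distrib power_mult power2_eq_square)
    also have "\<dots> \<le> (1/2) ^ n"
      using elim assms by (intro power_mono) auto
    finally show ?case by simp
  qed
  then show ?thesis
    by (rule summable_comparison_test_ev) (auto intro: summable_geometric)
qed

text \<open>The half \<open>n >= 0\<close> of the theta series, as a power series in
  \<open>w = exp (2 * \<i> * x)\<close>. Written through it, \<open>theta3\<close> is visibly entire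
  and depends on \<open>x\<close> only via \<open>exp (2 * \<i> * x)\<close>, which yields the
  period pi and \<open>th3_cong\<close>.\<close>

definition gauss_powser :: "real \<Rightarrow> complex \<Rightarrow> complex" where
  "gauss_powser q w = (\<Sum>n. of_real (q ^ n\<^sup>2) * w ^ n)"

lemma gauss_powser_has_sum:
  assumes "0 < q" "q < 1"
  shows "((\<lambda>n. of_real (q ^ n\<^sup>2) * w ^ n) has_sum gauss_powser q w) UNIV"
  unfolding gauss_powser_def
  using summable_gauss_powser[OF assms, of w]
  by (simp add: norm_summable_imp_has_sum summable_norm_cancel summable_sums)

lemma gauss_powser_Suc_sums:
  assumes "0 < q" "q < 1"
  shows "(\<lambda>n. of_real (q ^ (n+1)\<^sup>2) * w ^ (n+1)) sums (gauss_powser q w - 1)"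
  using has_sum_imp_sums[OF gauss_powser_has_sum[OF assms, of w]]
    sums_Suc_iff[of "\<lambda>n. of_real (q ^ n\<^sup>2) * w ^ n" "gauss_powser q w - 1"]
  by simp

lemma holomorphic_gauss_powser:
  assumes "0 < q" "q < 1"
  shows "gauss_powser q holomorphic_on UNIV"
proof -
  have "(gauss_powser q has_field_derivative (\<Sum>n. diffs (\<lambda>n. of_real (q ^ n\<^sup>2)) n * w ^ n)) (at w)" for w
    unfolding gauss_powser_def [abs_def]
    using summable_gauss_powser[OF assms]
    by (intro termdiffs_strong_converges_everywhere) (auto intro: summable_norm_cancel)
  then show ?thesis
    by (auto simp: holomorphic_on_def field_differentiable_def intro: has_field_derivative_at_within)
qed

text \<open>The subtracted 1 is the term of index 0, which both halves contain.\<close>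

lemma theta3_eq_gauss_powser:
  fixes x :: complex
  assumes "0 < q" "q < 1"
  shows "theta3 q x = gauss_powser q (exp (2 * \<i> * x)) + gauss_powser q (exp (- 2 * \<i> * x)) - 1"
proof -
  let ?w = "exp (2 * \<i> * x)" and ?v = "exp (- 2 * \<i> * x)"
  have "of_real (q ^ (n+1)\<^sup>2) * ?w ^ (n+1) + of_real (q ^ (n+1)\<^sup>2) * ?v ^ (n+1) =
        2 * (of_real (q ^ (n+1)\<^sup>2) * cos (of_nat (2 * (n+1)) * x))" for n
    by (simp only: cos_exp_eq exp_of_nat_mult [symmetric]) (simp add: algebra_simps)
  then have "(\<lambda>n. 2 * (of_real (q ^ (n+1)\<^sup>2) * cos (of_nat (2 * (n+1)) * x))) sums
        ((gauss_powser q ?w - 1) + (gauss_powser q ?v - 1))"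
    using sums_add[OF gauss_powser_Suc_sums[OF assms, of ?w] gauss_powser_Suc_sums[OF assms, of ?v]]
    by simp
  from sums_mult[OF this, of "1/2"]
  have "(\<lambda>n. of_real (q ^ (n+1)\<^sup>2) * cos (of_nat (2 * (n+1)) * x)) sums
        (((gauss_powser q ?w - 1) + (gauss_powser q ?v - 1)) / 2)"
    by simp
  from sums_unique[OF this, symmetric] show ?thesis
    unfolding theta3_def by (simp add: algebra_simps)
qed

lemma holomorphic_theta3:
  assumes "0 < q" "q < 1"
  shows "theta3 q holomorphic_on (UNIV :: complex set)"
proof -
  have eq: "theta3 q = (\<lambda>x. gauss_powser q (exp (2 * \<i> * x)) + gauss_powser q (exp (- 2 * \<i> * x)) - 1)"
    using theta3_eq_gauss_powser[OF assms] by (intro ext) 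
  have "gauss_powser q \<circ> (\<lambda>x. exp (2 * \<i> * x)) holomorphic_on UNIV"
       "gauss_powser q \<circ> (\<lambda>x. exp (- 2 * \<i> * x)) holomorphic_on UNIV"
    by (rule holomorphic_on_compose_gen[OF _ holomorphic_gauss_powser[OF assms]];
        auto intro!: holomorphic_intros)+
  then show ?thesis
    unfolding eq o_def by (intro holomorphic_intros)
qed

section \<open>Theta functions as unordered sums over the integers\<close>

lemma int_UNIV_eq: "(UNIV :: int set) = range int \<union> range (\<lambda>n. - int (Suc n))"
proof -
  have "i \<in> range int \<union> range (\<lambda>n. - int (Suc n))" for i
    by (cases i) auto
  then show ?thesis by auto
qed

lemma int_ranges_disjoint: "range int \<inter> range (\<lambda>n. - int (Suc n)) = {}"
  by auto

text \<open>The partner of \<open>n\<close> is \<open>- (n + 1)\<close> rather than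
  \<open>- n\<close> for the sake of half-integer exponents: \<open>n + 1/2\<close> and
  \<open>- (n + 1) + 1/2\<close> are opposite, so the two terms combine to a cosine in the series of
  \<open>theta2\<close>.\<close>

lemma has_sum_int_sums:
  fixes f :: "int \<Rightarrow> complex"
  assumes "(f has_sum S) UNIV"
  shows "(\<lambda>n. f (int n) + f (- int (Suc n))) sums S"
proof -
  have "f summable_on UNIV" using assms by (auto simp: summable_on_def)
  then have s: "f summable_on (range int)" "f summable_on (range (\<lambda>n. - int (Suc n)))"
    by (auto intro: summable_on_subset_banach)
  have "(f has_sum (infsum f (range int) + infsum f (range (\<lambda>n. - int (Suc n))))) UNIV"
    unfolding int_UNIV_eq
    by (intro has_sum_Un_disjoint has_sum_infsum s int_ranges_disjoint)
  then have S: "S = infsum f (range int) + infsum f (range (\<lambda>n. - int (Suc n)))"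
    using assms has_sum_unique by blast
  have "((f \<circ> int) has_sum infsum f (range int)) UNIV"
    using has_sum_infsum[OF s(1)] by (subst (asm) has_sum_reindex) (auto simp: inj_on_def)
  moreover have "((f \<circ> (\<lambda>n. - int (Suc n))) has_sum infsum f (range (\<lambda>n. - int (Suc n)))) UNIV"
    using has_sum_infsum[OF s(2)] by (subst (asm) has_sum_reindex) (auto simp: inj_on_def)
  ultimately show ?thesis
    unfolding S by (intro sums_add) (auto dest!: has_sum_imp_sums simp: o_def)
qed

lemma q_power_exp: "0 < q \<Longrightarrow> complex_of_real (q ^ m) = exp (of_real (ln q) * of_nat m)"
  by (metis exp_ln exp_of_real exp_of_real exp_of_nat2_mult of_real_power)

text \<open>Powers of \<open>q\<close> are written as exponentials so that shifts of the index by 1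
  or 1/2 and shifts of \<open>x\<close> by half periods all become algebra in one exponent. The sum
  is unordered so that it can be reindexed and multiplied freely.\<close>

lemma theta3_has_sum:
  fixes x :: complex
  assumes "0 < q" "q < 1"
  shows "((\<lambda>n::int. exp (of_real (ln q) * (of_int n)\<^sup>2 + 2 * \<i> * of_int n * x)) has_sum theta3 q x) UNIV"
proof -
  let ?f = "\<lambda>n::int. exp (of_real (ln q) * (of_int n)\<^sup>2 + 2 * \<i> * of_int n * x)"
  let ?w = "exp (2 * \<i> * x)" and ?v = "exp (- 2 * \<i> * x)"
  have f1: "?f \<circ> int = (\<lambda>n. of_real (q ^ n\<^sup>2) * ?w ^ n)"
    using assms by (auto simp: q_power_exp exp_of_nat_mult[symmetric] exp_add[symmetric] algebra_simps simp del: of_real_power)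
  have f2: "?f \<circ> (\<lambda>n. - int (Suc n)) = (\<lambda>n. of_real (q ^ (Suc n)\<^sup>2) * ?v ^ Suc n)"
    using assms by (intro ext; simp only: q_power_exp exp_of_nat_mult[symmetric] exp_add[symmetric] o_def)
      (simp add: algebra_simps power2_eq_square)
  have "((\<lambda>n. of_real (q ^ n\<^sup>2) * ?v ^ n) has_sum (gauss_powser q ?v - 1)) (UNIV - {0})"
    using has_sum_Diff[OF gauss_powser_has_sum[OF assms, of ?v] has_sum_finite[of "{0}"]] by simp
  moreover have "UNIV - {0} = range Suc"
    by (auto simp: image_iff) (metis not0_implies_Suc)
  ultimately have "((\<lambda>n. of_real (q ^ n\<^sup>2) * ?v ^ n) has_sum (gauss_powser q ?v - 1)) (range Suc)"
    by simp
  then have h2: "(?f has_sum (gauss_powser q ?v - 1)) (range (\<lambda>n. - int (Suc n)))"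
    by (subst has_sum_reindex, simp add: inj_on_def, subst f2)
       (subst (asm) has_sum_reindex, simp_all add: o_def)
  have h1: "(?f has_sum gauss_powser q ?w) (range int)"
    by (subst has_sum_reindex, simp add: inj_on_def, subst f1) (rule gauss_powser_has_sum[OF assms])
  have "(?f has_sum (gauss_powser q ?w + (gauss_powser q ?v - 1))) UNIV"
    unfolding int_UNIV_eq by (rule has_sum_Un_disjoint[OF h1 h2 int_ranges_disjoint])
  then show ?thesis
    by (simp only: theta3_eq_gauss_powser[OF assms, of x] add_diff_eq)
qed

text \<open>Completing the square turns the half-integer series into the integer one at a shifted
  argument, which reduces \<open>theta2\<close> to \<open>theta3\<close>.\<close>

lemma
  fixes x :: complex
  assumes "0 < q" "q < 1"
  shows theta2_has_sum: "((\<lambda>n::int. exp (of_real (ln q) * (of_int n + 1/2)\<^sup>2 + 2 * \<i> * (of_int n + 1/2) * x)) has_sum theta2 q x) UNIV"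
    and theta2_eq_theta3: "theta2 q x = exp (of_real (ln q) / 4 + \<i> * x) * theta3 q (x - \<i> * of_real (ln q) / 2)"
proof -
  let ?f = "\<lambda>n::int. exp (of_real (ln q) * (of_int n + 1/2)\<^sup>2 + 2 * \<i> * (of_int n + 1/2) * x)"
  let ?S = "exp (of_real (ln q) / 4 + \<i> * x) * theta3 q (x - \<i> * of_real (ln q) / 2)"
  have "?f n = exp (of_real (ln q) / 4 + \<i> * x) *
      exp (of_real (ln q) * (of_int n)\<^sup>2 + 2 * \<i> * of_int n * (x - \<i> * of_real (ln q) / 2))" for n
    unfolding exp_add[symmetric] by (rule arg_cong[of _ _ exp]) (simp add: field_simps power2_eq_square)
  then have h: "(?f has_sum ?S) UNIV"
    using has_sum_cmult_right[OF theta3_has_sum[OF assms, of "x - \<i> * of_real (ln q) / 2"]] by simp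
  have "?f (int n) + ?f (- int (Suc n)) =
      2 * (of_real (q powr ((real n + 1/2)\<^sup>2)) * cos (of_nat (2 * n + 1) * x))" for n
  proof -
    have "complex_of_real (q powr ((real n + 1/2)\<^sup>2)) = exp (of_real (ln q) * (of_nat n + 1/2)\<^sup>2)"
      using assms by (simp add: powr_def exp_of_real[symmetric] mult.commute)
    moreover have "?f (int n) = exp (of_real (ln q) * (of_nat n + 1/2)\<^sup>2) * exp (\<i> * (of_nat (2 * n + 1) * x))"
      unfolding exp_add[symmetric] by (rule arg_cong[of _ _ exp]) (simp add: field_simps)
    moreover have "?f (- int (Suc n)) = exp (of_real (ln q) * (of_nat n + 1/2)\<^sup>2) * exp (- (\<i> * (of_nat (2 * n + 1) * x)))"
      unfolding exp_add[symmetric] by (rule arg_cong[of _ _ exp]) (simp add: field_simps power2_eq_square)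
    ultimately show ?thesis
      unfolding cos_exp_eq by (simp only:) (simp add: algebra_simps)
  qed
  then have "(\<lambda>n. 2 * (of_real (q powr ((real n + 1/2)\<^sup>2)) * cos (of_nat (2 * n + 1) * x))) sums ?S"
    using has_sum_int_sums[OF h] by simp
  from sums_mult[OF this, of "1/2"]
  have "(\<lambda>n. of_real (q powr ((real n + 1/2)\<^sup>2)) * cos (of_nat (2 * n + 1) * x)) sums (?S / 2)"
    by simp
  from sums_unique[OF this, symmetric] show eq: "theta2 q x = ?S"
    unfolding theta2_def by (simp add: algebra_simps)
  show "(?f has_sum theta2 q x) UNIV" using h eq by simp
qed

lemma theta4_eq_theta3:
  fixes x :: complex
  shows "theta4 q x = theta3 q (x + of_real pi / 2)"
proof -
  have "cos (of_nat (2 * (n+1)) * (x + of_real pi / 2)) = (-1) ^ (n+1) * cos (of_nat (2 * (n+1)) * x)" for n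
  proof -
    have "of_nat (2 * (n+1)) * (x + of_real pi / 2) = of_nat (2 * (n+1)) * x + of_nat (n+1) * of_real pi"
      by (simp add: field_simps)
    moreover have "cos (of_nat m * complex_of_real pi) = (-1)^m" for m
      by (metis cos_npi cos_of_real of_real_1 of_real_minus of_real_mult of_real_of_nat_eq of_real_power)
    moreover have "sin (of_nat m * complex_of_real pi) = 0" for m
      by (metis of_real_0 of_real_mult of_real_of_nat_eq sin_npi sin_of_real)
    ultimately show ?thesis by (simp only: cos_add) simp
  qed
  then show ?thesis unfolding theta4_def theta3_def by (simp add: algebra_simps)
qed

lemma theta1_eq_theta2:
  fixes x :: complex
  shows "theta1 q x = theta2 q (x - of_real pi / 2)"
proof -
  have "cos (of_nat (2 * n + 1) * (x - of_real pi / 2)) = (-1) ^ n * sin (of_nat (2 * n + 1) * x)" for n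
  proof -
    have "of_nat (2 * n + 1) * (x - of_real pi / 2) = of_nat (2 * n + 1) * x - of_real pi / 2 - of_nat n * of_real pi"
      by (simp add: field_simps)
    moreover have "cos (of_nat n * complex_of_real pi) = (-1)^n"
      by (metis cos_npi cos_of_real of_real_1 of_real_minus of_real_mult of_real_of_nat_eq of_real_power)
    moreover have "sin (of_nat n * complex_of_real pi) = 0"
      by (metis of_real_0 of_real_mult of_real_of_nat_eq sin_npi sin_of_real)
    moreover have "cos (complex_of_real pi / 2) = 0" "sin (complex_of_real pi / 2) = 1"
      by (metis cos_of_real cos_pi_half of_real_0 of_real_divide of_real_numeral)
         (metis sin_of_real sin_pi_half of_real_1 of_real_divide of_real_numeral)
    ultimately show ?thesis by (simp only: cos_diff sin_diff) simp
  qed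
  then show ?thesis unfolding theta1_def theta2_def by (simp add: algebra_simps)
qed

section \<open>Multiplication of theta series\<close>

lemma has_sum_product_complex:
  fixes f :: "'a \<Rightarrow> complex" and g :: "'b \<Rightarrow> complex"
  assumes f: "(f has_sum a) A" and g: "(g has_sum b) B"
  shows "((\<lambda>(i, j). f i * g j) has_sum a * b) (A \<times> B)"
proof (rule has_sum_SigmaI)
  show "((\<lambda>j. case (i, j) of (i, j) \<Rightarrow> f i * g j) has_sum f i * b) B" for i
    using has_sum_cmult_right[OF g] by simp
  show "((\<lambda>i. f i * b) has_sum a * b) A"
    using has_sum_cmult_left[OF f] by simp
  have nf: "(\<lambda>i. norm (f i)) summable_on A" and ng: "(\<lambda>j. norm (g j)) summable_on B"
    using f g summable_on_iff_abs_summable_on_complex by (auto simp: summable_on_def)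
  have "(\<lambda>(i, j). norm (f i) * norm (g j)) summable_on (A \<times> B)"
  proof (rule summable_on_SigmaI)
    show "((\<lambda>j. case (i, j) of (i, j) \<Rightarrow> norm (f i) * norm (g j)) has_sum norm (f i) * infsum (\<lambda>j. norm (g j)) B) B" for i
      using has_sum_cmult_right[OF has_sum_infsum[OF ng]] by simp
    show "(\<lambda>i. norm (f i) * infsum (\<lambda>j. norm (g j)) B) summable_on A"
      using nf by (rule summable_on_cmult_left)
  qed auto
  then have "(\<lambda>p. norm (case p of (i, j) \<Rightarrow> f i * g j)) summable_on (A \<times> B)"
    by (simp add: case_prod_unfold norm_mult)
  then show "(\<lambda>(i, j). f i * g j) summable_on (A \<times> B)"
    by (rule abs_summable_summable)
qed

text \<open>
  The product is a double series over pairs \<open>(m, n)\<close>. Those with \<open>m + n\<close> even are \<open>(j + l, j - l)\<close>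
  and give the first term; those with \<open>m + n\<close> odd are \<open>(j + l + 1, j - l)\<close> and give the second.
\<close>

lemma theta3_product:
  fixes x y :: complex
  assumes q: "0 < q" "q < 1"
  shows "theta3 q (x + y) * theta3 q (x - y) =
    theta3 (q\<^sup>2) (2 * x) * theta3 (q\<^sup>2) (2 * y) + theta2 (q\<^sup>2) (2 * x) * theta2 (q\<^sup>2) (2 * y)"
proof -
  have q2: "0 < q\<^sup>2" "q\<^sup>2 < 1" using q by (auto simp: power_less_one_iff)
  let ?L = "complex_of_real (ln q)"
  have lnq: "complex_of_real (ln (q\<^sup>2)) = 2 * ?L" using q by (simp add: ln_realpow)
  define F where "F = (\<lambda>(m::int, n::int). exp (?L * (of_int m)\<^sup>2 + 2 * \<i> * of_int m * (x + y)) *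
      exp (?L * (of_int n)\<^sup>2 + 2 * \<i> * of_int n * (x - y)))"
  define e where "e = (\<lambda>(j::int, l::int). (j + l, j - l))"
  define d where "d = (\<lambda>(j::int, l::int). (j + l + 1, j - l))"
  have tot: "(F has_sum theta3 q (x + y) * theta3 q (x - y)) UNIV"
    using has_sum_product_complex[OF theta3_has_sum[OF q, of "x+y"] theta3_has_sum[OF q, of "x-y"]]
    by (simp add: F_def)
  have inj: "inj e" "inj d" by (auto simp: inj_on_def e_def d_def)
  have un: "range e \<union> range d = UNIV"
  proof -
    have "(m, n) \<in> range e \<union> range d" for m n
    proof (cases "even (m + n)")
      case True
      then obtain s where "m + n = 2 * s" by (elim evenE)
      then have "(m, n) = e (s, m - s)" by (simp add: e_def)
      then show ?thesis by blast
    next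
      case False
      then obtain s where "m + n = 2 * s + 1" by (elim oddE)
      then have "(m, n) = d (s, m - s - 1)" by (simp add: d_def)
      then show ?thesis by blast
    qed
    then show ?thesis by auto
  qed
  have dis: "range e \<inter> range d = {}"
  proof -
    have "e p \<noteq> d r" for p r
      by (cases p; cases r; auto simp: e_def d_def) presburger
    then show ?thesis by blast
  qed
  have "F \<circ> e = (\<lambda>(j, l). exp (of_real (ln (q\<^sup>2)) * (of_int j)\<^sup>2 + 2 * \<i> * of_int j * (2 * x)) *
      exp (of_real (ln (q\<^sup>2)) * (of_int l)\<^sup>2 + 2 * \<i> * of_int l * (2 * y)))"
  proof (intro ext, clarify)
    fix j l :: int
    show "(F \<circ> e) (j, l) = exp (of_real (ln (q\<^sup>2)) * (of_int j)\<^sup>2 + 2 * \<i> * of_int j * (2 * x)) *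
      exp (of_real (ln (q\<^sup>2)) * (of_int l)\<^sup>2 + 2 * \<i> * of_int l * (2 * y))"
      unfolding lnq F_def e_def o_def prod.case exp_add[symmetric]
      by (rule arg_cong[of _ _ exp]) (simp add: field_simps power2_eq_square)
  qed
  then have he: "(F has_sum theta3 (q\<^sup>2) (2 * x) * theta3 (q\<^sup>2) (2 * y)) (range e)"
    using has_sum_product_complex[OF theta3_has_sum[OF q2, of "2*x"] theta3_has_sum[OF q2, of "2*y"]]
    by (subst has_sum_reindex) (auto simp: inj)
  have "F \<circ> d = (\<lambda>(j, l). exp (of_real (ln (q\<^sup>2)) * (of_int j + 1/2)\<^sup>2 + 2 * \<i> * (of_int j + 1/2) * (2 * x)) *
      exp (of_real (ln (q\<^sup>2)) * (of_int l + 1/2)\<^sup>2 + 2 * \<i> * (of_int l + 1/2) * (2 * y)))"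
  proof (intro ext, clarify)
    fix j l :: int
    show "(F \<circ> d) (j, l) = exp (of_real (ln (q\<^sup>2)) * (of_int j + 1/2)\<^sup>2 + 2 * \<i> * (of_int j + 1/2) * (2 * x)) *
      exp (of_real (ln (q\<^sup>2)) * (of_int l + 1/2)\<^sup>2 + 2 * \<i> * (of_int l + 1/2) * (2 * y))"
      unfolding lnq F_def d_def o_def prod.case exp_add[symmetric]
      by (rule arg_cong[of _ _ exp]) (simp add: field_simps power2_eq_square)
  qed
  then have hd: "(F has_sum theta2 (q\<^sup>2) (2 * x) * theta2 (q\<^sup>2) (2 * y)) (range d)"
    using has_sum_product_complex[OF theta2_has_sum[OF q2, of "2*x"] theta2_has_sum[OF q2, of "2*y"]]
    by (subst has_sum_reindex) (auto simp: inj)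
  have "(F has_sum (theta3 (q\<^sup>2) (2 * x) * theta3 (q\<^sup>2) (2 * y) + theta2 (q\<^sup>2) (2 * x) * theta2 (q\<^sup>2) (2 * y))) UNIV"
    using has_sum_Un_disjoint[OF he hd dis] un by simp
  then show ?thesis using tot has_sum_unique by blast
qed

subsection \<open>Shifts by half periods\<close>

locale theta_nome =
  fixes q :: real
  assumes q_pos: "0 < q" and q_less_1: "q < 1"
begin

text \<open>The half period of the theta functions along the imaginary axis is \<open>\<i> * ht\<close>.\<close>

definition ht :: real where "ht = - ln q / 2"

lemma ht_pos: "0 < ht"
  using q_pos q_less_1 by (simp add: ht_def)

abbreviation "th1 \<equiv> (theta1 q :: complex \<Rightarrow> complex)"
abbreviation "th2 \<equiv> (theta2 q :: complex \<Rightarrow> complex)"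
abbreviation "th3 \<equiv> (theta3 q :: complex \<Rightarrow> complex)"
abbreviation "th4 \<equiv> (theta4 q :: complex \<Rightarrow> complex)"

lemma th3_minus [simp]: "th3 (- x) = th3 x"
  unfolding theta3_def by simp
lemma th2_minus [simp]: "th2 (- x) = th2 x"
  unfolding theta2_def by simp
lemma th4_minus [simp]: "th4 (- x) = th4 x"
  unfolding theta4_def by simp

lemma th3_plus_pi: "th3 (x + of_real pi) = th3 x"
proof -
  have "exp (2 * \<i> * (x + of_real pi)) = exp (2 * \<i> * x)"
    using exp_plus_2pin[of "2 * \<i> * x" 1] by (simp add: algebra_simps)
  moreover have "exp (- 2 * \<i> * (x + of_real pi)) = exp (- 2 * \<i> * x)"
    using exp_plus_2pin[of "- 2 * \<i> * x" "-1"] by (simp add: algebra_simps)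
  ultimately show ?thesis
    by (simp only: theta3_eq_gauss_powser[OF q_pos q_less_1])
qed

lemma th2_plus_pi: "th2 (x + of_real pi) = - th2 x"
  unfolding theta2_eq_theta3[OF q_pos q_less_1]
  using th3_plus_pi[of "x - \<i> * of_real (ln q) / 2"] by (simp add: algebra_simps exp_add)

lemma th4_plus_half_pi: "th4 (x + of_real pi / 2) = th3 x"
  using th3_plus_pi[of x] by (simp add: theta4_eq_theta3 add.assoc flip: field_sum_of_halves)

lemma th1_plus_half_pi: "th1 (x + of_real pi / 2) = th2 x"
  by (simp add: theta1_eq_theta2)

lemma th2_plus_half_pi: "th2 (x + of_real pi / 2) = - th1 x"
  using th2_plus_pi[of "x - of_real pi / 2"] by (simp add: theta1_eq_theta2 algebra_simps)

lemma th1_minus [simp]: "th1 (- x) = - th1 x"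
  using th2_minus[of "x + of_real pi / 2"] th2_plus_half_pi[of x]
  by (simp add: theta1_eq_theta2)

lemma th1_0 [simp]: "th1 0 = 0"
  using th1_minus[of 0] by simp

text \<open>This is \<open>q\<close> to the power -1/4, the constant factor in the shifts by the
  imaginary half period.\<close>

abbreviation "qf \<equiv> complex_of_real (exp (ht / 2))"

lemma qf_eq: "qf = exp (- of_real (ln q) / 4)"
  by (simp add: ht_def flip: exp_of_real)

lemma th3_plus_ht: "th3 (x + \<i> * of_real ht) = qf * exp (- \<i> * x) * th2 x"
  unfolding theta2_eq_theta3[OF q_pos q_less_1] qf_eq
  by (simp add: ht_def exp_add[symmetric] mult.assoc[symmetric])

text \<open>Raising the index by one changes the exponent just as moving \<open>x\<close> by the
  full imaginary period does, up to a summand that is free of the index.\<close>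

lemma th3_plus_2ht: "th3 (x + 2 * \<i> * of_real ht) = qf ^ 4 * exp (- 2 * \<i> * x) * th3 x"
proof -
  have "((\<lambda>n. exp (- of_real (ln q) - 2 * \<i> * x) * exp (of_real (ln q) * (of_int n)\<^sup>2 + 2 * \<i> * of_int n * x)) has_sum
        exp (- of_real (ln q) - 2 * \<i> * x) * th3 x) UNIV"
    by (intro has_sum_cmult_right theta3_has_sum q_pos q_less_1)
  then have "((\<lambda>n. exp (- of_real (ln q) - 2 * \<i> * x) * exp (of_real (ln q) * (of_int (n+1))\<^sup>2 + 2 * \<i> * of_int (n+1) * x)) has_sum
        exp (- of_real (ln q) - 2 * \<i> * x) * th3 x) UNIV"
    by (subst has_sum_reindex_bij_witness[of UNIV "\<lambda>n. n - 1" "\<lambda>n. n + 1" UNIV]) auto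
  moreover have "exp (- of_real (ln q) - 2 * \<i> * x) * exp (of_real (ln q) * (of_int (n+1))\<^sup>2 + 2 * \<i> * of_int (n+1) * x) =
      exp (of_real (ln q) * (of_int n)\<^sup>2 + 2 * \<i> * of_int n * (x + 2 * \<i> * of_real ht))" for n
    unfolding exp_add[symmetric] ht_def by (rule arg_cong[of _ _ exp]) (simp add: field_simps power2_eq_square)
  ultimately have "((\<lambda>n. exp (of_real (ln q) * (of_int n)\<^sup>2 + 2 * \<i> * of_int n * (x + 2 * \<i> * of_real ht))) has_sum
        exp (- of_real (ln q) - 2 * \<i> * x) * th3 x) UNIV"
    by simp
  then have "th3 (x + 2 * \<i> * of_real ht) = exp (- of_real (ln q) - 2 * \<i> * x) * th3 x"
    using theta3_has_sum[OF q_pos q_less_1] has_sum_unique by blast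
  moreover have "qf ^ 4 * exp (- 2 * \<i> * x) = exp (- of_real (ln q) - 2 * \<i> * x)"
    unfolding qf_eq exp_of_nat_mult[symmetric] exp_add[symmetric] by (rule arg_cong[of _ _ exp]) simp
  ultimately show ?thesis by simp
qed

text \<open>Two half-period shifts of \<open>th3\<close> make a full one; comparing both evaluations
  and cancelling the exponentials leaves \<open>th2\<close>.\<close>

lemma th2_plus_ht: "th2 (x + \<i> * of_real ht) = qf * exp (- \<i> * x) * th3 x"
proof -
  have "qf * exp (- \<i> * (x + \<i> * of_real ht)) * th2 (x + \<i> * of_real ht) = qf ^ 4 * exp (- 2 * \<i> * x) * th3 x"
    using th3_plus_ht[of "x + \<i> * of_real ht"] th3_plus_2ht[of x] by (simp only: mult_2 distrib_right add.assoc[symmetric])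
  moreover have "exp (- \<i> * (x + \<i> * of_real ht)) = qf ^ 2 * exp (- \<i> * x)"
    unfolding exp_of_real[symmetric] exp_of_nat_mult[symmetric] exp_add[symmetric]
    by (rule arg_cong[of _ _ exp]) (simp add: algebra_simps)
  moreover have "exp (- 2 * \<i> * x) = exp (- \<i> * x) * exp (- \<i> * x)"
    unfolding exp_add[symmetric] by (rule arg_cong[of _ _ exp]) simp
  ultimately show ?thesis by (simp add: power_numeral_reduce)
qed

lemma th1_plus_ht: "th1 (x + \<i> * of_real ht) = \<i> * qf * exp (- \<i> * x) * th4 x"
proof -
  have "th1 (x + \<i> * of_real ht) = qf * exp (- \<i> * (x - of_real pi / 2)) * th3 (x - of_real pi / 2)"
    using th2_plus_ht[of "x - of_real pi / 2"] by (simp add: theta1_eq_theta2 algebra_simps)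
  moreover have "th3 (x - of_real pi / 2) = th4 x"
    using th4_plus_half_pi[of "x - of_real pi / 2"] by simp
  moreover have "exp (- \<i> * (x - of_real pi / 2)) = \<i> * exp (- \<i> * x)"
  proof -
    have "exp (- \<i> * (x - of_real pi / 2)) = exp (\<i> * of_real (pi / 2)) * exp (- \<i> * x)"
      unfolding exp_add[symmetric] by (rule arg_cong[of _ _ exp]) (simp add: algebra_simps)
    then show ?thesis by (simp only: cis_conv_exp[symmetric] cis_pi_half)
  qed
  ultimately show ?thesis by simp
qed

lemma holomorphic_th3: "th3 holomorphic_on UNIV"
  by (rule holomorphic_theta3[OF q_pos q_less_1])

lemma holomorphic_th2: "th2 holomorphic_on UNIV"
proof -
  have eq: "th2 = (\<lambda>x. exp (of_real (ln q) / 4 + \<i> * x) * (th3 \<circ> (\<lambda>x. x - \<i> * of_real (ln q) / 2)) x)"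
    by (auto simp: theta2_eq_theta3[OF q_pos q_less_1])
  show ?thesis
    by (subst eq) (intro holomorphic_intros holomorphic_on_compose holomorphic_on_subset[OF holomorphic_th3], auto)
qed

lemma holomorphic_th1: "th1 holomorphic_on UNIV"
proof -
  have eq: "th1 = th2 \<circ> (\<lambda>x. x - of_real pi / 2)"
    by (auto simp: theta1_eq_theta2)
  show ?thesis
    by (subst eq) (intro holomorphic_intros holomorphic_on_compose holomorphic_on_subset[OF holomorphic_th2], auto)
qed

lemma holomorphic_th4: "th4 holomorphic_on UNIV"
proof -
  have eq: "th4 = th3 \<circ> (\<lambda>x. x + of_real pi / 2)"
    by (auto simp: theta4_eq_theta3)
  show ?thesis
    by (subst eq) (intro holomorphic_intros holomorphic_on_compose holomorphic_on_subset[OF holomorphic_th3], auto)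
qed

subsection \<open>Bilinear identities\<close>

text \<open>The squares of all four theta functions are linear combinations of \<open>th3d x\<close>
  and \<open>th2d x\<close> with null values as coefficients. Expressed in this pair, the quadratic
  theta relations become polynomial identities that \<open>algebra\<close> decides.\<close>

definition th3d :: "complex \<Rightarrow> complex" where "th3d x = theta3 (q\<^sup>2) (2 * x)"
definition th2d :: "complex \<Rightarrow> complex" where "th2d x = theta2 (q\<^sup>2) (2 * x)"

lemma theta_nome_square: "theta_nome (q\<^sup>2)"
  using q_pos q_less_1 by unfold_locales (auto simp: power_less_one_iff)

interpretation sq: theta_nome "q\<^sup>2"
  by (rule theta_nome_square)

lemma ht_square: "theta_nome.ht (q\<^sup>2) = 2 * ht"
  using q_pos by (simp add: sq.ht_def ht_def ln_realpow)

lemma th3_prod: "th3 (x + y) * th3 (x - y) = th3d x * th3d y + th2d x * th2d y"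
  using theta3_product[OF q_pos q_less_1] by (simp add: th3d_def th2d_def)

lemma th3d_plus_ht: "th3d (x + \<i> * of_real ht) = qf\<^sup>2 * exp (- 2 * \<i> * x) * th2d x"
proof -
  have "2 * (x + \<i> * of_real ht) = 2 * x + \<i> * of_real sq.ht"
    by (simp add: ht_square algebra_simps)
  moreover have "sq.qf = qf\<^sup>2"
    by (simp add: ht_square exp_of_real[symmetric] exp_of_nat_mult[symmetric])
  ultimately show ?thesis
    using sq.th3_plus_ht[of "2 * x"] by (simp add: th3d_def th2d_def algebra_simps)
qed

lemma th2d_plus_ht: "th2d (x + \<i> * of_real ht) = qf\<^sup>2 * exp (- 2 * \<i> * x) * th3d x"
proof -
  have "2 * (x + \<i> * of_real ht) = 2 * x + \<i> * of_real sq.ht"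
    by (simp add: ht_square algebra_simps)
  moreover have "sq.qf = qf\<^sup>2"
    by (simp add: ht_square exp_of_real[symmetric] exp_of_nat_mult[symmetric])
  ultimately show ?thesis
    using sq.th2_plus_ht[of "2 * x"] by (simp add: th3d_def th2d_def algebra_simps)
qed

lemma th3d_plus_half_pi: "th3d (x + of_real pi / 2) = th3d x"
  and th2d_plus_half_pi: "th2d (x + of_real pi / 2) = - th2d x"
  using sq.th3_plus_pi[of "2 * x"] sq.th2_plus_pi[of "2 * x"]
  by (simp_all add: th3d_def th2d_def distrib_left)

text \<open>Moving \<open>x\<close> alone by the half period turns both factors of
  \<open>th3_prod\<close> into \<open>th2\<close> and swaps \<open>th3d x\<close> with
  \<open>th2d x\<close>; the exponential factors on the two sides agree and cancel.\<close>

lemma th2_prod: "th2 (x + y) * th2 (x - y) = th3d x * th2d y + th2d x * th3d y"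
proof -
  let ?X = "x + \<i> * of_real ht"
  have "qf * exp (- \<i> * (x + y)) * th2 (x + y) * (qf * exp (- \<i> * (x - y)) * th2 (x - y)) =
        th3 (?X + y) * th3 (?X - y)"
    using th3_plus_ht[of "x + y"] th3_plus_ht[of "x - y"] by (simp add: add_ac diff_add_eq)
  also have "\<dots> = qf\<^sup>2 * exp (- 2 * \<i> * x) * (th3d x * th2d y + th2d x * th3d y)"
    unfolding th3_prod th3d_plus_ht th2d_plus_ht by (simp add: algebra_simps)
  also have "exp (- 2 * \<i> * x) = exp (- \<i> * (x + y)) * exp (- \<i> * (x - y))"
    unfolding exp_add[symmetric] by (rule arg_cong[of _ _ exp]) (simp add: algebra_simps)
  finally show ?thesis by (simp add: power2_eq_square)
qed

lemma th4_prod: "th4 (x + y) * th4 (x - y) = th3d x * th3d y - th2d x * th2d y"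
  using th3_prod[of "x + of_real pi / 2" y]
  by (simp add: theta4_eq_theta3 th3d_plus_half_pi th2d_plus_half_pi add_ac diff_add_eq)

lemma th1_prod: "th1 (x + y) * th1 (x - y) = th3d x * th2d y - th2d x * th3d y"
  using th2_prod[of "x - of_real pi / 2" y] th3d_plus_half_pi[of "x - of_real pi / 2"]
    th2d_plus_half_pi[of "x - of_real pi / 2"]
  by (simp add: theta1_eq_theta2 algebra_simps)

lemma th1_sq: "(th1 x)\<^sup>2 = th3d x * th2d 0 - th2d x * th3d 0"
  and th2_sq: "(th2 x)\<^sup>2 = th3d x * th2d 0 + th2d x * th3d 0"
  and th3_sq: "(th3 x)\<^sup>2 = th3d x * th3d 0 + th2d x * th2d 0"
  and th4_sq: "(th4 x)\<^sup>2 = th3d x * th3d 0 - th2d x * th2d 0"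
  using th1_prod[of x 0] th2_prod[of x 0] th3_prod[of x 0] th4_prod[of x 0]
  by (simp_all add: power2_eq_square)

text \<open>The squares of \<open>th1\<close> and \<open>th4\<close> are a linear image of
  \<open>(th3d, th2d)\<close> with determinant \<open>(th4 0)\<^sup>2\<close>, and the product on
  the left is the alternating form of that pair at \<open>x\<close> and \<open>y\<close>.\<close>

lemma th1_add_diff: "(th4 0)\<^sup>2 * (th1 (x + y) * th1 (x - y)) = (th1 x)\<^sup>2 * (th4 y)\<^sup>2 - (th4 x)\<^sup>2 * (th1 y)\<^sup>2"
  unfolding th1_prod th1_sq th4_sq by algebra

lemma th4_add_diff: "(th4 0)\<^sup>2 * (th4 (x + y) * th4 (x - y)) = (th4 x)\<^sup>2 * (th4 y)\<^sup>2 - (th1 x)\<^sup>2 * (th1 y)\<^sup>2"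
  unfolding th4_prod th1_sq th4_sq by algebra

lemma th2_sq_eq: "(th4 0)\<^sup>2 * (th2 x)\<^sup>2 = (th2 0)\<^sup>2 * (th4 x)\<^sup>2 - (th3 0)\<^sup>2 * (th1 x)\<^sup>2"
  unfolding th1_sq th2_sq th3_sq th4_sq by algebra

lemma th3_sq_eq: "(th4 0)\<^sup>2 * (th3 x)\<^sup>2 = (th3 0)\<^sup>2 * (th4 x)\<^sup>2 - (th2 0)\<^sup>2 * (th1 x)\<^sup>2"
  unfolding th1_sq th2_sq th3_sq th4_sq by algebra

text \<open>With \<open>A = th3d 0\<close> and \<open>B = th2d 0\<close> the squared null values are
  \<open>A^2 + B^2\<close>, \<open>2 A B\<close> and \<open>A^2 - B^2\<close>, a Pythagorean
  triple.\<close>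

lemma th_null_quartic: "th3 0 ^ 4 = th2 0 ^ 4 + th4 0 ^ 4"
proof -
  have "th3 0 ^ 4 = ((th3 0)\<^sup>2)\<^sup>2" "th2 0 ^ 4 = ((th2 0)\<^sup>2)\<^sup>2" "th4 0 ^ 4 = ((th4 0)\<^sup>2)\<^sup>2" by simp_all
  then show ?thesis unfolding th2_sq th3_sq th4_sq by algebra
qed

text \<open>The quarter shifts \<open>x + pi/4\<close> and \<open>y - pi/4\<close> keep
  \<open>x + y\<close> and add pi/2 to \<open>x - y\<close>, so that one factor becomes
  \<open>th4\<close>. On the right, where arguments are doubled, they act as half shifts. The case
  \<open>y = 0\<close> is Landen's transformation.\<close>

lemma th3_th4_prod: "th3 (x + y) * th4 (x - y) =
    theta4 (q\<^sup>2) (2 * x) * theta4 (q\<^sup>2) (2 * y) - theta1 (q\<^sup>2) (2 * x) * theta1 (q\<^sup>2) (2 * y)"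
proof -
  have "th3 (x + y) * th4 (x - y) = th3d (x + of_real pi / 4) * th3d (y - of_real pi / 4) +
      th2d (x + of_real pi / 4) * th2d (y - of_real pi / 4)"
    using th3_prod[of "x + of_real pi / 4" "y - of_real pi / 4"] by (simp add: theta4_eq_theta3 algebra_simps)
  moreover have "th3d (x + of_real pi / 4) = theta4 (q\<^sup>2) (2 * x)"
    by (simp add: th3d_def theta4_eq_theta3 algebra_simps)
  moreover have "th3d (y - of_real pi / 4) = theta4 (q\<^sup>2) (2 * y)"
    using sq.th4_plus_half_pi[of "2 * y - of_real pi / 2"] by (simp add: th3d_def algebra_simps)
  moreover have "th2d (x + of_real pi / 4) = - theta1 (q\<^sup>2) (2 * x)"
    using sq.th2_plus_half_pi[of "2 * x"] by (simp add: th2d_def algebra_simps)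
  moreover have "th2d (y - of_real pi / 4) = theta1 (q\<^sup>2) (2 * y)"
    by (simp add: th2d_def theta1_eq_theta2 algebra_simps)
  ultimately show ?thesis by simp
qed

lemma th1_th2_prod: "th1 (x + y) * th2 (x - y) =
    theta4 (q\<^sup>2) (2 * x) * theta1 (q\<^sup>2) (2 * y) + theta1 (q\<^sup>2) (2 * x) * theta4 (q\<^sup>2) (2 * y)"
proof -
  have "th1 (x + y) * th2 (x - y) = th3d (x - of_real pi / 4) * th2d (y - of_real pi / 4) +
      th2d (x - of_real pi / 4) * th3d (y - of_real pi / 4)"
    using th2_prod[of "x - of_real pi / 4" "y - of_real pi / 4"] by (simp add: theta1_eq_theta2 algebra_simps)
  moreover have "th3d (y - of_real pi / 4) = theta4 (q\<^sup>2) (2 * y)" for y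
    using sq.th4_plus_half_pi[of "2 * y - of_real pi / 2"] by (simp add: th3d_def algebra_simps)
  moreover have "th2d (y - of_real pi / 4) = theta1 (q\<^sup>2) (2 * y)" for y
    by (simp add: th2d_def theta1_eq_theta2 algebra_simps)
  ultimately show ?thesis by simp
qed

lemma th1_th2_landen: "th1 x * th2 x = theta1 (q\<^sup>2) (2 * x) * theta4 (q\<^sup>2) 0"
  using th1_th2_prod[of x 0] by simp

lemma th3_th4_landen: "th3 x * th4 x = theta4 (q\<^sup>2) (2 * x) * theta4 (q\<^sup>2) 0"
  using th3_th4_prod[of x 0] by simp

text \<open>The nome \<open>q^2\<close> is only an intermediary: all the products involved are
  Landen products, and eliminating the functions of nome \<open>q^2\<close> among them leaves the
  duplication formula.\<close>

lemma th1_double: "th1 (2 * x) * (th2 0 * th3 0 * th4 0) = 2 * (th1 x * th2 x * th3 x * th4 x)"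
proof -
  have "th1 (2 * x) * th2 0 = 2 * theta1 (q\<^sup>2) (2 * x) * theta4 (q\<^sup>2) (2 * x)"
    using th1_th2_prod[of x x] by simp
  moreover have "th3 0 * th4 0 = theta4 (q\<^sup>2) 0 * theta4 (q\<^sup>2) (0::complex)"
    using th3_th4_landen[of 0] by simp
  ultimately show ?thesis
    using th1_th2_landen[of x] th3_th4_landen[of x] by algebra
qed

end

subsection \<open>Real values and positivity\<close>

lemma suminf_of_real_bounded:
  fixes f :: "nat \<Rightarrow> real"
  assumes "0 < q" "q < 1" and "\<And>n. \<bar>f n\<bar> \<le> q ^ n"
  shows "summable f" "(\<Sum>n. complex_of_real (f n)) = of_real (\<Sum>n. f n)"
proof -
  show "summable f"
    by (rule summable_comparison_test[of _ "\<lambda>n. q ^ n"]) (use assms in \<open>auto intro: summable_geometric\<close>)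
  then show "(\<Sum>n. complex_of_real (f n)) = of_real (\<Sum>n. f n)"
    by (rule suminf_of_real[symmetric])
qed

context theta_nome
begin

lemma theta_coeff_bounds:
  shows "\<bar>q ^ (n+1)\<^sup>2\<bar> \<le> q ^ n" "\<bar>q powr ((real n + 1/2)\<^sup>2)\<bar> \<le> q ^ n"
proof -
  have "q ^ (n+1)\<^sup>2 \<le> q ^ n"
    using q_pos q_less_1 by (intro power_decreasing) (auto simp: power2_eq_square)
  then show "\<bar>q ^ (n+1)\<^sup>2\<bar> \<le> q ^ n" using q_pos by simp
  have "q powr ((real n + 1/2)\<^sup>2) \<le> q powr (real n)"
  proof (rule powr_mono')
    have "real n * 1 \<le> real n * real n + real n * 1" by simp
    then show "real n \<le> (real n + 1/2)\<^sup>2" by (simp add: power2_eq_square algebra_simps)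
  qed (use q_pos q_less_1 in auto)
  then show "\<bar>q powr ((real n + 1/2)\<^sup>2)\<bar> \<le> q ^ n" using q_pos by (simp add: powr_realpow)
qed

lemma mult_bounded_le: "\<bar>a\<bar> \<le> (b::real) \<Longrightarrow> \<bar>c\<bar> \<le> 1 \<Longrightarrow> \<bar>a * c\<bar> \<le> b"
  using mult_mono[of "\<bar>a\<bar>" b "\<bar>c\<bar>" 1] by (simp add: abs_mult)

text \<open>The real and the complex instance of the polymorphic \<open>theta1\<close> are separate
  series. Identifying them on the real line lets complex identities descend to the real functions
  that define the wave.\<close>

lemma th1_of_real: "th1 (of_real x) = of_real (theta1 q x)"
proof -
  let ?f = "\<lambda>n. (-1) ^ n * q powr ((real n + 1/2)\<^sup>2) * sin (of_nat (2 * n + 1) * x)"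
  have "\<bar>?f n\<bar> \<le> q ^ n" for n
    by (rule mult_bounded_le) (use theta_coeff_bounds(2)[of n] in \<open>simp_all add: abs_mult\<close>)
  from suminf_of_real_bounded(2)[OF q_pos q_less_1 this] show ?thesis
    by (simp add: theta1_def sin_of_real[symmetric])
qed

lemma th2_of_real: "th2 (of_real x) = of_real (theta2 q x)"
proof -
  let ?f = "\<lambda>n. q powr ((real n + 1/2)\<^sup>2) * cos (of_nat (2 * n + 1) * x)"
  have "\<bar>?f n\<bar> \<le> q ^ n" for n
    by (intro mult_bounded_le theta_coeff_bounds abs_cos_le_one)
  from suminf_of_real_bounded(2)[OF q_pos q_less_1 this] show ?thesis
    by (simp add: theta2_def cos_of_real[symmetric])
qed

lemma th3_of_real: "th3 (of_real x) = of_real (theta3 q x)"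
proof -
  let ?f = "\<lambda>n. q ^ (n+1)\<^sup>2 * cos (of_nat (2 * (n + 1)) * x)"
  have "\<bar>?f n\<bar> \<le> q ^ n" for n
    by (intro mult_bounded_le theta_coeff_bounds abs_cos_le_one)
  from suminf_of_real_bounded(2)[OF q_pos q_less_1 this] show ?thesis
    by (simp add: theta3_def cos_of_real[symmetric])
qed

lemma th4_of_real: "th4 (of_real x) = of_real (theta4 q x)"
proof -
  let ?f = "\<lambda>n. (-1) ^ (n+1) * q ^ (n+1)\<^sup>2 * cos (of_nat (2 * (n + 1)) * x)"
  have "\<bar>?f n\<bar> \<le> q ^ n" for n
    by (rule mult_bounded_le) (use theta_coeff_bounds(1)[of n] in \<open>simp_all add: abs_mult power_abs\<close>)
  from suminf_of_real_bounded(2)[OF q_pos q_less_1 this] show ?thesis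
    by (simp add: theta4_def cos_of_real[symmetric])
qed

lemma theta2_0_pos: "0 < theta2 q (0::real)"
proof -
  let ?f = "\<lambda>n. q powr ((real n + 1/2)\<^sup>2)"
  have "summable ?f"
    by (rule suminf_of_real_bounded(1)[OF q_pos q_less_1 theta_coeff_bounds(2)])
  then have "0 < suminf ?f"
    using q_pos by (intro suminf_pos) auto
  then show ?thesis by (simp add: theta2_def)
qed

lemma theta3_0_pos: "0 < theta3 q (0::real)"
proof -
  let ?f = "\<lambda>n. q ^ (n+1)\<^sup>2"
  have "summable ?f"
    by (rule suminf_of_real_bounded(1)[OF q_pos q_less_1 theta_coeff_bounds(1)])
  then have "0 \<le> suminf ?f"
    using q_pos by (intro suminf_nonneg) auto
  then show ?thesis by (simp add: theta3_def)
qed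

lemma th2_0_nonzero: "th2 0 \<noteq> 0" and th3_0_nonzero: "th3 0 \<noteq> 0"
  using theta2_0_pos theta3_0_pos th2_of_real[of 0] th3_of_real[of 0] by auto

subsection \<open>Zeros\<close>

text \<open>In the strip the sine of \<open>(2 n + 1) x\<close> grows at most like
  \<open>exp (2 n ht)\<close>, which \<open>q ^ n\<close> absorbs. The recurrence
  \<open>sin ((2n+3) x) = sin ((2n+1) x) + 2 cos ((2n+2) x) sin x\<close> keeps \<open>sin x\<close>
  as a factor of the bound, as the comparison with the first term of the series requires.\<close>

lemma norm_sin_odd_multiple_le:
  assumes "\<bar>Im x\<bar> \<le> ht"
  shows "norm (sin (of_nat (2 * n + 1) * x)) * q ^ n \<le> real (2 * n + 1) * norm (sin x)"
proof (induction n)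
  case (Suc n)
  have qn: "exp (2 * ht * real m) * q ^ m = 1" for m
  proof -
    have "exp (2 * ht * real m) * q ^ m = exp (2 * ht * real m) * exp (ln q * real m)"
      using q_pos by (metis exp_ln exp_of_nat2_mult)
    also have "\<dots> = 1" by (simp add: ht_def flip: exp_add)
    finally show ?thesis .
  qed
  let ?z = "of_nat (2 * n + 2) * x"
  have e: "exp (\<bar>Im ?z\<bar>) \<le> exp (2 * ht * real (Suc n))"
  proof -
    have "\<bar>Im ?z\<bar> = real (2 * n + 2) * \<bar>Im x\<bar>" by (simp add: abs_mult)
    also have "\<dots> \<le> real (2 * n + 2) * ht" using assms by (intro mult_left_mono) auto
    finally show ?thesis by (simp add: algebra_simps)
  qed
  have c: "norm (2 * cos ?z) * q ^ Suc n \<le> 2"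
  proof -
    have "norm (2 * cos ?z) \<le> 2 * exp (\<bar>Im ?z\<bar>)"
      using cmod_cos_le_exp[of 1 ?z] by (simp add: norm_mult)
    also have "\<dots> \<le> 2 * exp (2 * ht * real (Suc n))" using e by simp
    finally have "norm (2 * cos ?z) * q ^ Suc n \<le> 2 * exp (2 * ht * real (Suc n)) * q ^ Suc n"
      using q_pos by (intro mult_right_mono) auto
    then show ?thesis using qn[of "Suc n"] by (simp only: mult.assoc)
  qed
  have "sin (of_nat (2 * Suc n + 1) * x) = sin (?z + x)" "sin (of_nat (2 * n + 1) * x) = sin (?z - x)"
    by (simp_all add: algebra_simps)
  then have "sin (of_nat (2 * Suc n + 1) * x) = sin (of_nat (2 * n + 1) * x) + 2 * cos ?z * sin x"
    by (simp add: sin_add sin_diff)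
  then have "norm (sin (of_nat (2 * Suc n + 1) * x)) \<le> norm (sin (of_nat (2 * n + 1) * x)) + norm (2 * cos ?z) * norm (sin x)"
    by (metis norm_mult norm_triangle_ineq)
  then have "norm (sin (of_nat (2 * Suc n + 1) * x)) * q ^ Suc n \<le>
      norm (sin (of_nat (2 * n + 1) * x)) * q ^ Suc n + (norm (2 * cos ?z) * q ^ Suc n) * norm (sin x)"
    using q_pos mult_right_mono[of _ _ "q ^ Suc n"] by (fastforce simp: algebra_simps)
  also have "norm (sin (of_nat (2 * n + 1) * x)) * q ^ Suc n \<le> norm (sin (of_nat (2 * n + 1) * x)) * q ^ n"
    using q_pos q_less_1 by (intro mult_left_mono power_decreasing) auto
  also have "(norm (2 * cos ?z) * q ^ Suc n) * norm (sin x) \<le> 2 * norm (sin x)"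
    by (rule mult_right_mono[OF c]) simp
  finally show ?case using Suc.IH by (simp add: algebra_simps)
qed simp

text \<open>For small nomes the first term of the series dominates all the others.\<close>

lemma th1_zero_small_nome:
  assumes q: "q \<le> 1/8" and x: "\<bar>Im x\<bar> \<le> ht" and z: "th1 x = 0"
  shows "sin x = 0"
proof (rule ccontr)
  assume "sin x \<noteq> 0"
  let ?t = "\<lambda>n. (-1) ^ n * of_real (q powr ((real n + 1/2)\<^sup>2)) * sin (of_nat (2 * n + 1) * x)"
  define M where "M = q powr (1/4) * norm (sin x)"
  have M: "M > 0" using \<open>sin x \<noteq> 0\<close> q_pos by (simp add: M_def)
  \<comment> \<open>The exponent \<open>(n + 1/2)^2\<close> is split as
    \<open>1/4 + n^2 + n\<close>: \<open>q ^ n\<close> pays for the growth of the sine, and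
    \<open>q ^ (n^2) <= 8^(-n)\<close> beats \<open>2 n + 1 <= 3^n\<close>. The ratio 3/8 makes the
    tail at most \<open>3/5\<close> of the first term, whence the bound 1/8 on
    \<open>q\<close>.\<close>
  have bound: "norm (?t n) \<le> M * (3/8) ^ n" for n
  proof -
    have "q powr ((real n + 1/2)\<^sup>2) = q powr (1/4) * q ^ (n\<^sup>2) * q ^ n"
      using q_pos by (simp add: power2_eq_square algebra_simps powr_add[symmetric] powr_realpow[symmetric])
    then have "norm (?t n) = q powr (1/4) * q ^ (n\<^sup>2) * (norm (sin (of_nat (2 * n + 1) * x)) * q ^ n)"
      using q_pos by (simp add: norm_mult norm_power)
    also have "\<dots> \<le> q powr (1/4) * q ^ (n\<^sup>2) * (real (2 * n + 1) * norm (sin x))"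
      using q_pos by (intro mult_left_mono norm_sin_odd_multiple_le[OF x]) auto
    also have "\<dots> = M * (real (2 * n + 1) * q ^ (n\<^sup>2))" by (simp add: M_def)
    also have "\<dots> \<le> M * (3 ^ n * (1/8) ^ n)"
    proof (intro mult_left_mono mult_mono)
      show "real (2 * n + 1) \<le> 3 ^ n" using Bernoulli_inequality[of "2::real" n] by simp
      have "q ^ (n\<^sup>2) \<le> q ^ n" using q_pos q_less_1 by (intro power_decreasing) (auto simp: power2_eq_square)
      also have "\<dots> \<le> (1/8) ^ n" using q_pos q by (intro power_mono) auto
      finally show "q ^ (n\<^sup>2) \<le> (1/8) ^ n" .
    qed (use M q_pos in auto)
    also have "3 ^ n * (1/8) ^ n = (3/8 :: real) ^ n" by (simp add: power_mult_distrib[symmetric])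
    finally show ?thesis .
  qed
  have geo: "summable (\<lambda>n. M * (3/8) ^ n)" by (intro summable_mult summable_geometric) simp
  have st: "summable ?t" by (rule summable_comparison_test[OF _ geo]) (use bound in blast)
  have "suminf ?t = 0" using z by (simp add: theta1_def)
  then have "?t 0 = - (\<Sum>n. ?t (Suc n))"
    using suminf_split_head[OF st] by simp
  moreover have "norm (?t 0) = M" using q_pos by (simp add: M_def norm_mult power_divide)
  moreover have "norm (\<Sum>n. ?t (Suc n)) \<le> (\<Sum>n. M * (3/8) ^ Suc n)"
    using geo by (intro norm_suminf_le bound) (subst summable_Suc_iff)
  moreover have "(\<Sum>n. M * (3/8) ^ Suc n) = M * (3/5)"
  proof -
    have "(\<lambda>n. (3/8 * M) * (3/8) ^ n) sums (3/8 * M * (1 / (1 - 3/8)))"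
      by (intro sums_mult geometric_sums) simp
    from sums_unique[OF this] show ?thesis by (simp add: algebra_simps)
  qed
  ultimately have "M \<le> M * (3/5)" by simp
  with M show False by simp
qed

end

text \<open>Cancels a factor that may have zeros: near \<open>a\<close> it has none, and the
  identity theorem extends the vanishing of \<open>f\<close> from there.\<close>

lemma holomorphic_mult_eq_0:
  fixes f g :: "complex \<Rightarrow> complex"
  assumes f: "f holomorphic_on UNIV" and g: "g holomorphic_on UNIV"
    and "\<And>z. f z * g z = 0" and "g a \<noteq> 0"
  shows "f z = 0"
proof -
  have "isCont g a"
    using holomorphic_on_imp_continuous_on[OF g] continuous_on_eq_continuous_at[OF open_UNIV] by blast
  then obtain e where e: "e > 0" "\<And>y. y \<in> ball a e \<Longrightarrow> g y \<noteq> 0"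
    using continuous_at_avoid[of a g 0] \<open>g a \<noteq> 0\<close> by (metis dist_commute mem_ball)
  show ?thesis
    by (rule analytic_continuation_open[of "ball a e" UNIV f "\<lambda>_. 0"])
       (use assms e in \<open>auto simp del: mem_ball\<close>)
qed

lemma (in theta_nome) th3_cong: "exp (2 * \<i> * x) = exp (2 * \<i> * y) \<Longrightarrow> th3 x = th3 y"
  by (simp add: theta3_eq_gauss_powser[OF q_pos q_less_1] exp_minus)

text \<open>
  Zeros for the nome \<open>q\<close> double to zeros for \<open>q\<^sup>2\<close>, so squaring repeatedly reduces the claim to
  small nomes.
\<close>

lemma theta1_zero_strip:
  fixes x :: complex
  assumes "0 < q" "q < 1" "\<bar>Im x\<bar> \<le> - ln q / 2" "theta1 q x = 0"
  shows "sin x = 0"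
proof -
  obtain n where "(q ^ 2 ^ n) \<le> 1/8"
  proof -
    obtain m where m: "q ^ m < 1/8" using real_arch_pow_inv[of "1/8" q] assms by auto
    have "q ^ 2 ^ m \<le> q ^ m" using assms by (intro power_decreasing) auto
    with m that[of m] show ?thesis by linarith
  qed
  then show ?thesis using assms
  proof (induction n arbitrary: q x)
    case 0
    interpret theta_nome q by unfold_locales fact+
    show ?case using 0 th1_zero_small_nome[of x] by (simp add: ht_def)
  next
    case (Suc n)
    interpret theta_nome q by unfold_locales fact+
    have q2: "0 < q\<^sup>2" "q\<^sup>2 < 1" using q_pos q_less_1 by (auto simp: power_less_one_iff)
    have "theta1 (q\<^sup>2) (2 * x) * theta4 (q\<^sup>2) 0 = 0"
      using th1_th2_landen[of x] Suc.prems by simp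
    \<comment> \<open>Otherwise \<open>th1 * th2\<close> would vanish identically, and since
      \<open>th2 0\<close> does not, so would \<open>th1\<close>; but its value at pi/2 is
      \<open>th2 0\<close>.\<close>
    moreover have "theta4 (q\<^sup>2) (0::complex) \<noteq> 0"
    proof
      assume "theta4 (q\<^sup>2) (0::complex) = 0"
      then have "th1 z * th2 z = 0" for z
        using th1_th2_landen[of z] by simp
      then have "th1 (of_real pi / 2) = 0"
        using holomorphic_mult_eq_0[OF holomorphic_th1 holomorphic_th2 _ th2_0_nonzero] by blast
      then show False using th1_plus_half_pi[of 0] th2_0_nonzero by simp
    qed
    ultimately have "theta1 (q\<^sup>2) (2 * x) = 0" by simp
    moreover have "(q\<^sup>2) ^ 2 ^ n \<le> 1/8" using Suc.prems(1) by (simp add: power_mult[symmetric])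
    moreover have "\<bar>Im (2 * x)\<bar> \<le> - ln (q\<^sup>2) / 2" using Suc.prems by (simp add: ln_realpow abs_mult)
    ultimately have "sin (2 * x) = 0" using Suc.IH[of "q\<^sup>2" "2 * x"] q2 by blast
    then have "sin x = 0 \<or> cos x = 0" by (simp add: sin_double)
    \<comment> \<open>Doubling creates spurious candidates at the odd multiples of pi/2. There
      \<open>th3\<close> and \<open>th4\<close> exchange their null values, so that a zero of
      \<open>th1\<close> would give \<open>th3 0 ^ 4 = th4 0 ^ 4\<close>, against
      \<open>th_null_quartic\<close>.\<close>
    moreover have "cos x \<noteq> 0"
    proof
      assume "cos x = 0"
      then have "exp (\<i> * x) = - exp (- (\<i> * x))"
        by (simp add: cos_exp_eq eq_neg_iff_add_eq_0)
      then have e: "exp (2 * \<i> * x) = -1"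
        by (metis add.inverse_inverse exp_add exp_zero minus_mult_right mult.assoc mult_2 right_minus mult.commute mult_minus_left)
      have "exp (2 * \<i> * (of_real pi / 2)) = -1" by simp
      then have "th3 x = th4 0" using th3_cong[of x "of_real pi / 2"] e by (simp add: theta4_eq_theta3)
      moreover have "th4 x = th3 0"
      proof -
        have "exp (2 * \<i> * (x + of_real pi / 2)) = 1"
          using e by (simp add: distrib_left exp_add)
        then show ?thesis using th3_cong[of "x + of_real pi / 2" 0] by (simp add: theta4_eq_theta3)
      qed
      moreover have "th1 x = 0" by fact
      ultimately have "th3 0 ^ 4 = th4 0 ^ 4"
        using th3_sq_eq[of x] by (simp add: power2_eq_square power4_eq_xxxx mult.assoc)
      then show False using th_null_quartic th2_0_nonzero by simp
    qed
    ultimately show ?case by blast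
  qed
qed

context theta_nome
begin

lemma th1_nonzero: "\<bar>Im x\<bar> \<le> ht \<Longrightarrow> sin x \<noteq> 0 \<Longrightarrow> th1 x \<noteq> 0"
  using theta1_zero_strip[OF q_pos q_less_1, of x] by (auto simp: ht_def)

lemma th2_nonzero: "\<bar>Im x\<bar> \<le> ht \<Longrightarrow> cos x \<noteq> 0 \<Longrightarrow> th2 x \<noteq> 0"
  using th1_nonzero[of "x + of_real pi / 2"] cos_sin_eq[of "- x"]
  by (simp add: th1_plus_half_pi add.commute)

text \<open>A zero of \<open>th4\<close> becomes one of \<open>th1\<close> after a shift by the half
  period. As \<open>th4\<close> is even, the zero may be taken in the lower half of the strip, so
  that the shifted point still lies in the strip where the zeros of \<open>th1\<close> are known to
  be real.\<close>

lemma th4_nonzero: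
  assumes "\<bar>Im x\<bar> < ht"
  shows "th4 x \<noteq> 0"
proof
  assume "th4 x = 0"
  define y where "y = (if Im x \<le> 0 then x else - x)"
  have y: "Im y \<le> 0" "- ht < Im y" "th4 y = 0"
    using assms \<open>th4 x = 0\<close> by (auto simp: y_def)
  then have "th1 (y + \<i> * of_real ht) = 0" by (simp add: th1_plus_ht)
  then have "sin (y + \<i> * of_real ht) = 0"
    using th1_nonzero[of "y + \<i> * of_real ht"] y by auto
  then obtain i where "y + \<i> * of_real ht = of_real (of_int i * pi)"
    using sin_eq_0 by blast
  then have "Im (y + \<i> * of_real ht) = 0" by simp
  with y show False by simp
qed

lemma th4_real_nonzero: "th4 (of_real x) \<noteq> 0"
  using th4_nonzero ht_pos by simp

lemma th4_ht: "th4 (\<i> * of_real ht) = 0"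
  using th1_plus_ht[of "- \<i> * of_real ht"] by simp

text \<open>The series alternates in sign, so positivity is not termwise. Landen's transformation at
  0 makes \<open>theta3 q 0 * theta4 q 0\<close> the square of a nonzero real number.\<close>

lemma theta4_0_pos: "0 < theta4 q (0::real)"
proof -
  interpret sq: theta_nome "q\<^sup>2" by (rule theta_nome_square)
  have "th3 0 * th4 0 = of_real ((theta4 (q\<^sup>2) (0::real))\<^sup>2)"
    using th3_th4_landen[of 0] sq.th4_of_real[of 0] by (simp add: power2_eq_square)
  then have "theta3 q (0::real) * theta4 q 0 = (theta4 (q\<^sup>2) (0::real))\<^sup>2"
    using th3_of_real[of 0] th4_of_real[of 0]
    by (metis of_real_0 of_real_eq_iff of_real_mult)
  moreover have "theta4 (q\<^sup>2) (0::real) \<noteq> 0"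
    using sq.th4_real_nonzero[of 0] sq.th4_of_real[of 0] by auto
  ultimately show ?thesis using theta3_0_pos by (metis zero_less_mult_pos zero_less_power2)
qed

subsection \<open>Wronskians\<close>

text \<open>The derivative of \<open>th1\<close> at 0 stays an unevaluated constant through the
  Wronskian formulas. It is absorbed into \<open>lam\<close>, which the elliptic integral then
  identifies.\<close>

definition dth :: complex where "dth = deriv th1 0"

lemma th_DERIV:
  "(th1 has_field_derivative deriv th1 x) (at x)"
  "(th2 has_field_derivative deriv th2 x) (at x)"
  "(th3 has_field_derivative deriv th3 x) (at x)"
  "(th4 has_field_derivative deriv th4 x) (at x)"
  using holomorphic_th1 holomorphic_th2 holomorphic_th3 holomorphic_th4 
  by (auto intro: holomorphic_derivI[OF _ open_UNIV])

lemmas th_DERIV' [derivative_intros] = th_DERIV[THEN DERIV_chain2]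

lemma holomorphic_theta_intros [holomorphic_intros]:
  "f holomorphic_on S \<Longrightarrow> (\<lambda>x. th1 (f x)) holomorphic_on S"
  "f holomorphic_on S \<Longrightarrow> (\<lambda>x. th2 (f x)) holomorphic_on S"
  "f holomorphic_on S \<Longrightarrow> (\<lambda>x. th3 (f x)) holomorphic_on S"
  "f holomorphic_on S \<Longrightarrow> (\<lambda>x. th4 (f x)) holomorphic_on S"
  using holomorphic_on_compose_gen[OF _ holomorphic_th1] holomorphic_on_compose_gen[OF _ holomorphic_th2]
    holomorphic_on_compose_gen[OF _ holomorphic_th3] holomorphic_on_compose_gen[OF _ holomorphic_th4]
  by (auto simp: o_def)

lemma holomorphic_deriv_theta [holomorphic_intros]:
  "deriv th1 holomorphic_on UNIV" "deriv th2 holomorphic_on UNIV"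
  "deriv th3 holomorphic_on UNIV" "deriv th4 holomorphic_on UNIV"
  by (intro holomorphic_deriv holomorphic_th1 holomorphic_th2 holomorphic_th3 holomorphic_th4 open_UNIV)+

text \<open>\<open>th1_add_diff\<close> is differentiated in its first variable at coinciding
  arguments, where \<open>th1 (x - y)\<close> vanishes and only its derivative \<open>dth\<close>
  survives.\<close>

lemma th1_double_wronskian:
  "(th4 0)\<^sup>2 * (th1 (2 * x) * dth) = 2 * th1 x * th4 x * (deriv th1 x * th4 x - th1 x * deriv th4 x)"
proof -
  have "((\<lambda>z. (th4 0)\<^sup>2 * (th1 (z + x) * th1 (z - x))) has_field_derivative
      (th4 0)\<^sup>2 * (th1 (x + x) * deriv th1 (x - x) + deriv th1 (x + x) * th1 (x - x))) (at x)"
    by (auto intro!: derivative_eq_intros simp: algebra_simps)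
  moreover have "((\<lambda>z. (th1 z)\<^sup>2 * (th4 x)\<^sup>2 - (th4 z)\<^sup>2 * (th1 x)\<^sup>2) has_field_derivative
      2 * th1 x * deriv th1 x * (th4 x)\<^sup>2 - 2 * th4 x * deriv th4 x * (th1 x)\<^sup>2) (at x)"
    by (auto intro!: derivative_eq_intros simp: algebra_simps)
  ultimately have "(th4 0)\<^sup>2 * (th1 (x + x) * deriv th1 (x - x) + deriv th1 (x + x) * th1 (x - x)) =
      2 * th1 x * deriv th1 x * (th4 x)\<^sup>2 - 2 * th4 x * deriv th4 x * (th1 x)\<^sup>2"
    unfolding th1_add_diff by (rule DERIV_unique)
  then show ?thesis
    unfolding dth_def mult_2[of x] by (simp add: algebra_simps power2_eq_square)
qed

lemma th4_0_nonzero: "th4 0 \<noteq> 0"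
  using th4_real_nonzero[of 0] by simp

lemma th4_half_pi_nonzero: "th4 (of_real pi / 2) \<noteq> 0"
  using th4_plus_half_pi[of 0] th3_0_nonzero by simp

lemma th1_half_pi_nonzero: "th1 (of_real pi / 2) \<noteq> 0"
  using th1_plus_half_pi[of 0] th2_0_nonzero by simp

text \<open>Two expressions for \<open>th1 (2 * x)\<close>, the duplication formula and
  \<open>th1_double_wronskian\<close>, are compared; the common factor \<open>th1 x * th4 x\<close>
  has zeros and is cancelled by the identity theorem.\<close>

lemma wronskian_1_4: "th2 0 * th3 0 * (deriv th1 x * th4 x - th1 x * deriv th4 x) = th4 0 * dth * th2 x * th3 x"
proof -
  have "(th2 0 * th3 0 * (deriv th1 x * th4 x - th1 x * deriv th4 x) - th4 0 * dth * th2 x * th3 x) *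
     (th1 x * th4 x) = 0" for x
  proof -
    let ?G = "(th2 0 * th3 0 * (deriv th1 x * th4 x - th1 x * deriv th4 x) - th4 0 * dth * th2 x * th3 x) * (th1 x * th4 x)"
    have "2 * th4 0 * ?G = (th2 0 * th3 0 * th4 0) * (2 * th1 x * th4 x * (deriv th1 x * th4 x - th1 x * deriv th4 x)) -
        (th4 0)\<^sup>2 * dth * (2 * (th1 x * th2 x * th3 x * th4 x))"
      by (simp add: algebra_simps power2_eq_square)
    also have "\<dots> = 0"
      unfolding th1_double[symmetric] th1_double_wronskian[symmetric] by (simp add: algebra_simps)
    finally show ?thesis using th4_0_nonzero by simp
  qed
  then have "th2 0 * th3 0 * (deriv th1 x * th4 x - th1 x * deriv th4 x) - th4 0 * dth * th2 x * th3 x = 0" for x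
    by (rule holomorphic_mult_eq_0[where a = "of_real pi / 2", rotated 2])
       (auto intro!: holomorphic_intros simp: th1_half_pi_nonzero th4_half_pi_nonzero)
  then show ?thesis by simp
qed

text \<open>Pointwise algebra shared by \<open>th2\<close> and \<open>th3\<close>: a quadratic
  relation, its derivative and the known Wronskian of \<open>th1\<close> and \<open>th4\<close>
  determine the next Wronskian, up to a factor \<open>t2\<close> that remains to be
  cancelled.\<close>

lemma wronskian_quotient_aux:
  fixes a2 a3 a4 :: complex
  assumes "a4\<^sup>2 * (2 * t2 * t2') = a2\<^sup>2 * (2 * t4 * t4') - a3\<^sup>2 * (2 * t1 * t1')"
    and "a4\<^sup>2 * t2\<^sup>2 = a2\<^sup>2 * t4\<^sup>2 - a3\<^sup>2 * t1\<^sup>2"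
    and "a2 * a3 * (t1' * t4 - t1 * t4') = a4 * d * t2 * t3" and "a4 \<noteq> 0"
  shows "(a2 * a4 * (t2' * t4 - t2 * t4') + a3 * d * t1 * t3) * t2 = 0"
proof -
  have "2 * a4 * ((a2 * a4 * (t2' * t4 - t2 * t4') + a3 * d * t1 * t3) * t2) =
      a2 * t4 * (a4\<^sup>2 * (2 * t2 * t2')) - 2 * a2 * t4' * (a4\<^sup>2 * t2\<^sup>2) + 2 * a3 * t1 * (a4 * d * t2 * t3)"
    by (simp add: algebra_simps power2_eq_square)
  also have "\<dots> = 0"
    unfolding assms(1,2) assms(3)[symmetric] by (simp add: algebra_simps power2_eq_square)
  finally show ?thesis using \<open>a4 \<noteq> 0\<close> by simp
qed

lemma wronskian_2_4: "th2 0 * th4 0 * (deriv th2 x * th4 x - th2 x * deriv th4 x) = - th3 0 * dth * th1 x * th3 x"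
proof -
  have "(th2 0 * th4 0 * (deriv th2 x * th4 x - th2 x * deriv th4 x) + th3 0 * dth * th1 x * th3 x) * th2 x = 0" for x
  proof -
    have "((\<lambda>x. (th4 0)\<^sup>2 * (th2 x)\<^sup>2) has_field_derivative (th4 0)\<^sup>2 * (2 * th2 x * deriv th2 x)) (at x)"
      by (auto intro!: derivative_eq_intros)
    moreover have "((\<lambda>x. (th2 0)\<^sup>2 * (th4 x)\<^sup>2 - (th3 0)\<^sup>2 * (th1 x)\<^sup>2) has_field_derivative
        (th2 0)\<^sup>2 * (2 * th4 x * deriv th4 x) - (th3 0)\<^sup>2 * (2 * th1 x * deriv th1 x)) (at x)"
      by (auto intro!: derivative_eq_intros)
    ultimately have "(th4 0)\<^sup>2 * (2 * th2 x * deriv th2 x) =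
        (th2 0)\<^sup>2 * (2 * th4 x * deriv th4 x) - (th3 0)\<^sup>2 * (2 * th1 x * deriv th1 x)"
      unfolding th2_sq_eq by (rule DERIV_unique)
    from wronskian_quotient_aux[OF this th2_sq_eq wronskian_1_4 th4_0_nonzero] show ?thesis .
  qed
  then have "th2 0 * th4 0 * (deriv th2 x * th4 x - th2 x * deriv th4 x) + th3 0 * dth * th1 x * th3 x = 0" for x
    by (rule holomorphic_mult_eq_0[where a = 0, rotated 2])
       (auto intro!: holomorphic_intros simp: th2_0_nonzero)
  then show ?thesis by (simp add: eq_neg_iff_add_eq_0)
qed

lemma wronskian_3_4: "th3 0 * th4 0 * (deriv th3 x * th4 x - th3 x * deriv th4 x) = - th2 0 * dth * th1 x * th2 x"
proof -
  have "(th3 0 * th4 0 * (deriv th3 x * th4 x - th3 x * deriv th4 x) + th2 0 * dth * th1 x * th2 x) * th3 x = 0" for x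
  proof -
    have "((\<lambda>x. (th4 0)\<^sup>2 * (th3 x)\<^sup>2) has_field_derivative (th4 0)\<^sup>2 * (2 * th3 x * deriv th3 x)) (at x)"
      by (auto intro!: derivative_eq_intros)
    moreover have "((\<lambda>x. (th3 0)\<^sup>2 * (th4 x)\<^sup>2 - (th2 0)\<^sup>2 * (th1 x)\<^sup>2) has_field_derivative
        (th3 0)\<^sup>2 * (2 * th4 x * deriv th4 x) - (th2 0)\<^sup>2 * (2 * th1 x * deriv th1 x)) (at x)"
      by (auto intro!: derivative_eq_intros)
    ultimately have "(th4 0)\<^sup>2 * (2 * th3 x * deriv th3 x) =
        (th3 0)\<^sup>2 * (2 * th4 x * deriv th4 x) - (th2 0)\<^sup>2 * (2 * th1 x * deriv th1 x)"
      unfolding th3_sq_eq by (rule DERIV_unique)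
    moreover have "th3 0 * th2 0 * (deriv th1 x * th4 x - th1 x * deriv th4 x) = th4 0 * dth * th3 x * th2 x"
      using wronskian_1_4[of x] by (simp add: mult_ac)
    ultimately show ?thesis
      by (intro wronskian_quotient_aux th3_sq_eq th4_0_nonzero)
  qed
  then have "th3 0 * th4 0 * (deriv th3 x * th4 x - th3 x * deriv th4 x) + th2 0 * dth * th1 x * th2 x = 0" for x
    by (rule holomorphic_mult_eq_0[where a = 0, rotated 2])
       (auto intro!: holomorphic_intros simp: th3_0_nonzero)
  then show ?thesis by (simp add: eq_neg_iff_add_eq_0)
qed

text \<open>The two Wronskians against \<open>th4\<close> are combined so that
  \<open>deriv th4\<close> drops out. Quotients over \<open>th2\<close> are the ones needed on the
  imaginary axis, since \<open>th4\<close> vanishes at the half period.\<close>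

lemma wronskian_1_2: "th3 0 * th4 0 * (deriv th1 x * th2 x - th1 x * deriv th2 x) = th2 0 * dth * th3 x * th4 x"
proof -
  have "(th3 0 * th4 0 * (deriv th1 x * th2 x - th1 x * deriv th2 x) - th2 0 * dth * th3 x * th4 x) * th4 x = 0" for x
  proof -
    let ?G = "(th3 0 * th4 0 * (deriv th1 x * th2 x - th1 x * deriv th2 x) - th2 0 * dth * th3 x * th4 x) * th4 x"
    have "th2 0 * ?G = th4 0 * th2 x * (th2 0 * th3 0 * (deriv th1 x * th4 x - th1 x * deriv th4 x)) -
        th3 0 * th1 x * (th2 0 * th4 0 * (deriv th2 x * th4 x - th2 x * deriv th4 x)) -
        dth * th3 x * ((th2 0)\<^sup>2 * (th4 x)\<^sup>2)"
      by (simp add: algebra_simps power2_eq_square)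
    also have "\<dots> = dth * th3 x * ((th4 0)\<^sup>2 * (th2 x)\<^sup>2) + (th3 0)\<^sup>2 * (th1 x)\<^sup>2 * dth * th3 x -
        dth * th3 x * ((th2 0)\<^sup>2 * (th4 x)\<^sup>2)"
      unfolding wronskian_1_4 wronskian_2_4 by (simp add: algebra_simps power2_eq_square)
    also have "\<dots> = 0"
      unfolding th2_sq_eq by (simp add: algebra_simps)
    finally show ?thesis using th2_0_nonzero by simp
  qed
  then have "th3 0 * th4 0 * (deriv th1 x * th2 x - th1 x * deriv th2 x) - th2 0 * dth * th3 x * th4 x = 0" for x
    by (rule holomorphic_mult_eq_0[where a = 0, rotated 2])
       (auto intro!: holomorphic_intros simp: th4_0_nonzero)
  then show ?thesis by simp
qed

end

section \<open>Inversion of the nome\<close>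

lemma one_minus_modulus_sin_pos:
  fixes m s :: real
  assumes "0 \<le> m" "m < 1"
  shows "0 < 1 - m\<^sup>2 * (sin s)\<^sup>2"
proof -
  have "m\<^sup>2 * (sin s)\<^sup>2 \<le> m\<^sup>2 * 1"
    by (intro mult_left_mono) (auto simp: abs_square_le_1)
  also have "m\<^sup>2 * 1 < 1" using assms by (simp add: power_less_one_iff abs_square_less_1)
  finally show ?thesis by simp
qed

lemma continuous_ellK_integrand:
  assumes "0 \<le> m" "m < 1"
  shows "continuous_on S (\<lambda>s::real. 1 / sqrt (1 - m\<^sup>2 * (sin s)\<^sup>2))"
  using one_minus_modulus_sin_pos[OF assms]
  by (intro continuous_intros) (smt (verit) real_sqrt_eq_zero_cancel_iff)

lemma ellK_pos:
  assumes "0 \<le> m" "m < 1"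
  shows "0 < ellK m"
proof -
  have "integral {0..pi/2} (\<lambda>_. 1) \<le> ellK m"
    unfolding ellK_def
  proof (rule integral_le)
    show "(\<lambda>s. 1 / sqrt (1 - m\<^sup>2 * (sin s)\<^sup>2)) integrable_on {0..pi/2}"
      by (intro integrable_continuous_interval continuous_ellK_integrand assms)
    show "1 \<le> 1 / sqrt (1 - m\<^sup>2 * (sin s)\<^sup>2)" for s
      using one_minus_modulus_sin_pos[OF assms, of s] by (simp add: le_divide_eq)
  qed (auto intro: integrable_const_ivl)
  then have "pi / 2 \<le> ellK m" by simp
  then show ?thesis using pi_gt_zero by linarith
qed

lemma ellK_integrand_mono:
  fixes m n s :: real
  assumes "0 \<le> m" "m \<le> n" "n < 1"
  shows "1 / sqrt (1 - m\<^sup>2 * (sin s)\<^sup>2) \<le> 1 / sqrt (1 - n\<^sup>2 * (sin s)\<^sup>2)"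
  using one_minus_modulus_sin_pos[of n s] one_minus_modulus_sin_pos[of m s] assms
  by (intro divide_left_mono) (auto intro!: mult_right_mono power_mono mult_pos_pos)

lemma ellK_mono:
  assumes "0 \<le> m" "m \<le> n" "n < 1"
  shows "ellK m \<le> ellK n"
  unfolding ellK_def
proof (rule integral_le)
  show "(\<lambda>s. 1 / sqrt (1 - m\<^sup>2 * (sin s)\<^sup>2)) integrable_on {0..pi/2}"
       "(\<lambda>s. 1 / sqrt (1 - n\<^sup>2 * (sin s)\<^sup>2)) integrable_on {0..pi/2}"
    using assms by (auto intro!: integrable_continuous_interval continuous_ellK_integrand)
qed (intro ellK_integrand_mono assms)

text \<open>If the integrals were equal, the continuous nonnegative difference of the integrands
  would vanish throughout, but at pi/2 the integrands differ.\<close>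

lemma ellK_strict_mono:
  assumes "0 \<le> m" "m < n" "n < 1"
  shows "ellK m < ellK n"
proof -
  note le = ellK_integrand_mono[OF assms(1) less_imp_le[OF assms(2)] assms(3)]
  have "ellK m \<noteq> ellK n"
  proof
    assume eq: "ellK m = ellK n"
    have int: "(\<lambda>s. 1 / sqrt (1 - k\<^sup>2 * (sin s)\<^sup>2)) integrable_on {0..pi/2}" if "0 \<le> k" "k < 1" for k
      using that by (intro integrable_continuous_interval continuous_ellK_integrand)
    have "((\<lambda>s. 1 / sqrt (1 - n\<^sup>2 * (sin s)\<^sup>2) - 1 / sqrt (1 - m\<^sup>2 * (sin s)\<^sup>2)) has_integral ellK n - ellK m) {0..pi/2}"
      unfolding ellK_def using assms by (intro has_integral_diff integrable_integral int) auto
    then have "((\<lambda>s. 1 / sqrt (1 - n\<^sup>2 * (sin s)\<^sup>2) - 1 / sqrt (1 - m\<^sup>2 * (sin s)\<^sup>2)) has_integral 0) (cbox 0 (pi/2))"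
      using eq by simp
    then have "1 / sqrt (1 - n\<^sup>2 * (sin (pi/2))\<^sup>2) - 1 / sqrt (1 - m\<^sup>2 * (sin (pi/2))\<^sup>2) = 0"
      by (rule has_integral_0_cbox_imp_0[rotated 2])
         (use le assms in \<open>auto intro!: continuous_intros continuous_ellK_integrand simp: not_le[THEN iffD2, OF pi_gt_zero]\<close>)
    then have "sqrt (1 - n\<^sup>2) = sqrt (1 - m\<^sup>2)"
      by simp
    then have "n\<^sup>2 = m\<^sup>2" by simp
    then show False using assms by (simp add: power2_eq_iff)
  qed
  then show ?thesis using ellK_mono[of m n] assms by simp
qed

text \<open>K increases with the modulus while K' decreases, so K'/K is strictly decreasing.\<close>

lemma nome_inj:
  assumes "0 < m" "m < 1" "0 < n" "n < 1" "nome m = nome n"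
  shows "m = n"
proof -
  have less: "nome m \<noteq> nome n" if mn: "0 < m" "m < n" "n < 1" for m n
  proof -
    have m1: "m\<^sup>2 < n\<^sup>2" "n\<^sup>2 < 1" "m\<^sup>2 > 0" using mn by (auto simp: power_less_one_iff intro: power_strict_mono)
    have "ellK (compl_modulus n) \<le> ellK (compl_modulus m)"
      using m1 by (intro ellK_mono) auto
    moreover have "0 < ellK (compl_modulus n)"
      using m1 mn by (intro ellK_pos) auto
    moreover have "ellK m < ellK n" "0 < ellK m"
      using mn by (auto intro: ellK_strict_mono ellK_pos)
    ultimately have "ellK (compl_modulus n) / ellK n < ellK (compl_modulus m) / ellK m"
      by (intro frac_less2) auto
    then have "pi * (ellK (compl_modulus n) / ellK n) < pi * (ellK (compl_modulus m) / ellK m)"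
      by (rule mult_strict_left_mono) simp
    then show ?thesis by (simp add: nome_def)
  qed
  show ?thesis
    using less[of m n] less[of n m] assms by (metis linorder_neqE_linordered_idom)
qed

text \<open>The functions \<open>f\<close>, \<open>g\<close>, \<open>h\<close> stand for sn, cn, dn
  up to a rescaling of the variable. The substitution \<open>s = arcsin (f x)\<close> turns the
  elliptic integrand into the constant \<open>lam\<close>.\<close>

lemma ellK_eqI:
  fixes f g h :: "real \<Rightarrow> real"
  assumes L: "0 < L" and m: "0 \<le> m" "m < 1"
    and deriv: "\<And>x. x \<in> {0..L} \<Longrightarrow> (f has_real_derivative lam * g x * h x) (at x)"
    and fg: "\<And>x. x \<in> {0..L} \<Longrightarrow> (f x)\<^sup>2 + (g x)\<^sup>2 = 1"
    and fh: "\<And>x. x \<in> {0..L} \<Longrightarrow> (h x)\<^sup>2 + m\<^sup>2 * (f x)\<^sup>2 = 1"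
    and gpos: "\<And>x. x \<in> {0<..<L} \<Longrightarrow> 0 < g x" and hpos: "\<And>x. x \<in> {0..L} \<Longrightarrow> 0 < h x"
    and ends: "f 0 = 0" "f L = 1"
  shows "ellK m = lam * L"
proof -
  let ?F = "\<lambda>s. 1 / sqrt (1 - m\<^sup>2 * (sin s)\<^sup>2)"
  have f1: "\<bar>f x\<bar> \<le> 1" if "x \<in> {0..L}" for x
    using fg[OF that] by (metis abs_square_le_1 le_add_same_cancel1 zero_le_power2)
  have "((\<lambda>x. (lam * h x) *\<^sub>R ?F (arcsin (f x))) has_integral
      (integral {arcsin (f 0)..arcsin (f L)} ?F - integral {arcsin (f L)..arcsin (f 0)} ?F)) {0..L}"
  \<comment> \<open>The end points are exceptional: \<open>arcsin\<close> is not differentiable at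
    \<open>f L = 1\<close>, and \<open>g\<close> is known to be positive only in the
    interior.\<close>
  proof (rule has_integral_substitution_general[where s = "{0, L}"])
    show "(\<lambda>x. arcsin (f x)) ` {0..L} \<subseteq> {- (pi/2)..pi/2}"
    proof (rule image_subsetI)
      fix x assume "x \<in> {0..L}"
      then have "- 1 \<le> f x" "f x \<le> 1" using f1[of x] by (simp_all add: abs_le_iff)
      then show "arcsin (f x) \<in> {- (pi/2)..pi/2}"
        using arcsin_bounded[of "f x"] by (simp only: atLeastAtMost_iff)
    qed
    show "continuous_on {- (pi/2)..pi/2} ?F" by (intro continuous_ellK_integrand m)
    have "continuous_on {0..L} f"
      by (rule DERIV_continuous_on[OF has_field_derivative_at_within[OF deriv]])
    then show "continuous_on {0..L} (\<lambda>x. arcsin (f x))"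
      using f1 by (intro continuous_on_arcsin) (auto simp: abs_le_iff)
    fix x assume x: "x \<in> {0..L} - {0, L}"
    then have g: "0 < g x" using gpos by auto
    have x': "x \<in> {0..L}" using x by simp
    have "(f x)\<^sup>2 < 1" using fg[OF x'] g by (smt (verit) zero_less_power2)
    then have f2: "- 1 < f x" "f x < 1" by (auto simp: abs_square_less_1 abs_less_iff)
    have "sqrt (1 - (f x)\<^sup>2) = g x" using fg[OF x'] g by (intro real_sqrt_unique) auto
    then have "((\<lambda>x. arcsin (f x)) has_real_derivative inverse (g x) * (lam * g x * h x)) (at x)"
      using DERIV_chain2[OF DERIV_arcsin[OF f2] deriv[OF x']] by simp
    then show "((\<lambda>x. arcsin (f x)) has_real_derivative lam * h x) (at x within {0..L})"
      using g by (auto intro: has_field_derivative_at_within simp: field_simps)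
  qed (use L in auto)
  moreover have "integral {pi/2..0} ?F = 0" by (simp add: integral_empty)
  ultimately have "((\<lambda>x. (lam * h x) *\<^sub>R ?F (arcsin (f x))) has_integral ellK m) {0..L}"
    by (simp add: ends ellK_def)
  moreover have "(lam * h x) *\<^sub>R ?F (arcsin (f x)) = lam" if "x \<in> {0..L}" for x
  proof -
    have "sqrt (1 - m\<^sup>2 * (f x)\<^sup>2) = h x" using fh[OF that] hpos[OF that] by (intro real_sqrt_unique) auto
    then show ?thesis using f1[OF that] hpos[OF that] by (simp add: abs_le_iff)
  qed
  ultimately have "((\<lambda>x. lam) has_integral ellK m) {0..L}"
    by (rule has_integral_eq[rotated])
  moreover have "((\<lambda>x. lam) has_integral lam * L) {0..L}"
    using has_integral_const_real[of lam 0 L] L by (simp add: mult.commute)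
  ultimately show ?thesis by (rule has_integral_unique)
qed

lemma has_real_derivative_of_complex:
  fixes F :: "complex \<Rightarrow> complex" and f :: "real \<Rightarrow> real"
  assumes "(F has_field_derivative D) (at (of_real x))" and "\<And>t. F (of_real t) = of_real (f t)"
  shows "(f has_real_derivative Re D) (at x)" "D = of_real (Re D)"
proof -
  have v: "((\<lambda>t. complex_of_real (f t)) has_vector_derivative D) (at x)"
    using has_vector_derivative_real_field[OF assms(1)] assms(2) by simp
  have "((\<lambda>t. Re (complex_of_real (f t))) has_vector_derivative Re D) (at x)"
    using v by (rule bounded_linear.has_vector_derivative[OF bounded_linear_Re])
  then show "(f has_real_derivative Re D) (at x)"
    by (simp add: has_real_derivative_iff_has_vector_derivative)
  have "((\<lambda>t. Im (complex_of_real (f t))) has_vector_derivative Im D) (at x)"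
    using v by (rule bounded_linear.has_vector_derivative[OF bounded_linear_Im])
  then have "((\<lambda>t::real. 0::real) has_vector_derivative Im D) (at x)" by simp
  then have "Im D = 0"
    using has_vector_derivative_const vector_derivative_unique_at by blast
  then show "D = of_real (Re D)" by (simp add: complex_eq_iff)
qed

lemma continuous_nonzero_pos:
  fixes f :: "real \<Rightarrow> real"
  assumes "continuous_on {a..b} f" "0 < f a" "\<And>x. x \<in> {a..b} \<Longrightarrow> f x \<noteq> 0" "x \<in> {a..b}"
  shows "0 < f x"
proof (rule ccontr)
  assume "\<not> 0 < f x"
  then obtain c where "a \<le> c" "c \<le> x" "f c = 0"
    using IVT2'[of f x 0 a] assms continuous_on_subset[OF assms(1), of "{a..x}"] by fastforce
  then show False using assms by auto
qed

section \<open>The modulus that belongs to a given nome\<close>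

context theta_nome
begin

definition a2 :: real where "a2 = theta2 q 0"
definition a3 :: real where "a3 = theta3 q 0"
definition a4 :: real where "a4 = theta4 q 0"
definition modk :: real where "modk = a2\<^sup>2 / a3\<^sup>2"
text \<open>The constant in the derivative of the sn quotient \<open>a3/a2 * th1/th4\<close>, as
  \<open>wronskian_1_4\<close> dictates it. \<open>ellK_modk\<close> shows that it equals 2K/pi for
  the modulus \<open>modk\<close>.\<close>

definition lam :: real where "lam = Re dth * a3 / (a2 * a4)"

lemma a_pos: "0 < a2" "0 < a3" "0 < a4"
  using theta2_0_pos theta3_0_pos theta4_0_pos by (simp_all add: a2_def a3_def a4_def)

lemma th_0: "th2 0 = of_real a2" "th3 0 = of_real a3" "th4 0 = of_real a4"
  using th2_of_real[of 0] th3_of_real[of 0] th4_of_real[of 0] by (simp_all add: a2_def a3_def a4_def)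

lemma a_quartic: "a3 ^ 4 = a2 ^ 4 + a4 ^ 4"
  using th_null_quartic unfolding th_0 by (simp flip: of_real_power of_real_add)

lemma modk_bounds: "0 < modk" "modk < 1"
proof -
  show "0 < modk" using a_pos by (simp add: modk_def)
  have "(a2\<^sup>2)\<^sup>2 < (a3\<^sup>2)\<^sup>2" using a_quartic a_pos by simp
  then have "a2\<^sup>2 < a3\<^sup>2" using power2_less_imp_less zero_le_power2 by blast
  then show "modk < 1" using a_pos by (simp add: modk_def)
qed

lemma compl_modk: "compl_modulus modk = a4\<^sup>2 / a3\<^sup>2"
proof (rule real_sqrt_unique)
  have "1 - a2 ^ 4 / a3 ^ 4 = (a3 ^ 4 - a2 ^ 4) / a3 ^ 4"
    using a_pos by (simp add: diff_divide_distrib)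
  also have "\<dots> = a4 ^ 4 / a3 ^ 4" by (simp add: a_quartic)
  finally have "1 - a2 ^ 4 / a3 ^ 4 = a4 ^ 4 / a3 ^ 4" .
  then show "(a4\<^sup>2 / a3\<^sup>2)\<^sup>2 = 1 - modk\<^sup>2"
    by (simp add: modk_def power_divide)
qed simp

lemma dth_real: "dth = of_real (Re dth)"
  using has_real_derivative_of_complex(2)[of th1 dth 0 "theta1 q"] th_DERIV(1)[of 0] th1_of_real
  by (simp add: dth_def)

lemma ellK_modk: "ellK modk = lam * (pi / 2)"
proof (rule ellK_eqI)
  define f where "f x = a3 / a2 * theta1 q x / theta4 q x" for x :: real
  define g where "g x = a4 / a2 * theta2 q x / theta4 q x" for x :: real
  define h where "h x = a4 / a3 * theta3 q x / theta4 q x" for x :: real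
  note of_real_th = th1_of_real th2_of_real th3_of_real th4_of_real
  have t4: "theta4 q x \<noteq> 0" for x :: real
    using th4_real_nonzero[of x] th4_of_real[of x] by auto
  have sq2: "a4\<^sup>2 * (theta2 q x)\<^sup>2 = a2\<^sup>2 * (theta4 q x)\<^sup>2 - a3\<^sup>2 * (theta1 q x)\<^sup>2" for x
    using th2_sq_eq[of "of_real x"] unfolding th_0 of_real_th
    by (simp flip: of_real_power of_real_mult of_real_diff)
  have sq3: "a4\<^sup>2 * (theta3 q x)\<^sup>2 = a3\<^sup>2 * (theta4 q x)\<^sup>2 - a2\<^sup>2 * (theta1 q x)\<^sup>2" for x
    using th3_sq_eq[of "of_real x"] unfolding th_0 of_real_th
    by (simp flip: of_real_power of_real_mult of_real_diff)
  show f: "(f has_real_derivative lam * g x * h x) (at x)" for x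
  proof -
    let ?X = "complex_of_real x"
    have "((\<lambda>z. th1 z / th4 z) has_field_derivative
        (deriv th1 ?X * th4 ?X - th1 ?X * deriv th4 ?X) / (th4 ?X)\<^sup>2) (at ?X)"
      using th4_real_nonzero[of x]
      by (auto intro!: derivative_eq_intros simp: power2_eq_square)
    from DERIV_cmult[OF this, of "of_real (a3 / a2)"]
    have "((\<lambda>z. of_real (a3 / a2) * th1 z / th4 z) has_field_derivative
        of_real (a3 / a2) * (deriv th1 ?X * th4 ?X - th1 ?X * deriv th4 ?X) / (th4 ?X)\<^sup>2) (at ?X)"
      by simp
    moreover have "of_real (a3 / a2) * (deriv th1 ?X * th4 ?X - th1 ?X * deriv th4 ?X) / (th4 ?X)\<^sup>2 =
        of_real (lam * g x * h x)"
    proof -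
      have "of_real a2 * of_real a3 * (deriv th1 ?X * th4 ?X - th1 ?X * deriv th4 ?X) =
          of_real (a4 * Re dth * theta2 q x * theta3 q x)"
        using wronskian_1_4[of ?X] unfolding th_0 of_real_th by (metis dth_real of_real_mult)
      then have W: "deriv th1 ?X * th4 ?X - th1 ?X * deriv th4 ?X = of_real (a4 * Re dth * theta2 q x * theta3 q x / (a2 * a3))"
        using a_pos by (simp add: field_simps)
      show ?thesis
        unfolding W unfolding of_real_th lam_def g_def h_def using a_pos t4[of x]
        by (simp add: field_simps power2_eq_square)
    qed
    moreover have "of_real (a3 / a2) * th1 (of_real t) / th4 (of_real t) = of_real (f t)" for t
      by (simp add: f_def of_real_th)
    ultimately show ?thesis
      using has_real_derivative_of_complex(1)[of _ "of_real (lam * g x * h x)" x f] by simp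
  qed
  show fg: "(f x)\<^sup>2 + (g x)\<^sup>2 = 1" for x
    using sq2[of x] t4[of x] a_pos unfolding f_def g_def
    by (simp add: power_divide power_mult_distrib field_simps)
  show fh: "(h x)\<^sup>2 + modk\<^sup>2 * (f x)\<^sup>2 = 1" for x
    using sq3[of x] t4[of x] a_pos unfolding f_def h_def modk_def
    by (simp add: power_divide power_mult_distrib field_simps power2_eq_square)
  show "f 0 = 0" using th1_of_real[of 0] by (simp add: f_def)
  have "th1 (of_real (pi/2)) = of_real a2" "th4 (of_real (pi/2)) = of_real a3"
    using th1_plus_half_pi[of 0] th4_plus_half_pi[of 0] th_0 by auto
  then have "theta1 q (pi/2) = a2" "theta4 q (pi/2) = a3"
    unfolding of_real_th by simp_all
  then show "f (pi / 2) = 1" using a_pos by (simp add: f_def)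
  have holo: "continuous_on UNIV (\<lambda>x::real. theta2 q x)" "continuous_on UNIV (\<lambda>x::real. theta3 q x)" 
      "continuous_on UNIV (\<lambda>x::real. theta4 q x)"
    using th_DERIV(2,3,4)[THEN has_real_derivative_of_complex(1)] of_real_th
    by (meson DERIV_isCont continuous_at_imp_continuous_on)+
  have cg: "continuous_on S g" and ch: "continuous_on S h" for S
    unfolding g_def h_def using t4 a_pos by (auto intro!: continuous_intros continuous_on_subset[OF holo(1)] 
        continuous_on_subset[OF holo(2)] continuous_on_subset[OF holo(3)])
  have g0: "g 0 = 1" "h 0 = 1" using a_pos by (simp_all add: g_def h_def a2_def a3_def a4_def)
  show "0 < g x" if x: "x \<in> {0<..<pi/2}" for x
  proof (rule continuous_nonzero_pos[OF cg])
    show "g y \<noteq> 0" if "y \<in> {0..x}" for y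
    proof -
      have "cos y > 0" using that x by (intro cos_gt_zero_pi) auto
      then have "th2 (of_real y) \<noteq> 0" using ht_pos by (intro th2_nonzero) (auto simp: cos_of_real)
      then show ?thesis using a_pos t4 by (simp add: g_def th2_of_real)
    qed
  qed (use x g0 in auto)
  show "0 < h x" if x: "x \<in> {0..pi/2}" for x
  proof (rule continuous_nonzero_pos[OF ch])
    show "h y \<noteq> 0" if "y \<in> {0..x}" for y
    proof -
      have "(f y)\<^sup>2 \<le> 1" using fg[of y] by (metis le_add_same_cancel1 zero_le_power2)
      then have "modk\<^sup>2 * (f y)\<^sup>2 \<le> modk\<^sup>2 * 1" by (intro mult_left_mono) auto
      also have "modk\<^sup>2 * 1 < 1" using modk_bounds by (simp add: power_less_one_iff)
      finally show ?thesis using fh[of y] by auto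
    qed
  qed (use x g0 in auto)
qed (use modk_bounds in auto)

lemma cnj_theta: "cnj (th1 x) = th1 (cnj x)" "cnj (th2 x) = th2 (cnj x)"
  "cnj (th3 x) = th3 (cnj x)" "cnj (th4 x) = th4 (cnj x)"
proof -
  have P: "cnj (gauss_powser q w) = gauss_powser q (cnj w)" for w
  proof -
    have "(\<lambda>n. cnj (of_real (q ^ n\<^sup>2) * w ^ n)) sums cnj (gauss_powser q w)"
      using has_sum_imp_sums[OF gauss_powser_has_sum[OF q_pos q_less_1, of w]]
      by (rule sums_cnj[THEN iffD2])
    then show ?thesis
      using has_sum_imp_sums[OF gauss_powser_has_sum[OF q_pos q_less_1, of "cnj w"]]
      by (simp add: sums_unique2)
  qed
  show t3: "cnj (th3 x) = th3 (cnj x)" for x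
    by (simp add: theta3_eq_gauss_powser[OF q_pos q_less_1] P exp_cnj)
  have t2': "cnj (th2 x) = th2 (- cnj x)" for x
  proof -
    have "cnj (th2 x) = exp (of_real (ln q) / 4 - \<i> * cnj x) * th3 (cnj x + \<i> * of_real (ln q) / 2)"
      by (simp add: theta2_eq_theta3[OF q_pos q_less_1] t3 exp_cnj)
    also have "\<dots> = th2 (- cnj x)"
      using th3_minus[of "cnj x + \<i> * of_real (ln q) / 2"]
      by (simp add: theta2_eq_theta3[OF q_pos q_less_1])
    finally show ?thesis .
  qed
  then show t2: "cnj (th2 x) = th2 (cnj x)" for x by simp
  show "cnj (th1 x) = th1 (cnj x)" "cnj (th4 x) = th4 (cnj x)"
    by (simp_all add: theta1_eq_theta2 theta4_eq_theta3 t2 t3)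
qed

text \<open>On the imaginary axis conjugation is negation, so parity makes the three even functions
  real and \<open>th1\<close> purely imaginary.\<close>

lemma theta_imaginary_axis:
  fixes t :: real
  defines "z \<equiv> \<i> * complex_of_real t"
  shows "- \<i> * th1 z = of_real (Re (- \<i> * th1 z))" "th2 z = of_real (Re (th2 z))"
    "th3 z = of_real (Re (th3 z))" "th4 z = of_real (Re (th4 z))"
proof -
  have "cnj z = - z" by (simp add: z_def)
  then have c: "cnj (- \<i> * th1 z) = - \<i> * th1 z" "cnj (th2 z) = th2 z" "cnj (th3 z) = th3 z" "cnj (th4 z) = th4 z"
    by (simp_all add: cnj_theta)
  have "w = of_real (Re w)" if "cnj w = w" for w
    using that by (simp add: complex_eq_iff)
  from c[THEN this] show "- \<i> * th1 z = of_real (Re (- \<i> * th1 z))" "th2 z = of_real (Re (th2 z))"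
    "th3 z = of_real (Re (th3 z))" "th4 z = of_real (Re (th4 z))" .
qed

text \<open>
  Along the imaginary axis the quotients \<open>- \<i> \<theta>\<^sub>1 / \<theta>\<^sub>2\<close>, \<open>\<theta>\<^sub>4 / \<theta>\<^sub>2\<close>, \<open>\<theta>\<^sub>3 / \<theta>\<^sub>2\<close> are, up to
  constants, the functions sn, cn, dn of the complementary modulus (Jacobi's imaginary transformation).
\<close>

lemma ellK_compl_modk: "ellK (compl_modulus modk) = lam * ht"
proof -
  define t1 where "t1 t = Re (- \<i> * th1 (\<i> * of_real t))" for t :: real
  define t2 where "t2 t = Re (th2 (\<i> * of_real t))" for t :: real
  define t3 where "t3 t = Re (th3 (\<i> * of_real t))" for t :: real
  define t4 where "t4 t = Re (th4 (\<i> * of_real t))" for t :: real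
  have im: "th1 (\<i> * of_real t) = \<i> * of_real (t1 t)" "th2 (\<i> * of_real t) = of_real (t2 t)"
    "th3 (\<i> * of_real t) = of_real (t3 t)" "th4 (\<i> * of_real t) = of_real (t4 t)" for t
  proof -
    show "th1 (\<i> * of_real t) = \<i> * of_real (t1 t)"
      using arg_cong[OF theta_imaginary_axis(1)[of t], of "\<lambda>z. \<i> * z"] by (simp add: t1_def)
  qed (use theta_imaginary_axis[of t] in \<open>simp_all add: t2_def t3_def t4_def\<close>)
  define f where "f t = a3 / a4 * t1 t / t2 t" for t
  define g where "g t = a2 / a4 * t4 t / t2 t" for t
  define h where "h t = a2 / a3 * t3 t / t2 t" for t
  have t2nz: "t2 t \<noteq> 0" if "t \<in> {0..ht}" for t
  proof -
    have "cos (\<i> * of_real t) \<noteq> 0"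
    proof
      assume "cos (\<i> * of_real t) = 0"
      then obtain n where "\<i> * of_real t = complex_of_real (of_int n * pi) + of_real pi / 2"
        using Complex_Transcendental.cos_eq_0 by blast
      from arg_cong[OF this, of Re] have "of_int (2 * n + 1) * pi = 0" by (simp add: algebra_simps)
      then have "2 * n + 1 = 0" by (simp only: mult_eq_0_iff of_int_eq_0_iff pi_neq_zero simp_thms)
      then show False by presburger
    qed
    then show ?thesis using th2_nonzero[of "\<i> * of_real t"] that im(2)[of t] by auto
  qed
  have f: "(f has_real_derivative lam * g t * h t) (at t)" if "t \<in> {0..ht}" for t
  proof -
    let ?X = "\<i> * complex_of_real t"
    have nz: "th2 ?X \<noteq> 0" using t2nz[OF that] im by simp
    have "((\<lambda>z. th1 (\<i> * z) / th2 (\<i> * z)) has_field_derivative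
        \<i> * (deriv th1 ?X * th2 ?X - th1 ?X * deriv th2 ?X) / (th2 ?X)\<^sup>2) (at (of_real t))"
      using nz by (auto intro!: derivative_eq_intros simp: power2_eq_square algebra_simps)
    then have "((\<lambda>z. of_real (a3 / a4) * - \<i> * (th1 (\<i> * z) / th2 (\<i> * z))) has_field_derivative
        of_real (a3 / a4) * (deriv th1 ?X * th2 ?X - th1 ?X * deriv th2 ?X) / (th2 ?X)\<^sup>2) (at (of_real t))"
      by (rule DERIV_cong[OF DERIV_cmult]) (simp add: mult_ac)
    moreover have "of_real (a3 / a4) * (deriv th1 ?X * th2 ?X - th1 ?X * deriv th2 ?X) / (th2 ?X)\<^sup>2 =
        of_real (lam * g t * h t)"
    proof -
      have "of_real a3 * of_real a4 * (deriv th1 ?X * th2 ?X - th1 ?X * deriv th2 ?X) =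
          of_real (a2 * Re dth * t3 t * t4 t)"
        using wronskian_1_2[of ?X] unfolding th_0 im by (metis dth_real of_real_mult)
      then have W: "deriv th1 ?X * th2 ?X - th1 ?X * deriv th2 ?X = of_real (a2 * Re dth * t3 t * t4 t / (a3 * a4))"
        using a_pos by (simp add: field_simps)
      show ?thesis
        unfolding W unfolding im lam_def g_def h_def using a_pos t2nz[OF that]
        by (simp add: field_simps power2_eq_square)
    qed
    moreover have "of_real (a3 / a4) * - \<i> * (th1 (\<i> * of_real t) / th2 (\<i> * of_real t)) = of_real (f t)" for t
      by (simp add: f_def im mult_ac)
    ultimately show ?thesis
      using has_real_derivative_of_complex(1)[of _ "of_real (lam * g t * h t)" t f] by simp
  qed
  have fg: "(f t)\<^sup>2 + (g t)\<^sup>2 = 1" if "t \<in> {0..ht}" for t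
  proof -
    have "complex_of_real (a4\<^sup>2 * (t2 t)\<^sup>2) = of_real (a2\<^sup>2 * (t4 t)\<^sup>2 + a3\<^sup>2 * (t1 t)\<^sup>2)"
      using th2_sq_eq[of "\<i> * of_real t"] unfolding th_0 im by (simp add: power_mult_distrib)
    then have "a4\<^sup>2 * (t2 t)\<^sup>2 = a2\<^sup>2 * (t4 t)\<^sup>2 + a3\<^sup>2 * (t1 t)\<^sup>2" by (simp only: of_real_eq_iff)
    moreover have "a4\<^sup>2 * (t2 t)\<^sup>2 \<noteq> 0" using t2nz[OF that] a_pos by simp
    moreover have "(f t)\<^sup>2 + (g t)\<^sup>2 = (a2\<^sup>2 * (t4 t)\<^sup>2 + a3\<^sup>2 * (t1 t)\<^sup>2) / (a4\<^sup>2 * (t2 t)\<^sup>2)"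
      by (simp add: f_def g_def power_divide power_mult_distrib add_divide_distrib)
    ultimately show ?thesis by simp
  qed
  have fh: "(h t)\<^sup>2 + (compl_modulus modk)\<^sup>2 * (f t)\<^sup>2 = 1" if "t \<in> {0..ht}" for t
  proof -
    \<comment> \<open>Divided by the right-hand side, this is the relation between sn and dn for the
      complementary modulus, with \<open>th2\<close> in the denominator.\<close>
    have "(th2 0)\<^sup>2 * (th3 x)\<^sup>2 - (th4 0)\<^sup>2 * (th1 x)\<^sup>2 = (th3 0)\<^sup>2 * (th2 x)\<^sup>2" for x
      unfolding th1_sq th2_sq th3_sq th4_sq by algebra
    from this[of "\<i> * of_real t"]
    have "complex_of_real (a2\<^sup>2 * (t3 t)\<^sup>2 + a4\<^sup>2 * (t1 t)\<^sup>2) = of_real (a3\<^sup>2 * (t2 t)\<^sup>2)"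
      unfolding th_0 im by (simp add: power_mult_distrib)
    then have "a2\<^sup>2 * (t3 t)\<^sup>2 + a4\<^sup>2 * (t1 t)\<^sup>2 = a3\<^sup>2 * (t2 t)\<^sup>2" by (simp only: of_real_eq_iff)
    moreover have "a3\<^sup>2 * (t2 t)\<^sup>2 \<noteq> 0" using t2nz[OF that] a_pos by simp
    moreover have "(h t)\<^sup>2 + (compl_modulus modk)\<^sup>2 * (f t)\<^sup>2 =
        (a2\<^sup>2 * (t3 t)\<^sup>2 + a4\<^sup>2 * (t1 t)\<^sup>2) / (a3\<^sup>2 * (t2 t)\<^sup>2)"
      unfolding compl_modk using a_pos
      by (simp add: f_def h_def power_divide power_mult_distrib add_divide_distrib power2_eq_square mult_ac)
    ultimately show ?thesis by simp
  qed
  have cm: "0 \<le> compl_modulus modk" "compl_modulus modk < 1"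
    using modk_bounds by (auto simp: power_le_one)
  have cont: "continuous_on UNIV t2" "continuous_on UNIV t3" "continuous_on UNIV t4"
    unfolding t2_def [abs_def] t3_def [abs_def] t4_def [abs_def]
    by (intro continuous_intros holomorphic_on_imp_continuous_on[OF holomorphic_th2, THEN continuous_on_compose2]
        holomorphic_on_imp_continuous_on[OF holomorphic_th3, THEN continuous_on_compose2]
        holomorphic_on_imp_continuous_on[OF holomorphic_th4, THEN continuous_on_compose2]; simp)+
  have cg: "continuous_on S g" and ch: "continuous_on S h" if "S \<subseteq> {0..ht}" for S
  proof -
    have "\<And>t. t \<in> S \<Longrightarrow> a4 \<noteq> 0 \<and> a3 \<noteq> 0 \<and> t2 t \<noteq> 0" using t2nz that a_pos by auto
    then show "continuous_on S g" "continuous_on S h"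
      unfolding g_def h_def by (auto intro!: continuous_intros continuous_on_subset[OF cont(1)] 
          continuous_on_subset[OF cont(2)] continuous_on_subset[OF cont(3)])
  qed
  have t0: "t2 0 = a2" "t3 0 = a3" "t4 0 = a4"
    by (simp_all add: t2_def t3_def t4_def th_0)
  have g0: "g 0 = 1" "h 0 = 1" using a_pos by (simp_all add: g_def h_def t0)
  have gpos: "0 < g x" if x: "x \<in> {0<..<ht}" for x
  proof (rule continuous_nonzero_pos[OF cg, of 0 x])
    show "g y \<noteq> 0" if "y \<in> {0..x}" for y
      using th4_nonzero[of "\<i> * of_real y"] t2nz[of y] im(4)[of y] that x a_pos by (auto simp: g_def)
  qed (use x g0 in auto)
  have hpos: "0 < h x" if x: "x \<in> {0..ht}" for x
  proof (rule continuous_nonzero_pos[OF ch, of 0 x])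
    show "h y \<noteq> 0" if "y \<in> {0..x}" for y
    proof -
      have y: "y \<in> {0..ht}" using that x by auto
      have "(f y)\<^sup>2 \<le> 1" using fg[OF y] by (metis le_add_same_cancel1 zero_le_power2)
      then have "(compl_modulus modk)\<^sup>2 * (f y)\<^sup>2 \<le> (compl_modulus modk)\<^sup>2 * 1" by (intro mult_left_mono) auto
      also have "(compl_modulus modk)\<^sup>2 * 1 < 1" using cm by (simp only: mult_1_right power_less_one_iff) simp
      finally show ?thesis using fh[OF y] by auto
    qed
  qed (use x g0 in auto)
  have f0: "f 0 = 0" by (simp add: f_def t1_def)
  have "g ht = 0" by (simp add: g_def t4_def th4_ht)
  then have "(f ht)\<^sup>2 = 1" using fg[of ht] ht_pos by simp
  \<comment> \<open>The sign is not tracked along the axis. The value -1 would give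
    \<open>K' = - lam * ht\<close>, which contradicts positivity of K', since the integral along the
    real axis has already shown \<open>lam\<close> to be positive.\<close>
  then consider "f ht = 1" | "f ht = -1" by (auto simp: power2_eq_1_iff)
  then show ?thesis
  proof cases
    case 1
    show ?thesis by (rule ellK_eqI[OF ht_pos cm f fg fh gpos hpos f0 1])
  next
    case 2
    have "ellK (compl_modulus modk) = - lam * ht"
    proof (rule ellK_eqI[OF ht_pos cm _ _ _ gpos hpos, of "\<lambda>t. - f t"])
      show "((\<lambda>t. - f t) has_real_derivative - lam * g t * h t) (at t)" if "t \<in> {0..ht}" for t
        using DERIV_minus[OF f[OF that]] by simp
    qed (use fg fh f0 2 in auto)
    moreover have "0 < ellK (compl_modulus modk)" by (intro ellK_pos cm)
    moreover have "0 < lam * (pi / 2)" using ellK_modk ellK_pos[of modk] modk_bounds by simp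
    ultimately show ?thesis using ht_pos
      by (smt (verit) mult_minus_left mult_pos_pos pi_half_gt_zero zero_less_mult_pos2)
  qed
qed

lemma lam_pos: "0 < lam"
proof -
  have "0 < lam * (pi / 2)" using ellK_modk ellK_pos[of modk] modk_bounds by simp
  then show ?thesis by (simp add: zero_less_mult_iff)
qed

lemma nome_modk: "nome modk = q"
  using lam_pos q_pos unfolding nome_def ellK_modk ellK_compl_modk
  by (simp add: ht_def field_simps)

end

lemma nome_bounds:
  assumes "0 < k" "k < 1"
  shows "0 < nome k" "nome k < 1"
proof -
  have "0 < ellK k" "0 < ellK (compl_modulus k)"
    using assms by (auto intro!: ellK_pos simp: power_less_one_iff power_le_one)
  then show "0 < nome k" "nome k < 1" by (auto simp: nome_def)
qed

section \<open>Jacobi elliptic functions\<close>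

locale jacobi_modulus =
  fixes k :: real
  assumes k_pos: "0 < k" and k_less_1: "k < 1"

sublocale jacobi_modulus \<subseteq> theta_nome "nome k"
  using nome_bounds k_pos k_less_1 by unfold_locales

context jacobi_modulus
begin

abbreviation "HH \<equiv> (jacobi_H k :: complex \<Rightarrow> complex)"
abbreviation "TT \<equiv> (jacobi_Theta k :: complex \<Rightarrow> complex)"
abbreviation "ZZ \<equiv> (jacobi_Z k :: complex \<Rightarrow> complex)"
abbreviation "sn \<equiv> (jacobi_sn k :: complex \<Rightarrow> complex)"
abbreviation "cn \<equiv> (jacobi_cn k :: complex \<Rightarrow> complex)"
abbreviation "dn \<equiv> (jacobi_dn k :: complex \<Rightarrow> complex)"

text \<open>Here \<open>q\<close> is \<open>nome k\<close>, so \<open>modk\<close> and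
  \<open>k\<close> have the same nome. Only now do the prefactors in the definitions of sn, cn, dn
  become ratios of null values.\<close>

lemma modk_eq: "modk = k"
  using nome_inj[of modk k] modk_bounds k_pos k_less_1 nome_modk by simp

lemma k_eq: "k = a2\<^sup>2 / a3\<^sup>2"
  using modk_eq by (simp add: modk_def)

lemma compl_k_eq: "compl_modulus k = a4\<^sup>2 / a3\<^sup>2"
  using compl_modk modk_eq by simp

lemma sqrt_k: "sqrt k = a2 / a3"
proof (rule real_sqrt_unique)
  show "(a2 / a3)\<^sup>2 = k" unfolding power_divide by (rule k_eq[symmetric])
qed (use a_pos in simp)

lemma sqrt_compl_k: "sqrt (compl_modulus k) = a4 / a3"
proof (rule real_sqrt_unique)
  show "(a4 / a3)\<^sup>2 = compl_modulus k" unfolding power_divide by (rule compl_k_eq[symmetric])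
qed (use a_pos in simp)

lemma sqrt_compl_k_div_k: "sqrt (compl_modulus k / k) = a4 / a2"
proof (rule real_sqrt_unique)
  have "(a4\<^sup>2 / a3\<^sup>2) / (a2\<^sup>2 / a3\<^sup>2) = (a4 / a2)\<^sup>2"
    using a_pos by (simp add: power_divide)
  then show "(a4 / a2)\<^sup>2 = compl_modulus k / k"
    by (simp only: compl_k_eq[symmetric] k_eq[symmetric])
qed (use a_pos in simp)

lemma of_real_k_sq: "complex_of_real (k\<^sup>2) = (of_real a2) ^ 4 / (of_real a3) ^ 4"
proof -
  have "(a2\<^sup>2 / a3\<^sup>2)\<^sup>2 = a2 ^ 4 / a3 ^ 4" by (simp add: power_divide)
  then have "k\<^sup>2 = a2 ^ 4 / a3 ^ 4" by (simp only: k_eq[symmetric])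
  from arg_cong[OF this, of complex_of_real] show ?thesis by simp
qed

lemma ellK_eq: "ellK k = lam * (pi / 2)"
  using ellK_modk modk_eq by simp

lemma scale_eq: "pi / (2 * ellK k) = 1 / lam"
  using lam_pos by (simp add: ellK_eq)

lemma HH_eq: "HH x = th1 (of_real (1 / lam) * x)" and TT_eq: "TT x = th4 (of_real (1 / lam) * x)"
  unfolding jacobi_H_def jacobi_Theta_def scale_eq by simp_all

lemma sn_eq: "sn x = of_real (a3 / a2) * (th1 (of_real (1 / lam) * x) / th4 (of_real (1 / lam) * x))"
  and cn_eq: "cn x = of_real (a4 / a2) * (th2 (of_real (1 / lam) * x) / th4 (of_real (1 / lam) * x))"
  and dn_eq: "dn x = of_real (a4 / a3) * (th3 (of_real (1 / lam) * x) / th4 (of_real (1 / lam) * x))"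
  unfolding jacobi_sn_def jacobi_cn_def jacobi_dn_def HH_eq TT_eq sqrt_k sqrt_compl_k sqrt_compl_k_div_k scale_eq
  by simp_all

lemma HH_minus [simp]: "HH (- x) = - HH x" and TT_minus [simp]: "TT (- x) = TT x"
  by (simp_all add: HH_eq TT_eq)

lemma HH_0 [simp]: "HH 0 = 0"
  by (simp add: HH_eq)

lemma TT_0: "TT 0 = of_real a4"
  by (simp add: TT_eq th_0)

lemma TT_0_nonzero: "TT 0 \<noteq> 0"
  using a_pos by (simp add: TT_0)

lemma TT_real_nonzero: "TT (of_real x) \<noteq> 0"
  using th4_real_nonzero[of "x / lam"] by (simp add: TT_eq)

lemma sn_minus [simp]: "sn (- x) = - sn x" and cn_minus [simp]: "cn (- x) = cn x"
  and dn_minus [simp]: "dn (- x) = dn x"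
  by (simp_all add: sn_eq cn_eq dn_eq)

lemma holomorphic_HH: "HH holomorphic_on UNIV" and holomorphic_TT: "TT holomorphic_on UNIV"
  by (subst HH_eq[abs_def] TT_eq[abs_def]; intro holomorphic_intros)+

lemma HH_DERIV: "(HH has_field_derivative deriv HH x) (at x)"
  and TT_DERIV: "(TT has_field_derivative deriv TT x) (at x)"
  using holomorphic_HH holomorphic_TT by (auto intro: holomorphic_derivI[OF _ open_UNIV])

lemmas HH_DERIV' [derivative_intros] = HH_DERIV[THEN DERIV_chain2]
lemmas TT_DERIV' [derivative_intros] = TT_DERIV[THEN DERIV_chain2]

lemma deriv_HH_minus [simp]: "deriv HH (- x) = deriv HH x"
proof -
  have "((\<lambda>x. HH (- x)) has_field_derivative deriv HH (- x) * (- 1)) (at x)"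
    by (rule derivative_eq_intros refl)+
  moreover have "((\<lambda>x. HH (- x)) has_field_derivative - deriv HH x) (at x)"
    unfolding HH_minus by (rule DERIV_minus[OF HH_DERIV])
  ultimately show ?thesis using DERIV_unique by fastforce
qed

lemma deriv_TT_minus [simp]: "deriv TT (- x) = - deriv TT x"
proof -
  have "((\<lambda>x. TT (- x)) has_field_derivative deriv TT (- x) * (- 1)) (at x)"
    by (rule derivative_eq_intros refl)+
  moreover have "((\<lambda>x. TT (- x)) has_field_derivative deriv TT x) (at x)"
    unfolding TT_minus by (rule TT_DERIV)
  ultimately show ?thesis using DERIV_unique by fastforce
qed

lemma ZZ_minus [simp]: "ZZ (- x) = - ZZ x"
  by (simp add: jacobi_Z_def)

lemma deriv_TT_eq: "TT x \<noteq> 0 \<Longrightarrow> deriv TT x = ZZ x * TT x"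
  by (simp add: jacobi_Z_def)

lemma dth_eq: "dth = of_real (lam * a2 * a4 / a3)"
proof -
  have "Re dth = lam * a2 * a4 / a3" unfolding lam_def using a_pos by simp
  then show ?thesis by (metis dth_real)
qed

lemma deriv_HH_0: "deriv HH 0 = of_real (sqrt k) * TT 0"
proof -
  have "(HH has_field_derivative dth * of_real (1 / lam)) (at 0)"
    unfolding HH_eq[abs_def] using lam_pos by (auto intro!: derivative_eq_intros simp: dth_def)
  then have "deriv HH 0 = dth * of_real (1 / lam)" by (rule DERIV_imp_deriv)
  then show ?thesis
    using lam_pos a_pos by (simp add: dth_eq sqrt_k TT_0)
qed

lemma sn_sq: "TT x \<noteq> 0 \<Longrightarrow> (HH x)\<^sup>2 = of_real k * (sn x)\<^sup>2 * (TT x)\<^sup>2"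
  using k_pos by (simp add: jacobi_sn_def power_divide power_mult_distrib flip: of_real_power)

lemma sn_cn_sq: "TT x \<noteq> 0 \<Longrightarrow> (sn x)\<^sup>2 + (cn x)\<^sup>2 = 1"
  and dn_sn_sq: "TT x \<noteq> 0 \<Longrightarrow> (dn x)\<^sup>2 + of_real (k\<^sup>2) * (sn x)\<^sup>2 = 1"
proof -
  let ?y = "of_real (1 / lam) * x"
  assume "TT x \<noteq> 0"
  then have nz: "th4 ?y \<noteq> 0" by (simp add: TT_eq)
  have c: "complex_of_real a2 \<noteq> 0" "complex_of_real a3 \<noteq> 0" "complex_of_real a4 \<noteq> 0" using a_pos by auto
  have "(of_real a3)\<^sup>2 * (th1 ?y)\<^sup>2 + (of_real a4)\<^sup>2 * (th2 ?y)\<^sup>2 = (of_real a2)\<^sup>2 * (th4 ?y)\<^sup>2"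
    using th2_sq_eq[of ?y] unfolding th_0 by (simp add: algebra_simps)
  then show "(sn x)\<^sup>2 + (cn x)\<^sup>2 = 1"
    unfolding sn_eq cn_eq using nz c
    by (simp add: power_mult_distrib power_divide divide_simps) 
  have "(of_real a4)\<^sup>2 * (th3 ?y)\<^sup>2 + (of_real a2)\<^sup>2 * (th1 ?y)\<^sup>2 = (of_real a3)\<^sup>2 * (th4 ?y)\<^sup>2"
    using th3_sq_eq[of ?y] unfolding th_0 by (simp add: algebra_simps)
  then show "(dn x)\<^sup>2 + of_real (k\<^sup>2) * (sn x)\<^sup>2 = 1"
    unfolding sn_eq dn_eq of_real_k_sq using nz c
    by (simp add: power_mult_distrib power_divide divide_simps power4_eq_xxxx power2_eq_square)
       (simp add: algebra_simps)
qed

lemma theta_quotient_DERIV: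
  fixes f f' :: "complex \<Rightarrow> complex"
  assumes f: "\<And>y. (f has_field_derivative f' y) (at y)"
    and W: "\<And>y. f' y * th4 y - f y * deriv th4 y = W y"
    and nz: "TT x \<noteq> 0"
  shows "((\<lambda>x. c * (f (of_real (1 / lam) * x) / th4 (of_real (1 / lam) * x))) has_field_derivative
    c * of_real (1 / lam) * W (of_real (1 / lam) * x) / (th4 (of_real (1 / lam) * x))\<^sup>2) (at x)"
proof -
  have nz': "th4 (of_real (1 / lam) * x) \<noteq> 0" using nz by (simp add: TT_eq)
  note f[THEN DERIV_chain2, derivative_intros]
  show ?thesis
    unfolding W[symmetric]
    by (rule derivative_eq_intros refl nz')+ (simp add: power2_eq_square divide_simps algebra_simps)
qed

lemma sn_DERIV: "TT x \<noteq> 0 \<Longrightarrow> (sn has_field_derivative cn x * dn x) (at x)"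
  and cn_DERIV: "TT x \<noteq> 0 \<Longrightarrow> (cn has_field_derivative - sn x * dn x) (at x)"
  and dn_DERIV: "TT x \<noteq> 0 \<Longrightarrow> (dn has_field_derivative - of_real (k\<^sup>2) * sn x * cn x) (at x)"
proof -
  assume nz: "TT x \<noteq> 0"
  let ?y = "of_real (1 / lam) * x"
  have nz': "th4 ?y \<noteq> 0" using nz by (simp add: TT_eq)
  have c: "complex_of_real a2 \<noteq> 0" "complex_of_real a3 \<noteq> 0" "complex_of_real a4 \<noteq> 0" "complex_of_real lam \<noteq> 0"
    using a_pos lam_pos by auto
  let ?l = "complex_of_real lam" and ?a2 = "complex_of_real a2" and ?a3 = "complex_of_real a3" and ?a4 = "complex_of_real a4"
  have d: "dth = ?l * ?a2 * ?a4 / ?a3" by (simp add: dth_eq)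
  have w1: "deriv th1 y * th4 y - th1 y * deriv th4 y = ?l * (?a4\<^sup>2 / ?a3\<^sup>2) * th2 y * th3 y" for y
  proof -
    have "?a2 * ?a3 * (deriv th1 y * th4 y - th1 y * deriv th4 y) = ?a2 * ?a3 * (?l * (?a4\<^sup>2 / ?a3\<^sup>2) * th2 y * th3 y)"
      using wronskian_1_4[of y] c unfolding th_0 d by (simp add: power2_eq_square)
    then show ?thesis using c by (simp only: mult_left_cancel mult_eq_0_iff simp_thms)
  qed
  have w2: "deriv th2 y * th4 y - th2 y * deriv th4 y = - ?l * th1 y * th3 y" for y
  proof -
    have "?a2 * ?a4 * (deriv th2 y * th4 y - th2 y * deriv th4 y) = ?a2 * ?a4 * (- ?l * th1 y * th3 y)"
      using wronskian_2_4[of y] c unfolding th_0 d by simp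
    then show ?thesis using c by (simp only: mult_left_cancel mult_eq_0_iff simp_thms)
  qed
  have w3: "deriv th3 y * th4 y - th3 y * deriv th4 y = - ?l * (?a2\<^sup>2 / ?a3\<^sup>2) * th1 y * th2 y" for y
  proof -
    have "?a3 * ?a4 * (deriv th3 y * th4 y - th3 y * deriv th4 y) = ?a3 * ?a4 * (- ?l * (?a2\<^sup>2 / ?a3\<^sup>2) * th1 y * th2 y)"
      using wronskian_3_4[of y] c unfolding th_0 d by (simp add: power2_eq_square)
    then show ?thesis using c by (simp only: mult_left_cancel mult_eq_0_iff simp_thms)
  qed
  note w = w1 w2 w3
  show "(sn has_field_derivative cn x * dn x) (at x)"
    unfolding sn_eq[abs_def] 
    by (rule DERIV_cong[OF theta_quotient_DERIV[OF th_DERIV(1) w(1) nz]])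
       (use c nz' in \<open>simp add: cn_eq dn_eq divide_simps power2_eq_square mult_ac\<close>)
  show "(cn has_field_derivative - sn x * dn x) (at x)"
    unfolding cn_eq[abs_def] 
    by (rule DERIV_cong[OF theta_quotient_DERIV[OF th_DERIV(2) w(2) nz]])
       (use c nz' in \<open>simp add: sn_eq dn_eq divide_simps power2_eq_square mult_ac\<close>)
  show "(dn has_field_derivative - of_real (k\<^sup>2) * sn x * cn x) (at x)"
    unfolding dn_eq[abs_def] 
    by (rule DERIV_cong[OF theta_quotient_DERIV[OF th_DERIV(3) w(3) nz]])
       (unfold of_real_k_sq, use c nz' in \<open>simp add: sn_eq cn_eq divide_simps power4_eq_xxxx power2_eq_square mult_ac\<close>)
qed

lemma HH_add_diff: "(TT 0)\<^sup>2 * (HH (x + y) * HH (x - y)) = (HH x)\<^sup>2 * (TT y)\<^sup>2 - (TT x)\<^sup>2 * (HH y)\<^sup>2"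
  and TT_add_diff: "(TT 0)\<^sup>2 * (TT (x + y) * TT (x - y)) = (TT x)\<^sup>2 * (TT y)\<^sup>2 - (HH x)\<^sup>2 * (HH y)\<^sup>2"
  using th1_add_diff[of "of_real (1 / lam) * x" "of_real (1 / lam) * y"]
    th4_add_diff[of "of_real (1 / lam) * x" "of_real (1 / lam) * y"]
  by (simp_all add: HH_eq TT_eq distrib_left right_diff_distrib)

subsection \<open>Real arguments\<close>

lemma sn_of_real: "sn (of_real x) = of_real (jacobi_sn k x)"
  and cn_of_real: "cn (of_real x) = of_real (jacobi_cn k x)"
  and dn_of_real: "dn (of_real x) = of_real (jacobi_dn k x)"
  unfolding jacobi_sn_def jacobi_cn_def jacobi_dn_def jacobi_H_def jacobi_Theta_def
  by (simp_all add: th1_of_real[symmetric] th2_of_real[symmetric] th3_of_real[symmetric] th4_of_real[symmetric])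

lemma real_sn_cn_sq: "(jacobi_sn k x)\<^sup>2 + (jacobi_cn k x)\<^sup>2 = (1::real)"
  and real_dn_sn_sq: "(jacobi_dn k x)\<^sup>2 + k\<^sup>2 * (jacobi_sn k x)\<^sup>2 = (1::real)"
proof -
  have "complex_of_real ((jacobi_sn k x)\<^sup>2 + (jacobi_cn k x)\<^sup>2) = of_real 1"
    using sn_cn_sq[OF TT_real_nonzero[of x]] by (simp add: sn_of_real cn_of_real)
  then show "(jacobi_sn k x)\<^sup>2 + (jacobi_cn k x)\<^sup>2 = 1" by (simp only: of_real_eq_iff)
  have "complex_of_real ((jacobi_dn k x)\<^sup>2 + k\<^sup>2 * (jacobi_sn k x)\<^sup>2) = of_real 1"
    using dn_sn_sq[OF TT_real_nonzero[of x]] by (simp add: sn_of_real dn_of_real)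
  then show "(jacobi_dn k x)\<^sup>2 + k\<^sup>2 * (jacobi_sn k x)\<^sup>2 = 1" by (simp only: of_real_eq_iff)
qed

lemma real_sn_DERIV: "(jacobi_sn k has_real_derivative jacobi_cn k x * jacobi_dn k x) (at x)"
  and real_cn_DERIV: "(jacobi_cn k has_real_derivative - jacobi_sn k x * jacobi_dn k x) (at x)"
  and real_dn_DERIV: "(jacobi_dn k has_real_derivative - k\<^sup>2 * jacobi_sn k x * jacobi_cn k x) (at x)"
  using has_real_derivative_of_complex(1)[OF sn_DERIV[OF TT_real_nonzero[of x]] sn_of_real]
    has_real_derivative_of_complex(1)[OF cn_DERIV[OF TT_real_nonzero[of x]] cn_of_real]
    has_real_derivative_of_complex(1)[OF dn_DERIV[OF TT_real_nonzero[of x]] dn_of_real]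
  by (simp_all add: sn_of_real cn_of_real dn_of_real flip: of_real_mult of_real_power of_real_minus)

lemma real_sn_0: "jacobi_sn k (0::real) = 0" and real_cn_0: "jacobi_cn k (0::real) = 1"
  and real_dn_0: "jacobi_dn k (0::real) = 1"
proof -
  have "complex_of_real (jacobi_sn k 0) = of_real 0" "complex_of_real (jacobi_cn k 0) = of_real 1"
    "complex_of_real (jacobi_dn k 0) = of_real 1"
    using a_pos by (simp_all add: sn_of_real[symmetric] cn_of_real[symmetric] dn_of_real[symmetric] sn_eq cn_eq dn_eq th_0)
  then show "jacobi_sn k (0::real) = 0" "jacobi_cn k (0::real) = 1" "jacobi_dn k (0::real) = 1"
    by (simp_all only: of_real_eq_iff)
qed

lemma real_cn_pos:
  fixes x :: real
  assumes "0 \<le> x" "x < ellK k"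
  shows "0 < jacobi_cn k x"
proof (rule continuous_nonzero_pos[of 0 x "jacobi_cn k" x])
  show "continuous_on {0..x} (jacobi_cn k :: real \<Rightarrow> real)"
    by (rule DERIV_continuous_on[OF has_field_derivative_at_within[OF real_cn_DERIV]])
  show "jacobi_cn k y \<noteq> 0" if "y \<in> {0..x}" for y
  proof -
    have "y / lam < pi / 2" using that assms lam_pos by (simp add: ellK_eq field_simps)
    then have "0 < cos (y / lam)" using that lam_pos by (intro cos_gt_zero_pi) (auto intro: less_le_trans[of _ 0])
    then have "cos (complex_of_real (y / lam)) \<noteq> 0" by (simp only: cos_of_real of_real_eq_0_iff)
    then have "th2 (of_real (y / lam)) \<noteq> 0" using ht_pos by (intro th2_nonzero) auto
    then have "cn (of_real y) \<noteq> 0"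
      using a_pos TT_real_nonzero[of y] by (simp add: cn_eq TT_eq)
    then show ?thesis by (simp add: cn_of_real)
  qed
qed (use assms real_cn_0 in auto)

lemma real_dn_pos:
  fixes x :: real
  assumes "0 \<le> x"
  shows "0 < jacobi_dn k x"
proof (rule continuous_nonzero_pos[of 0 x "jacobi_dn k" x])
  show "continuous_on {0..x} (jacobi_dn k :: real \<Rightarrow> real)"
    by (rule DERIV_continuous_on[OF has_field_derivative_at_within[OF real_dn_DERIV]])
  show "jacobi_dn k y \<noteq> 0" if "y \<in> {0..x}" for y
  proof -
    have "(jacobi_sn k y)\<^sup>2 \<le> 1" using real_sn_cn_sq[of y] by (metis le_add_same_cancel1 zero_le_power2)
    then have "k\<^sup>2 * (jacobi_sn k y)\<^sup>2 \<le> k\<^sup>2 * 1" by (intro mult_left_mono) auto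
    also have "k\<^sup>2 * 1 < 1" using k_pos k_less_1 by (simp add: power_less_one_iff)
    finally show ?thesis using real_dn_sn_sq[of y] by auto
  qed
qed (use assms real_dn_0 in auto)

text \<open>Vanishing on a horizontal line would make the function vanish identically. This supplies
  the real points at which linear independence of the two solutions is read off.\<close>

lemma HH_line_nonzero: "\<exists>x::real. HH (of_real x + w) \<noteq> 0"
proof (rule ccontr)
  assume "\<not> ?thesis"
  then have z: "HH (of_real x + w) = 0" for x :: real by blast
  have "HH (z + w) = 0" for z
  proof (rule analytic_continuation[of "\<lambda>z. HH (z + w)" UNIV \<real> 0 z])
    show "(\<lambda>z. HH (z + w)) holomorphic_on UNIV"
      unfolding HH_eq by (intro holomorphic_intros)
    show "0 islimpt (\<real> :: complex set)"
      unfolding islimpt_approachable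
    proof (intro allI impI)
      fix e :: real assume "e > 0"
      then show "\<exists>x'\<in>\<real>. x' \<noteq> (0::complex) \<and> dist x' 0 < e"
        by (intro bexI[of _ "of_real (e / 2)"]) auto
    qed
  qed (use z in \<open>auto elim: Reals_cases\<close>)
  from this[of "of_real (lam * (pi / 2)) - w"]
  have "th1 (of_real pi / 2) = 0" using lam_pos by (simp add: HH_eq)
  then show False using th1_half_pi_nonzero by simp
qed

subsection \<open>Addition formulas for logarithmic derivatives\<close>

lemma HH_add_diff_deriv1:
  "(TT 0)\<^sup>2 * (deriv HH (x + u) * HH (x - u) + HH (x + u) * deriv HH (x - u)) =
    2 * HH x * deriv HH x * (TT u)\<^sup>2 - 2 * TT x * deriv TT x * (HH u)\<^sup>2"
proof (rule DERIV_unique)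
  show "((\<lambda>x. (TT 0)\<^sup>2 * (HH (x + u) * HH (x - u))) has_field_derivative
      (TT 0)\<^sup>2 * (deriv HH (x + u) * HH (x - u) + HH (x + u) * deriv HH (x - u))) (at x)"
    by (auto intro!: derivative_eq_intros simp: algebra_simps)
  show "((\<lambda>x. (TT 0)\<^sup>2 * (HH (x + u) * HH (x - u))) has_field_derivative
      2 * HH x * deriv HH x * (TT u)\<^sup>2 - 2 * TT x * deriv TT x * (HH u)\<^sup>2) (at x)"
    unfolding HH_add_diff by (auto intro!: derivative_eq_intros simp: algebra_simps)
qed

lemma HH_add_diff_deriv2:
  "(TT 0)\<^sup>2 * (deriv HH (x + u) * HH (x - u) - HH (x + u) * deriv HH (x - u)) =
    2 * TT u * deriv TT u * (HH x)\<^sup>2 - 2 * HH u * deriv HH u * (TT x)\<^sup>2"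
proof (rule DERIV_unique)
  show "((\<lambda>u. (TT 0)\<^sup>2 * (HH (x + u) * HH (x - u))) has_field_derivative
      (TT 0)\<^sup>2 * (deriv HH (x + u) * HH (x - u) - HH (x + u) * deriv HH (x - u))) (at u)"
    by (auto intro!: derivative_eq_intros simp: algebra_simps)
  show "((\<lambda>u. (TT 0)\<^sup>2 * (HH (x + u) * HH (x - u))) has_field_derivative
      2 * TT u * deriv TT u * (HH x)\<^sup>2 - 2 * HH u * deriv HH u * (TT x)\<^sup>2) (at u)"
    unfolding HH_add_diff by (auto intro!: derivative_eq_intros simp: algebra_simps)
qed

lemma TT_add_diff_deriv1:
  "(TT 0)\<^sup>2 * (deriv TT (x + u) * TT (x - u) + TT (x + u) * deriv TT (x - u)) =
    2 * TT x * deriv TT x * (TT u)\<^sup>2 - 2 * HH x * deriv HH x * (HH u)\<^sup>2"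
proof (rule DERIV_unique)
  show "((\<lambda>x. (TT 0)\<^sup>2 * (TT (x + u) * TT (x - u))) has_field_derivative
      (TT 0)\<^sup>2 * (deriv TT (x + u) * TT (x - u) + TT (x + u) * deriv TT (x - u))) (at x)"
    by (auto intro!: derivative_eq_intros simp: algebra_simps)
  show "((\<lambda>x. (TT 0)\<^sup>2 * (TT (x + u) * TT (x - u))) has_field_derivative
      2 * TT x * deriv TT x * (TT u)\<^sup>2 - 2 * HH x * deriv HH x * (HH u)\<^sup>2) (at x)"
    unfolding TT_add_diff by (auto intro!: derivative_eq_intros simp: algebra_simps)
qed

lemma TT_add_diff_deriv2:
  "(TT 0)\<^sup>2 * (deriv TT (x + u) * TT (x - u) - TT (x + u) * deriv TT (x - u)) =
    2 * TT u * deriv TT u * (TT x)\<^sup>2 - 2 * HH u * deriv HH u * (HH x)\<^sup>2"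
proof (rule DERIV_unique)
  show "((\<lambda>u. (TT 0)\<^sup>2 * (TT (x + u) * TT (x - u))) has_field_derivative
      (TT 0)\<^sup>2 * (deriv TT (x + u) * TT (x - u) - TT (x + u) * deriv TT (x - u))) (at u)"
    by (auto intro!: derivative_eq_intros simp: algebra_simps)
  show "((\<lambda>u. (TT 0)\<^sup>2 * (TT (x + u) * TT (x - u))) has_field_derivative
      2 * TT u * deriv TT u * (TT x)\<^sup>2 - 2 * HH u * deriv HH u * (HH x)\<^sup>2) (at u)"
    unfolding TT_add_diff by (auto intro!: derivative_eq_intros simp: algebra_simps)
qed

lemma HH_double: "(TT 0)\<^sup>2 * (HH (2 * x) * deriv HH 0) = 2 * HH x * TT x * (deriv HH x * TT x - HH x * deriv TT x)"
  using HH_add_diff_deriv1[of x x] by (simp add: algebra_simps power2_eq_square)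

text \<open>
  Of the four arguments \<open>x + u\<close>, \<open>x - u\<close>, \<open>- (x + v)\<close>, \<open>- (x - v)\<close>, whose sum is \<open>0\<close>, the first two
  enter with \<open>H'/H\<close> and the last two with \<open>Z\<close>; the sum of the four logarithmic derivatives is a
  product of theta functions. Stated without denominators, it also covers the zeros of \<open>H\<close>.
\<close>

lemma four_term:
  "(deriv HH (x + u) * HH (x - u) + HH (x + u) * deriv HH (x - u)) * (TT (x + v) * TT (x - v)) -
    HH (x + u) * HH (x - u) * (deriv TT (x + v) * TT (x - v) + TT (x + v) * deriv TT (x - v)) =
    deriv HH 0 * HH (2 * x) * (TT (u + v) * TT (u - v))" (is "?L = ?R")
proof -
  let ?P = "(TT 0)\<^sup>2 * (HH (x + u) * HH (x - u))"
  let ?P' = "(TT 0)\<^sup>2 * (deriv HH (x + u) * HH (x - u) + HH (x + u) * deriv HH (x - u))"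
  let ?Q = "(TT 0)\<^sup>2 * (TT (x + v) * TT (x - v))"
  let ?Q' = "(TT 0)\<^sup>2 * (deriv TT (x + v) * TT (x - v) + TT (x + v) * deriv TT (x - v))"
  have "(TT 0)\<^sup>2 * (TT 0)\<^sup>2 * ?L = ?P' * ?Q - ?P * ?Q'"
    by (simp only: algebra_simps)
  also have "\<dots> = (2 * HH x * TT x * (deriv HH x * TT x - HH x * deriv TT x)) *
      ((TT u)\<^sup>2 * (TT v)\<^sup>2 - (HH u)\<^sup>2 * (HH v)\<^sup>2)"
    unfolding HH_add_diff HH_add_diff_deriv1 TT_add_diff TT_add_diff_deriv1
    by (simp add: algebra_simps power2_eq_square)
  also have "\<dots> = (TT 0)\<^sup>2 * (HH (2 * x) * deriv HH 0) * ((TT 0)\<^sup>2 * (TT (u + v) * TT (u - v)))"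
    unfolding HH_double TT_add_diff ..
  also have "\<dots> = (TT 0)\<^sup>2 * (TT 0)\<^sup>2 * ?R"
    by (simp only: mult_ac)
  finally show ?thesis using TT_0_nonzero by (simp only: mult_left_cancel mult_eq_0_iff power_eq_0_iff simp_thms)
qed

text \<open>\<open>four_term\<close> with half sums and half differences chosen so that its four
  arguments are \<open>X + \<gamma> + \<alpha>\<close>, \<open>- 2\<alpha>\<close>,
  \<open>- (X - \<alpha>)\<close>, \<open>- \<gamma>\<close>. The left-hand side is the numerator in
  the derivative of \<open>HH (X + \<gamma> + \<alpha>) / TT (X + \<alpha>) * exp (- X * ZZ
  \<gamma>)\<close>; the bracket on the right becomes the profile divided by
  \<open>nu\<close>.\<close>

lemma lame_step:
  assumes "TT \<gamma> \<noteq> 0" "TT (X - \<alpha>) \<noteq> 0" "HH (2 * \<alpha>) \<noteq> 0"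
  shows "deriv HH (X + \<gamma> + \<alpha>) - HH (X + \<gamma> + \<alpha>) * (ZZ (X + \<alpha>) + ZZ \<gamma>) =
    (ZZ (X - \<alpha>) - ZZ (X + \<alpha>) + deriv HH (2 * \<alpha>) / HH (2 * \<alpha>)) * HH (X + \<gamma> + \<alpha>) -
    deriv HH 0 * TT (\<gamma> + 2 * \<alpha>) / (HH (2 * \<alpha>) * TT \<gamma>) * HH (X + \<gamma> - \<alpha>) * TT (X + \<alpha>) / TT (X - \<alpha>)"
proof -
  let ?x = "(X + \<gamma> - \<alpha>) / 2" and ?u = "(X + \<gamma> + 3 * \<alpha>) / 2" and ?v = "(X - \<alpha> - \<gamma>) / 2"
  have e: "?x + ?u = X + \<gamma> + \<alpha>" "?x - ?u = - (2 * \<alpha>)" "?x + ?v = X - \<alpha>" "?x - ?v = \<gamma>"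
    "?u + ?v = X + \<alpha>" "?u - ?v = \<gamma> + 2 * \<alpha>" "2 * ?x = X + \<gamma> - \<alpha>"
    by (simp_all add: field_simps)
  define a h h' t g r where abbrs: "a = HH (X + \<gamma> + \<alpha>)" "h = HH (2 * \<alpha>)" "h' = deriv HH (2 * \<alpha>)"
    "t = TT (X - \<alpha>)" "g = TT \<gamma>" "r = deriv HH 0 * HH (X + \<gamma> - \<alpha>) * (TT (X + \<alpha>) * TT (\<gamma> + 2 * \<alpha>))"
  define a' zt zg where abbrs': "a' = deriv HH (X + \<gamma> + \<alpha>)" "zt = ZZ (X - \<alpha>)" "zg = ZZ \<gamma>"
  have nz: "t \<noteq> 0" "g \<noteq> 0" "h \<noteq> 0" using assms by (simp_all add: abbrs)
  have "(- a' * h + a * h') * (t * g) + a * h * ((zt * t) * g + t * (zg * g)) = r"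
    using four_term[of ?x ?u ?v] unfolding e abbrs abbrs' 
    using deriv_TT_eq[OF assms(1)] deriv_TT_eq[OF assms(2)] by simp
  then have "a' * h * t * g = a * h' * t * g + a * h * t * g * (zt + zg) - r"
    by (simp add: algebra_simps)
  moreover define w \<rho> where "w = h' / h" and "\<rho> = r / (h * g * t)"
  then have w: "h' = w * h" "r = \<rho> * (h * g * t)" using nz by simp_all
  ultimately have "a' * (h * g * t) = ((zt + zg + w) * a - \<rho>) * (h * g * t)"
    by (simp add: algebra_simps)
  then have "a' = (zt + zg + h' / h) * a - r / (h * g * t)"
    using nz unfolding w_def \<rho>_def by (simp only: mult_right_cancel mult_eq_0_iff simp_thms)
  then show ?thesis
    unfolding abbrs abbrs' by (simp add: field_simps)
qed

section \<open>The addition formulas in terms of sn, cn, dn and Z\<close>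

lemma HH_sn: "TT x \<noteq> 0 \<Longrightarrow> HH x = of_real (sqrt k) * sn x * TT x"
  using k_pos by (simp add: jacobi_sn_def)

lemma deriv_HH_eq:
  assumes "TT x \<noteq> 0"
  shows "deriv HH x = of_real (sqrt k) * (cn x * dn x + sn x * ZZ x) * TT x"
proof -
  have "((\<lambda>x. HH x / (of_real (sqrt k) * TT x)) has_field_derivative
      (deriv HH x * TT x - HH x * deriv TT x) / (of_real (sqrt k) * (TT x)\<^sup>2)) (at x)"
    using assms k_pos by (auto intro!: derivative_eq_intros simp: power2_eq_square field_simps)
  then have "(deriv HH x * TT x - HH x * deriv TT x) / (of_real (sqrt k) * (TT x)\<^sup>2) = cn x * dn x"
    using DERIV_unique sn_DERIV[OF assms] by (fastforce simp: jacobi_sn_def[abs_def])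
  then have "deriv HH x * TT x - HH x * deriv TT x = of_real (sqrt k) * (TT x)\<^sup>2 * (cn x * dn x)"
    using assms k_pos by (simp add: field_simps)
  then have "deriv HH x * TT x = (of_real (sqrt k) * (cn x * dn x + sn x * ZZ x) * TT x) * TT x"
    unfolding deriv_TT_eq[OF assms] HH_sn[OF assms] by (simp add: algebra_simps power2_eq_square)
  then show ?thesis using assms by simp
qed

text \<open>Half the derivative of \<open>sn^2\<close>; the exponent \<mu> is a multiple of its
  value at \<gamma>.\<close>

definition scd :: "complex \<Rightarrow> complex" where "scd x = sn x * cn x * dn x"

lemma HH_deriv_HH:
  assumes "TT x \<noteq> 0"
  shows "HH x * deriv HH x = of_real k * (scd x + (sn x)\<^sup>2 * ZZ x) * (TT x)\<^sup>2"
proof -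
  have "of_real (sqrt k) * complex_of_real (sqrt k) = of_real k"
    using k_pos by (simp flip: of_real_mult)
  then show ?thesis
    unfolding HH_sn[OF assms] deriv_HH_eq[OF assms] scd_def by (simp add: power2_eq_square algebra_simps)
qed

lemma TT_add_diff_sn:
  assumes "TT x \<noteq> 0" "TT y \<noteq> 0"
  shows "(TT 0)\<^sup>2 * (TT (x + y) * TT (x - y)) = (TT x)\<^sup>2 * (TT y)\<^sup>2 * (1 - of_real (k\<^sup>2) * (sn x)\<^sup>2 * (sn y)\<^sup>2)"
  unfolding TT_add_diff sn_sq[OF assms(1)] sn_sq[OF assms(2)] by (simp add: algebra_simps power2_eq_square)

lemma HH_add_diff_sn:
  assumes "TT x \<noteq> 0" "TT y \<noteq> 0"
  shows "(TT 0)\<^sup>2 * (HH (x + y) * HH (x - y)) = of_real k * (TT x)\<^sup>2 * (TT y)\<^sup>2 * ((sn x)\<^sup>2 - (sn y)\<^sup>2)"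
  unfolding HH_add_diff sn_sq[OF assms(1)] sn_sq[OF assms(2)] by (simp add: algebra_simps)

text \<open>The derivative in \<open>y\<close> of the formula for
  \<open>TT (x + y) * TT (x - y)\<close>, divided by the formula itself. The denominator is nonzero
  because, up to nonzero factors, it is that product.\<close>

lemma ZZ_add_diff:
  assumes nz: "TT x \<noteq> 0" "TT y \<noteq> 0" "TT (x + y) \<noteq> 0" "TT (x - y) \<noteq> 0"
  shows "1 - of_real (k\<^sup>2) * (sn x)\<^sup>2 * (sn y)\<^sup>2 \<noteq> 0"
    "ZZ (x + y) - ZZ (x - y) = 2 * ZZ y - 2 * of_real (k\<^sup>2) * scd y * (sn x)\<^sup>2 / (1 - of_real (k\<^sup>2) * (sn x)\<^sup>2 * (sn y)\<^sup>2)"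
proof -
  let ?D = "1 - of_real (k\<^sup>2) * (sn x)\<^sup>2 * (sn y)\<^sup>2"
  show D: "?D \<noteq> 0"
    using TT_add_diff_sn[OF nz(1,2)] nz TT_0_nonzero by auto
  have "((TT 0)\<^sup>2 * (TT (x + y) * TT (x - y))) * (ZZ (x + y) - ZZ (x - y)) =
      (TT 0)\<^sup>2 * (deriv TT (x + y) * TT (x - y) - TT (x + y) * deriv TT (x - y))"
    unfolding deriv_TT_eq[OF nz(3)] deriv_TT_eq[OF nz(4)] by (simp add: algebra_simps)
  also have "\<dots> = 2 * TT y * (ZZ y * TT y) * (TT x)\<^sup>2 - 2 * (HH y * deriv HH y) * (HH x)\<^sup>2"
    unfolding TT_add_diff_deriv2 deriv_TT_eq[OF nz(2)] by (simp add: mult_ac)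
  also have "\<dots> = (TT x)\<^sup>2 * (TT y)\<^sup>2 * (2 * ZZ y * ?D - 2 * of_real (k\<^sup>2) * scd y * (sn x)\<^sup>2)"
    unfolding HH_deriv_HH[OF nz(2)] sn_sq[OF nz(1)] by (simp add: algebra_simps power2_eq_square)
  finally have "(TT x)\<^sup>2 * (TT y)\<^sup>2 * (?D * (ZZ (x + y) - ZZ (x - y))) =
      (TT x)\<^sup>2 * (TT y)\<^sup>2 * (2 * ZZ y * ?D - 2 * of_real (k\<^sup>2) * scd y * (sn x)\<^sup>2)"
    unfolding TT_add_diff_sn[OF nz(1,2)] by (simp only: mult_ac)
  then have "?D * (ZZ (x + y) - ZZ (x - y)) = 2 * ZZ y * ?D - 2 * of_real (k\<^sup>2) * scd y * (sn x)\<^sup>2"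
    using nz by (simp only: mult_left_cancel mult_eq_0_iff power_eq_0_iff simp_thms)
  then have "ZZ (x + y) - ZZ (x - y) = (2 * ZZ y * ?D - 2 * of_real (k\<^sup>2) * scd y * (sn x)\<^sup>2) / ?D"
    using D by (simp only: nonzero_eq_divide_eq mult.commute[of ?D] simp_thms)
  then show "ZZ (x + y) - ZZ (x - y) = 2 * ZZ y - 2 * of_real (k\<^sup>2) * scd y * (sn x)\<^sup>2 / ?D"
    using D by (simp only: diff_divide_distrib nonzero_mult_div_cancel_right simp_thms)
qed

text \<open>Adding the derivatives of \<open>HH_add_diff\<close> in its two variables removes
  \<open>deriv HH (x - y)\<close>. The factor \<open>HH (x - y)\<close> is kept, so that zeros of
  \<open>HH\<close> need no separate treatment.\<close>

lemma HH_add: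
  assumes nz: "TT x \<noteq> 0" "TT y \<noteq> 0"
  shows "(TT 0)\<^sup>2 * (HH (x - y) * (deriv HH (x + y) - HH (x + y) * (ZZ x + ZZ y))) =
    of_real k * (TT x)\<^sup>2 * (TT y)\<^sup>2 * (scd x - scd y)"
proof -
  have "2 * ((TT 0)\<^sup>2 * (HH (x - y) * deriv HH (x + y))) =
      (TT 0)\<^sup>2 * (deriv HH (x + y) * HH (x - y) + HH (x + y) * deriv HH (x - y)) +
      (TT 0)\<^sup>2 * (deriv HH (x + y) * HH (x - y) - HH (x + y) * deriv HH (x - y))"
    by (simp add: algebra_simps)
  also have "\<dots> = 2 * (HH x * deriv HH x) * (TT y)\<^sup>2 - 2 * TT x * (ZZ x * TT x) * (HH y)\<^sup>2 +
      (2 * TT y * (ZZ y * TT y) * (HH x)\<^sup>2 - 2 * (HH y * deriv HH y) * (TT x)\<^sup>2)"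
    unfolding HH_add_diff_deriv1 HH_add_diff_deriv2 deriv_TT_eq[OF nz(1)] deriv_TT_eq[OF nz(2)]
    by (simp add: mult_ac)
  also have "\<dots> = 2 * (of_real k * (TT x)\<^sup>2 * (TT y)\<^sup>2 * (scd x - scd y)) +
      2 * ((ZZ x + ZZ y) * (of_real k * (TT x)\<^sup>2 * (TT y)\<^sup>2 * ((sn x)\<^sup>2 - (sn y)\<^sup>2)))"
    unfolding HH_deriv_HH[OF nz(1)] HH_deriv_HH[OF nz(2)] sn_sq[OF nz(1)] sn_sq[OF nz(2)]
    by (simp add: algebra_simps power2_eq_square)
  finally have "2 * ((TT 0)\<^sup>2 * (HH (x - y) * (deriv HH (x + y) - HH (x + y) * (ZZ x + ZZ y)))) =
      2 * (of_real k * (TT x)\<^sup>2 * (TT y)\<^sup>2 * (scd x - scd y))"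
    unfolding HH_add_diff_sn[OF nz, symmetric] by (simp add: algebra_simps)
  then show ?thesis by (subst (asm) mult_left_cancel) simp_all
qed

lemma HH_double_scd:
  assumes "TT x \<noteq> 0"
  shows "(TT 0)\<^sup>2 * (HH (2 * x) * deriv HH 0) = 2 * of_real k * scd x * (TT x) ^ 4"
proof -
  have "2 * HH x * TT x * (deriv HH x * TT x - HH x * deriv TT x) =
      2 * (HH x * deriv HH x) * (TT x)\<^sup>2 - 2 * (HH x)\<^sup>2 * TT x * (ZZ x * TT x)"
    unfolding deriv_TT_eq[OF assms] by (simp add: algebra_simps power2_eq_square)
  then show ?thesis
    unfolding HH_double HH_deriv_HH[OF assms] sn_sq[OF assms] by (simp add: algebra_simps power2_eq_square power4_eq_xxxx)
qed

text \<open>Logarithmic differentiation of \<open>HH_double_scd\<close>; the numerator of the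
  fraction is the derivative of \<open>scd\<close>.\<close>

lemma HH_double_log_deriv:
  assumes nz: "TT x \<noteq> 0" and s: "scd x \<noteq> 0"
  shows "HH (2 * x) \<noteq> 0"
    and "deriv HH (2 * x) / HH (2 * x) = 2 * ZZ x + ((cn x)\<^sup>2 * (dn x)\<^sup>2 - (sn x)\<^sup>2 * (dn x)\<^sup>2 -
      of_real (k\<^sup>2) * (sn x)\<^sup>2 * (cn x)\<^sup>2) / (2 * scd x)"
proof -
  have k: "complex_of_real k \<noteq> 0" using k_pos by simp
  show HH: "HH (2 * x) \<noteq> 0"
    using HH_double_scd[OF nz] nz s k by auto
  let ?s' = "(cn x)\<^sup>2 * (dn x)\<^sup>2 - (sn x)\<^sup>2 * (dn x)\<^sup>2 - of_real (k\<^sup>2) * (sn x)\<^sup>2 * (cn x)\<^sup>2"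
  have op: "open {y. TT y \<noteq> 0}"
    using open_Collect_neq[of TT "\<lambda>_. 0"] holomorphic_on_imp_continuous_on[OF holomorphic_TT] by simp
  have 0: "((\<lambda>y. (TT 0)\<^sup>2 * (HH (2 * y) * deriv HH 0)) has_field_derivative
      (TT 0)\<^sup>2 * deriv HH 0 * (2 * deriv HH (2 * x))) (at x)"
    by (auto intro!: derivative_eq_intros simp: algebra_simps)
  \<comment> \<open>The formula for \<open>HH (2 * y)\<close> is available only where
    \<open>TT y\<close> is nonzero, an open set, so its derivative is taken locally.\<close>
  have 1: "((\<lambda>y. 2 * of_real k * scd y * (TT y) ^ 4) has_field_derivative
      (TT 0)\<^sup>2 * deriv HH 0 * (2 * deriv HH (2 * x))) (at x)"
    by (rule has_field_derivative_transform_within_open[OF 0 op]) (use nz HH_double_scd in auto)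
  have "(scd has_field_derivative ?s') (at x)"
    unfolding scd_def[abs_def]
    by (rule derivative_eq_intros sn_DERIV[OF nz] cn_DERIV[OF nz] dn_DERIV[OF nz] refl)+
       (simp add: algebra_simps power2_eq_square)
  then have "((\<lambda>y. 2 * of_real k * scd y * (TT y) ^ 4) has_field_derivative
      2 * of_real k * (?s' * (TT x) ^ 4 + scd x * (4 * (TT x) ^ 3 * deriv TT x))) (at x)"
    by (auto intro!: derivative_eq_intros simp: algebra_simps)
  from DERIV_unique[OF 1 this]
  have "(TT 0)\<^sup>2 * deriv HH 0 * (2 * deriv HH (2 * x)) = 2 * of_real k * (TT x) ^ 4 * (?s' + 4 * scd x * ZZ x)"
    unfolding deriv_TT_eq[OF nz] by (simp add: algebra_simps power3_eq_cube power4_eq_xxxx)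
  moreover have M: "(TT 0)\<^sup>2 * deriv HH 0 * HH (2 * x) = 2 * of_real k * (TT x) ^ 4 * scd x"
    using HH_double_scd[OF nz] by (simp add: mult_ac)
  ultimately have "(TT 0)\<^sup>2 * deriv HH 0 * (2 * deriv HH (2 * x)) * scd x =
      (TT 0)\<^sup>2 * deriv HH 0 * HH (2 * x) * (?s' + 4 * scd x * ZZ x)"
    by (simp add: mult_ac)
  moreover have "(TT 0)\<^sup>2 * deriv HH 0 \<noteq> 0"
    using M nz s k by auto
  ultimately have "2 * deriv HH (2 * x) * scd x = HH (2 * x) * (?s' + 4 * scd x * ZZ x)"
    by (simp add: mult.assoc)
  then show "deriv HH (2 * x) / HH (2 * x) = 2 * ZZ x + ?s' / (2 * scd x)"
    using HH s by (simp add: field_simps)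
qed

text \<open>The factor \<open>TT (2 * x)\<close> on both sides lets the formula cover the poles,
  where \<open>sn\<close> is 0 by the convention for division.\<close>

lemma sn_double:
  assumes nz: "TT x \<noteq> 0"
  shows "TT (2 * x) * sn (2 * x) * (1 - of_real (k\<^sup>2) * (sn x) ^ 4) = 2 * scd x * TT (2 * x)"
proof (cases "TT (2 * x) = 0")
  case False
  have "(TT 0)\<^sup>2 * (HH (2 * x) * deriv HH 0) = of_real k * (TT 0) ^ 3 * sn (2 * x) * TT (2 * x)"
  proof -
    have "of_real (sqrt k) * complex_of_real (sqrt k) = of_real k"
      using k_pos by (simp flip: of_real_mult)
    then show ?thesis
      unfolding deriv_HH_0 HH_sn[OF False] by (simp add: power2_eq_square power3_eq_cube)
  qed
  moreover have t: "(TT 0) ^ 3 * TT (2 * x) = (TT x) ^ 4 * (1 - of_real (k\<^sup>2) * (sn x) ^ 4)"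
    using TT_add_diff_sn[OF nz nz] by (simp add: power2_eq_square power3_eq_cube power4_eq_xxxx mult_ac)
  ultimately have "of_real k * sn (2 * x) * ((TT x) ^ 4 * (1 - of_real (k\<^sup>2) * (sn x) ^ 4)) = 2 * of_real k * scd x * (TT x) ^ 4"
    using HH_double_scd[OF nz] unfolding t[symmetric] by (simp add: mult_ac)
  then have "(of_real k * (TT x) ^ 4) * (sn (2 * x) * (1 - of_real (k\<^sup>2) * (sn x) ^ 4)) = (of_real k * (TT x) ^ 4) * (2 * scd x)"
    by (simp only: mult_ac)
  moreover have c: "of_real k * (TT x) ^ 4 \<noteq> 0" using nz k_pos by simp
  ultimately have "sn (2 * x) * (1 - of_real (k\<^sup>2) * (sn x) ^ 4) = 2 * scd x"
    using mult_left_cancel[OF c] by blast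
  then show ?thesis by (simp add: mult.assoc mult.commute)
qed simp

end

section \<open>Travelling wave solutions of the Lax system\<close>

lemma has_vector_derivative_vector2:
  fixes f g :: "real \<Rightarrow> complex"
  assumes f: "(f has_vector_derivative f') (at x)" and g: "(g has_vector_derivative g') (at x)"
  shows "((\<lambda>x. vector [f x, g x] :: complex^2) has_vector_derivative vector [f', g']) (at x)"
proof -
  let ?e = "\<lambda>z::complex. vector [z, 0] :: complex^2" and ?h = "\<lambda>z::complex. vector [0, z] :: complex^2"
  have "linear ?e" "linear ?h"
    by (auto intro!: linearI simp: vec_eq_iff forall_2)
  then have bl: "bounded_linear ?e" "bounded_linear ?h"
    by (simp_all add: linear_conv_bounded_linear)
  have "((\<lambda>x. ?e (f x) + ?h (g x)) has_vector_derivative ?e f' + ?h g') (at x)"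
    using bounded_linear.has_vector_derivative[OF bl(1) f] bounded_linear.has_vector_derivative[OF bl(2) g]
    by (rule has_vector_derivative_add)
  moreover have "?e a + ?h b = vector [a, b]" for a b
    by (simp add: vec_eq_iff forall_2)
  ultimately show ?thesis by simp
qed

text \<open>Gronwall's argument for the squared norm \<open>N\<close>: since \<zeta> is real, the
  coupling terms cancel in its derivative, and what remains is at most
  \<open>2 * M * N\<close>.\<close>

lemma linear_system_zero_right:
  fixes e f :: "real \<Rightarrow> complex" and w :: "real \<Rightarrow> real" and \<zeta> M :: real
  assumes d1: "\<And>x. (e has_vector_derivative of_real (w x) * e x + \<i> * of_real \<zeta> * f x) (at x)"
    and d2: "\<And>x. (f has_vector_derivative \<i> * of_real \<zeta> * e x - of_real (w x) * f x) (at x)"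
    and zero: "e 0 = 0" "f 0 = 0" and M: "\<And>x. \<bar>w x\<bar> \<le> M" and "0 \<le> x"
  shows "e x = 0 \<and> f x = 0"
proof -
  define N where "N x = (Re (e x))\<^sup>2 + (Im (e x))\<^sup>2 + ((Re (f x))\<^sup>2 + (Im (f x))\<^sup>2)" for x
  have r: "((\<lambda>x. Re (e x)) has_real_derivative w x * Re (e x) - \<zeta> * Im (f x)) (at x)"
    "((\<lambda>x. Im (e x)) has_real_derivative w x * Im (e x) + \<zeta> * Re (f x)) (at x)"
    "((\<lambda>x. Re (f x)) has_real_derivative - \<zeta> * Im (e x) - w x * Re (f x)) (at x)"
    "((\<lambda>x. Im (f x)) has_real_derivative \<zeta> * Re (e x) - w x * Im (f x)) (at x)" for x
    using bounded_linear.has_vector_derivative[OF bounded_linear_Re d1[of x]]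
      bounded_linear.has_vector_derivative[OF bounded_linear_Im d1[of x]]
      bounded_linear.has_vector_derivative[OF bounded_linear_Re d2[of x]]
      bounded_linear.has_vector_derivative[OF bounded_linear_Im d2[of x]]
    by (simp_all add: has_real_derivative_iff_has_vector_derivative)
  have N': "(N has_real_derivative 2 * w x * ((Re (e x))\<^sup>2 + (Im (e x))\<^sup>2 - ((Re (f x))\<^sup>2 + (Im (f x))\<^sup>2))) (at x)" for x
    unfolding N_def[abs_def]
    by (rule derivative_eq_intros r refl)+ (simp add: algebra_simps power2_eq_square)
  have "exp (- 2 * M * x) * N x \<le> exp (- 2 * M * 0) * N 0"
  proof (rule DERIV_nonpos_imp_nonincreasing[OF \<open>0 \<le> x\<close>])
    fix y
    let ?A = "(Re (e y))\<^sup>2 + (Im (e y))\<^sup>2" and ?B = "(Re (f y))\<^sup>2 + (Im (f y))\<^sup>2"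
    have "((\<lambda>x. exp (- 2 * M * x) * N x) has_real_derivative
        exp (- 2 * M * y) * (2 * w y * (?A - ?B)) - 2 * M * exp (- 2 * M * y) * N y) (at y)"
      by (rule derivative_eq_intros N' refl)+ (simp add: algebra_simps)
    moreover have "exp (- 2 * M * y) * (2 * w y * (?A - ?B)) - 2 * M * exp (- 2 * M * y) * N y \<le> 0"
    proof -
      have "w y * ?A \<le> M * ?A" "- w y * ?B \<le> M * ?B"
        using M[of y] mult_right_mono[of "w y" M ?A] mult_right_mono[of "- w y" M ?B] by (simp_all add: abs_le_iff)
      then have "2 * w y * (?A - ?B) - 2 * M * N y \<le> 0"
        by (simp add: N_def algebra_simps)
      then have "exp (- 2 * M * y) * (2 * w y * (?A - ?B) - 2 * M * N y) \<le> 0"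
        by (intro mult_nonneg_nonpos) auto
      then show ?thesis by (simp add: algebra_simps)
    qed
    ultimately show "\<exists>z. ((\<lambda>x. exp (- 2 * M * x) * N x) has_real_derivative z) (at y) \<and> z \<le> 0" by blast
  qed
  then have "N x \<le> 0" by (simp add: N_def zero mult_le_0_iff)
  then have "Re (e x) = 0 \<and> Im (e x) = 0 \<and> Re (f x) = 0 \<and> Im (f x) = 0"
    unfolding N_def by (smt (verit) zero_le_power2 zero_less_power2)
  then show ?thesis by (simp add: complex_eq_iff)
qed

text \<open>Reflection of the line changes the signs of \<open>w\<close> and \<zeta> and leaves the
  form of the system unchanged.\<close>

lemma linear_system_zero:
  fixes e f :: "real \<Rightarrow> complex" and w :: "real \<Rightarrow> real" and \<zeta> M :: real
  assumes d1: "\<And>x. (e has_vector_derivative of_real (w x) * e x + \<i> * of_real \<zeta> * f x) (at x)"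
    and d2: "\<And>x. (f has_vector_derivative \<i> * of_real \<zeta> * e x - of_real (w x) * f x) (at x)"
    and zero: "e 0 = 0" "f 0 = 0" and M: "\<And>x. \<bar>w x\<bar> \<le> M"
  shows "e x = 0 \<and> f x = 0"
proof (cases "0 \<le> x")
  case True
  then show ?thesis using linear_system_zero_right[OF assms] by simp
next
  case False
  have neg: "((\<lambda>x. g (- x)) has_vector_derivative - D) (at x)"
    if "(g has_vector_derivative D) (at (- x))" for g :: "real \<Rightarrow> complex" and D x
    using vector_diff_chain_at[of uminus "-1" x g D] that has_vector_derivative_minus[OF has_vector_derivative_id]
    by (simp add: o_def)
  have "e (- (- x)) = 0 \<and> f (- (- x)) = 0"
  proof (rule linear_system_zero_right[where e = "\<lambda>x. e (- x)" and f = "\<lambda>x. f (- x)" and x = "- x"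
        and w = "\<lambda>x. - w (- x)" and \<zeta> = "- \<zeta>" and M = M])
    show "((\<lambda>x. e (- x)) has_vector_derivative of_real (- w (- x)) * e (- x) + \<i> * of_real (- \<zeta>) * f (- x)) (at x)" for x
      using neg[OF d1[of "- x"]] by simp
    show "((\<lambda>x. f (- x)) has_vector_derivative \<i> * of_real (- \<zeta>) * e (- x) - of_real (- w (- x)) * f (- x)) (at x)" for x
      using neg[OF d2[of "- x"]] by (simp add: algebra_simps)
  qed (use zero M False in auto)
  then show ?thesis by simp
qed

text \<open>
  In the variables \<open>F = p + q\<close>, \<open>G = p - q\<close> the time equation of the travelling wave reads
  \<open>E1 = E2 = 0\<close>, and \<open>(E1, E2)\<close> solves the same linear system in \<open>x\<close> as \<open>(F, G)\<close> does. So the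
  time equation needs to be checked only at \<open>x = 0\<close>.
\<close>

lemma lax_travelling_wave:
  fixes \<phi> \<phi>1 \<phi>2 :: "real \<Rightarrow> real" and F G :: "real \<Rightarrow> complex" and \<zeta> c d M :: real and \<mu> :: complex
    and u :: "real \<Rightarrow> real \<Rightarrow> real"
  assumes p1: "\<And>x. (\<phi> has_real_derivative \<phi>1 x) (at x)" and p2: "\<And>x. (\<phi>1 has_real_derivative \<phi>2 x) (at x)"
    and ode: "\<And>x. \<phi>2 x = d - c * \<phi> x + 2 * \<phi> x ^ 3" and M: "\<And>x. \<bar>\<phi> x\<bar> \<le> M"
    and F: "\<And>x. (F has_vector_derivative of_real (\<phi> x) * F x + \<i> * of_real \<zeta> * G x) (at x)"
    and G: "\<And>x. (G has_vector_derivative \<i> * of_real \<zeta> * F x - of_real (\<phi> x) * G x) (at x)"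
    and z1: "(\<mu> + of_real (d - 4 * \<zeta>\<^sup>2 * \<phi> 0)) * F 0 +
      \<i> * of_real \<zeta> * of_real (c - 4 * \<zeta>\<^sup>2 - 2 * (\<phi> 0)\<^sup>2 - 2 * \<phi>1 0) * G 0 = 0"
    and z2: "(\<mu> - of_real (d - 4 * \<zeta>\<^sup>2 * \<phi> 0)) * G 0 +
      \<i> * of_real \<zeta> * of_real (c - 4 * \<zeta>\<^sup>2 - 2 * (\<phi> 0)\<^sup>2 + 2 * \<phi>1 0) * F 0 = 0"
    and u: "\<And>x t. u x t = \<phi> (x + c * t)"
  shows "lax_solution (of_real \<zeta>) u (\<lambda>x t. exp (\<mu> * of_real t) *s
    vector [(F (x + c * t) + G (x + c * t)) / 2, (F (x + c * t) - G (x + c * t)) / 2])"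
proof -
  let ?z = "complex_of_real \<zeta>"
  \<comment> \<open>After \<open>2 \<phi>^3 - \<phi>2\<close> is replaced by
    \<open>c \<phi> - d\<close>, the operator \<open>\<mu> + c U - V\<close> in the variables
    \<open>F\<close>, \<open>G\<close> has diagonal entries \<open>\<mu> + a\<close>,
    \<open>\<mu> - a\<close> and off-diagonal entries \<open>\<i> \<zeta> b\<close>,
    \<open>\<i> \<zeta> b'\<close>.\<close>
  define a where "a x = d - 4 * \<zeta>\<^sup>2 * \<phi> x" for x
  define b where "b x = c - 4 * \<zeta>\<^sup>2 - 2 * (\<phi> x)\<^sup>2 - 2 * \<phi>1 x" for x
  define b' where "b' x = c - 4 * \<zeta>\<^sup>2 - 2 * (\<phi> x)\<^sup>2 + 2 * \<phi>1 x" for x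
  define E1 where "E1 x = (\<mu> + of_real (a x)) * F x + \<i> * ?z * of_real (b x) * G x" for x
  define E2 where "E2 x = (\<mu> - of_real (a x)) * G x + \<i> * ?z * of_real (b' x) * F x" for x
  have real: "((\<lambda>x. complex_of_real (f x)) has_vector_derivative of_real f') (at x)"
    if "(f has_real_derivative f') (at x)" for f f' x
    using bounded_linear.has_vector_derivative[OF bounded_linear_of_real] that
    by (simp add: has_real_derivative_iff_has_vector_derivative)
  have a: "((\<lambda>x. complex_of_real (a x)) has_vector_derivative of_real (- 4 * \<zeta>\<^sup>2 * \<phi>1 x)) (at x)" for x
    unfolding a_def by (rule real) (auto intro!: derivative_eq_intros p1)
  have b: "((\<lambda>x. complex_of_real (b x)) has_vector_derivative of_real (- 4 * \<phi> x * \<phi>1 x - 2 * \<phi>2 x)) (at x)" for x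
    unfolding b_def by (rule real) (auto intro!: derivative_eq_intros p1 p2)
  have b': "((\<lambda>x. complex_of_real (b' x)) has_vector_derivative of_real (- 4 * \<phi> x * \<phi>1 x + 2 * \<phi>2 x)) (at x)" for x
    unfolding b'_def by (rule real) (auto intro!: derivative_eq_intros p1 p2)
  \<comment> \<open>That the defect obeys the spatial system is the zero curvature condition of the
    Lax pair along the wave; the second order equation \<open>ode\<close> enters here through
    \<phi>2.\<close>
  have "E1 x = 0 \<and> E2 x = 0" for x
  proof (rule linear_system_zero[where w = \<phi> and \<zeta> = \<zeta> and M = M])
    fix x
    let ?u = "complex_of_real (\<phi> x)" and ?u1 = "complex_of_real (\<phi>1 x)"
    have o: "complex_of_real (\<phi>2 x) = of_real d - of_real c * ?u + 2 * ?u ^ 3" by (simp add: ode)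
    show "(E1 has_vector_derivative ?u * E1 x + \<i> * ?z * E2 x) (at x)"
      unfolding E1_def[abs_def] E2_def
      by (rule derivative_eq_intros F G a b refl)+
        (simp add: o a_def b_def b'_def algebra_simps power2_eq_square power3_eq_cube)
    show "(E2 has_vector_derivative \<i> * ?z * E1 x - ?u * E2 x) (at x)"
      unfolding E2_def[abs_def] E1_def
      by (rule derivative_eq_intros F G a b' refl)+
        (simp add: o a_def b_def b'_def algebra_simps power2_eq_square power3_eq_cube)
  qed (use z1 z2 M in \<open>simp_all add: E1_def E2_def a_def b_def b'_def\<close>)
  then have E: "E1 x = 0" "E2 x = 0" for x by auto
  define p where "p x = (F x + G x) / 2" for x
  define q where "q x = (F x - G x) / 2" for x
  have p: "(p has_vector_derivative \<i> * ?z * p x + of_real (\<phi> x) * q x) (at x)" for x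
  proof -
    have "((\<lambda>x. (F x + G x) * (1 / 2)) has_vector_derivative \<i> * ?z * p x + of_real (\<phi> x) * q x) (at x)"
      by (rule derivative_eq_intros F G refl)+ (simp add: p_def q_def field_simps)
    then show ?thesis by (simp add: p_def[abs_def])
  qed
  have q: "(q has_vector_derivative of_real (\<phi> x) * p x - \<i> * ?z * q x) (at x)" for x
  proof -
    have "((\<lambda>x. (F x - G x) * (1 / 2)) has_vector_derivative of_real (\<phi> x) * p x - \<i> * ?z * q x) (at x)"
      by (rule derivative_eq_intros F G refl)+ (simp add: p_def q_def field_simps)
    then show ?thesis by (simp add: q_def[abs_def])
  qed
  have shift: "((\<lambda>x. f (x + r)) has_vector_derivative D) (at x)"
    if "(f has_vector_derivative D) (at (x + r))" for f :: "real \<Rightarrow> complex" and D x r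
  proof -
    have "((\<lambda>x. x + r) has_vector_derivative 1) (at x)"
      by (auto intro!: derivative_eq_intros simp flip: has_real_derivative_iff_has_vector_derivative)
    from vector_diff_chain_at[OF this that] show ?thesis by (simp add: o_def)
  qed
  have scale: "((\<lambda>t. f (x + c * t)) has_vector_derivative of_real c * D) (at t)"
    if "(f has_vector_derivative D) (at (x + c * t))" for f :: "real \<Rightarrow> complex" and D x t
  proof -
    have "((\<lambda>t. x + c * t) has_vector_derivative c) (at t)"
      by (auto intro!: derivative_eq_intros simp flip: has_real_derivative_iff_has_vector_derivative)
    from vector_diff_chain_at[OF this that] show ?thesis
      by (simp add: o_def scaleR_conv_of_real)
  qed
  have ex: "((\<lambda>t. exp (\<mu> * of_real t)) has_vector_derivative \<mu> * exp (\<mu> * of_real t)) (at t)" for t :: real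
    by (rule has_vector_derivative_real_field) (auto intro!: derivative_eq_intros)
  have du: "((\<lambda>y. u y t) has_real_derivative \<phi>1 (x + c * t)) (at x)" for x t
    unfolding u using DERIV_shift[of \<phi> _ x "c * t"] p1[of "x + c * t"] by blast
  then have du1: "deriv (\<lambda>y. u y t) = (\<lambda>x. \<phi>1 (x + c * t))" for t
    by (auto intro: DERIV_imp_deriv)
  have du2: "deriv (deriv (\<lambda>y. u y t)) x = \<phi>2 (x + c * t)" for x t
    unfolding du1 using DERIV_shift[of \<phi>1 _ x "c * t"] p2[of "x + c * t"] by (auto intro!: DERIV_imp_deriv)
  have eq: "exp (\<mu> * of_real t) *s vector [p y, q y] =
      (vector [exp (\<mu> * of_real t) * p y, exp (\<mu> * of_real t) * q y] :: complex^2)" for t y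
    by (simp add: vec_eq_iff forall_2)
  have "lax_solution ?z u (\<lambda>x t. exp (\<mu> * of_real t) *s vector [p (x + c * t), q (x + c * t)])"
    unfolding lax_solution_def eq
  proof (intro allI conjI)
    fix x t
    let ?e = "exp (\<mu> * of_real t)" and ?y = "x + c * t"
    let ?u = "complex_of_real (\<phi> ?y)" and ?u1 = "complex_of_real (\<phi>1 ?y)"
    have "((\<lambda>x. vector [?e * p (x + c * t), ?e * q (x + c * t)] :: complex^2) has_vector_derivative
        vector [?e * (\<i> * ?z * p ?y + ?u * q ?y), ?e * (?u * p ?y - \<i> * ?z * q ?y)]) (at x)"
      by (intro has_vector_derivative_vector2 has_vector_derivative_mult_right shift p q)
    moreover have "vector [?e * (\<i> * ?z * p ?y + ?u * q ?y), ?e * (?u * p ?y - \<i> * ?z * q ?y)] =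
        lax_U ?z (u x t) *v vector [?e * p ?y, ?e * q ?y]"
      by (simp add: vec_eq_iff forall_2 lax_U_def matrix_vector_mult_def sum_2 u algebra_simps)
    ultimately show "((\<lambda>x. vector [?e * p (x + c * t), ?e * q (x + c * t)] :: complex^2) has_vector_derivative
        lax_U ?z (u x t) *v vector [?e * p ?y, ?e * q ?y]) (at x)" by simp
    have "((\<lambda>t. vector [exp (\<mu> * of_real t) * p (x + c * t), exp (\<mu> * of_real t) * q (x + c * t)] :: complex^2)
        has_vector_derivative
        vector [?e * (of_real c * (\<i> * ?z * p ?y + ?u * q ?y)) + \<mu> * ?e * p ?y,
          ?e * (of_real c * (?u * p ?y - \<i> * ?z * q ?y)) + \<mu> * ?e * q ?y]) (at t)"
      by (intro has_vector_derivative_vector2 has_vector_derivative_mult ex scale p q)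
    moreover have "vector [?e * (of_real c * (\<i> * ?z * p ?y + ?u * q ?y)) + \<mu> * ?e * p ?y,
          ?e * (of_real c * (?u * p ?y - \<i> * ?z * q ?y)) + \<mu> * ?e * q ?y] =
        lax_V ?z (u x t) (deriv (\<lambda>y. u y t) x) (deriv (deriv (\<lambda>y. u y t)) x) *v vector [?e * p ?y, ?e * q ?y]"
    proof -
      have o: "complex_of_real (2 * u x t ^ 3 - \<phi>2 ?y) = of_real c * ?u - of_real d" by (simp add: ode u)
      have FG: "F ?y = p ?y + q ?y" "G ?y = p ?y - q ?y" by (simp_all add: p_def q_def field_simps)
      have half: "a = b" if "2 * (a - b) = 0" for a b :: complex using that by simp
      have r1: "\<mu> * p ?y + of_real c * (\<i> * ?z * p ?y + ?u * q ?y) =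
          (4 * \<i> * ?z ^ 3 + 2 * \<i> * ?z * ?u\<^sup>2) * p ?y + (4 * ?z\<^sup>2 * ?u - 2 * \<i> * ?z * ?u1 + (of_real c * ?u - of_real d)) * q ?y"
      proof -
        have "2 * (\<mu> * p ?y + of_real c * (\<i> * ?z * p ?y + ?u * q ?y) -
          ((4 * \<i> * ?z ^ 3 + 2 * \<i> * ?z * ?u\<^sup>2) * p ?y + (4 * ?z\<^sup>2 * ?u - 2 * \<i> * ?z * ?u1 + (of_real c * ?u - of_real d)) * q ?y)) =
          E1 ?y + E2 ?y"
          unfolding E1_def E2_def FG a_def b_def b'_def by (simp add: algebra_simps power2_eq_square power3_eq_cube)
        then show ?thesis unfolding E add_0_right by (rule half)
      qed
      have r2: "\<mu> * q ?y + of_real c * (?u * p ?y - \<i> * ?z * q ?y) =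
          (4 * ?z\<^sup>2 * ?u + 2 * \<i> * ?z * ?u1 + (of_real c * ?u - of_real d)) * p ?y + (- 4 * \<i> * ?z ^ 3 - 2 * \<i> * ?z * ?u\<^sup>2) * q ?y"
      proof -
        have "2 * (\<mu> * q ?y + of_real c * (?u * p ?y - \<i> * ?z * q ?y) -
          ((4 * ?z\<^sup>2 * ?u + 2 * \<i> * ?z * ?u1 + (of_real c * ?u - of_real d)) * p ?y + (- 4 * \<i> * ?z ^ 3 - 2 * \<i> * ?z * ?u\<^sup>2) * q ?y)) =
          E1 ?y - E2 ?y"
          unfolding E1_def E2_def FG a_def b_def b'_def by (simp add: algebra_simps power2_eq_square power3_eq_cube)
        then show ?thesis unfolding E diff_self by (rule half)
      qed
      have V: "lax_V ?z (u x t) (\<phi>1 ?y) (\<phi>2 ?y) = vector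
          [vector [4 * \<i> * ?z ^ 3 + 2 * \<i> * ?z * ?u\<^sup>2, 4 * ?z\<^sup>2 * ?u - 2 * \<i> * ?z * ?u1 + (of_real c * ?u - of_real d)],
           vector [4 * ?z\<^sup>2 * ?u + 2 * \<i> * ?z * ?u1 + (of_real c * ?u - of_real d), - 4 * \<i> * ?z ^ 3 - 2 * \<i> * ?z * ?u\<^sup>2]]"
        unfolding lax_V_def o by (simp add: u)
      show ?thesis
        unfolding du2 unfolding du1 V
        using arg_cong[OF r1, of "\<lambda>w. ?e * w"] arg_cong[OF r2, of "\<lambda>w. ?e * w"]
        by (simp add: vec_eq_iff forall_2 matrix_vector_mult_def sum_2 algebra_simps)
    qed
    ultimately show "((\<lambda>t. vector [exp (\<mu> * of_real t) * p (x + c * t), exp (\<mu> * of_real t) * q (x + c * t)] :: complex^2)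
        has_vector_derivative
        lax_V ?z (u x t) (deriv (\<lambda>y. u y t) x) (deriv (deriv (\<lambda>y. u y t)) x) *v vector [?e * p ?y, ?e * q ?y]) (at t)"
      by simp
  qed
  then show ?thesis by (simp add: p_def q_def)
qed

text \<open>In the frame moving with the wave, a vanishing combination becomes a combination of
  \<open>exp (\<mu> t)\<close> and \<open>exp (- \<mu> t)\<close> with coefficients free of
  \<open>t\<close>. Two suitable times separate them, and then one nonzero value of each
  \<open>p + q\<close> suffices.\<close>

lemma lin_indep2_travelling_waves:
  fixes p1 q1 p2 q2 :: "real \<Rightarrow> complex" and \<mu> :: complex and c :: real
  assumes "\<mu> \<noteq> 0" and nz: "p1 x1 + q1 x1 \<noteq> 0" "p2 x2 + q2 x2 \<noteq> 0"
  shows "lin_indep2 (\<lambda>x t. exp (\<mu> * of_real t) *s vector [p1 (x + c * t), q1 (x + c * t)])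
    (\<lambda>x t. exp (- \<mu> * of_real t) *s vector [p2 (x + c * t), q2 (x + c * t)])"
  unfolding lin_indep2_def
proof (intro allI impI)
  fix a b :: complex
  assume zero: "\<forall>x t. a *s (exp (\<mu> * of_real t) *s vector [p1 (x + c * t), q1 (x + c * t)]) +
    b *s (exp (- \<mu> * of_real t) *s vector [p2 (x + c * t), q2 (x + c * t)]) = (0 :: complex^2)"
  \<comment> \<open>The number \<open>2 * \<mu> * t0\<close> has modulus 2, strictly between 0 and 2
    pi, so its exponential is not 1 even for imaginary \<mu>.\<close>
  define t0 where "t0 = 1 / norm \<mu>"
  define w where "w = exp (\<mu> * of_real t0)"
  have norm: "norm (2 * \<mu> * of_real t0) = 2" using \<open>\<mu> \<noteq> 0\<close> by (simp add: t0_def norm_mult norm_divide)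
  have "w * w \<noteq> 1"
  proof
    assume "w * w = 1"
    then have "exp (2 * \<mu> * of_real t0) = 1" by (simp add: w_def mult.assoc flip: exp_add)
    then obtain n :: int where n: "Re (2 * \<mu> * of_real t0) = 0" "Im (2 * \<mu> * of_real t0) = of_int (2 * n) * pi"
      using exp_eq_1 by blast
    have "\<bar>of_int (2 * n) * pi\<bar> = 2" using norm unfolding cmod_eq_Im[OF n(1)] n(2) .
    then have "\<bar>of_int n\<bar> * pi = 1" by (simp add: abs_mult)
    moreover have "n = 0 \<or> 1 \<le> \<bar>of_int n :: real\<bar>" by linarith
    ultimately show False
      using pi_gt3 mult_right_mono[of 1 "\<bar>of_int n\<bar>" pi] by auto
  qed
  have comb: "a * exp (\<mu> * of_real t) * (p1 x + q1 x) + b * exp (- \<mu> * of_real t) * (p2 x + q2 x) = 0" for x t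
  proof -
    have "a *s (exp (\<mu> * of_real t) *s vector [p1 x, q1 x]) +
        b *s (exp (- \<mu> * of_real t) *s vector [p2 x, q2 x]) = (0 :: complex^2)"
      using zero[rule_format, of t "x - c * t"] by simp
    then have "a * (exp (\<mu> * of_real t) * p1 x) + b * (exp (- \<mu> * of_real t) * p2 x) = 0"
      "a * (exp (\<mu> * of_real t) * q1 x) + b * (exp (- \<mu> * of_real t) * q2 x) = 0"
      by (simp_all add: vec_eq_iff forall_2 mult.assoc)
    then have "(a * (exp (\<mu> * of_real t) * p1 x) + b * (exp (- \<mu> * of_real t) * p2 x)) + 
      (a * (exp (\<mu> * of_real t) * q1 x) + b * (exp (- \<mu> * of_real t) * q2 x)) = 0" by simp
    then show ?thesis by (simp add: algebra_simps)
  qed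
  have "a * (p1 x + q1 x) = 0 \<and> b * (p2 x + q2 x) = 0" for x
  proof -
    have 1: "a * (p1 x + q1 x) + b * (p2 x + q2 x) = 0" using comb[of 0 x] by simp
    have "w * (a * exp (\<mu> * of_real t0) * (p1 x + q1 x) + b * exp (- \<mu> * of_real t0) * (p2 x + q2 x)) = 0"
      using comb[of t0 x] by simp
    then have "w * w * (a * (p1 x + q1 x)) + (w * exp (- (\<mu> * of_real t0))) * (b * (p2 x + q2 x)) = 0"
      by (simp add: w_def algebra_simps)
    then have 2: "w * w * (a * (p1 x + q1 x)) + b * (p2 x + q2 x) = 0"
      by (simp add: w_def exp_minus)
    have "(w * w - 1) * (a * (p1 x + q1 x)) = (w * w * (a * (p1 x + q1 x)) + b * (p2 x + q2 x)) -
        (a * (p1 x + q1 x) + b * (p2 x + q2 x))"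
      by (simp add: algebra_simps)
    then have "(w * w - 1) * (a * (p1 x + q1 x)) = 0" unfolding 1 2 by simp
    then have "a * (p1 x + q1 x) = 0" using \<open>w * w \<noteq> 1\<close> by simp
    with 1 show ?thesis by simp
  qed
  then show "a = 0 \<and> b = 0" using nz by (metis mult_eq_0_iff)
qed

section \<open>The travelling wave\<close>

locale mkdv_wave =
  fixes z1 z2 z3 nu k al :: real
  assumes z: "0 < z3" "z3 < z2" "z2 < z1"
    and nu_def: "nu = sqrt (z1\<^sup>2 - z3\<^sup>2)"
    and k_def: "k = sqrt ((z1\<^sup>2 - z2\<^sup>2) / (z1\<^sup>2 - z3\<^sup>2))"
    and al: "0 < al" "al < ellK k"
    and sn_al: "jacobi_sn k al = sqrt ((z1 - z3) / (z1 + z2))"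

sublocale mkdv_wave \<subseteq> jacobi_modulus k
proof
  have 1: "z3\<^sup>2 < z2\<^sup>2" "z2\<^sup>2 < z1\<^sup>2" using z by (auto intro: power_strict_mono)
  then show "0 < k" "k < 1" by (auto simp: k_def)
qed

context mkdv_wave
begin

abbreviation "s_al \<equiv> (jacobi_sn k al :: real)"
abbreviation "c_al \<equiv> (jacobi_cn k al :: real)"
abbreviation "d_al \<equiv> (jacobi_dn k al :: real)"
abbreviation "cal \<equiv> complex_of_real al"

section \<open>Elliptic constants of the wave and of the point \<alpha>\<close>

lemma z_sq: "z3\<^sup>2 < z2\<^sup>2" "z2\<^sup>2 < z1\<^sup>2"
  using z by (auto intro: power_strict_mono)

lemma nu_pos: "0 < nu" and nu_sq: "nu\<^sup>2 = z1\<^sup>2 - z3\<^sup>2"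
  using z_sq by (auto simp: nu_def)

lemma k_sq: "k\<^sup>2 = (z1\<^sup>2 - z2\<^sup>2) / (z1\<^sup>2 - z3\<^sup>2)"
  using z_sq by (simp add: k_def)

lemma k_nu_sq: "k\<^sup>2 * nu\<^sup>2 = z1\<^sup>2 - z2\<^sup>2"
  using z_sq by (simp add: k_sq nu_sq)

lemma s_al_sq: "s_al\<^sup>2 = (z1 - z3) / (z1 + z2)"
  using z by (simp add: sn_al)

text \<open>Makes \<open>den x\<close> equal to \<open>z1 + z3\<close> times
  \<open>1 - k^2 s_al^2 sn^2(nu x)\<close>, which is the denominator in
  \<open>ZZ_add_diff\<close>.\<close>

lemma k_s_al_sq: "k\<^sup>2 * s_al\<^sup>2 = (z1 - z2) / (z1 + z3)"
proof -
  have "z1\<^sup>2 - z2\<^sup>2 = (z1 - z2) * (z1 + z2)" "z1\<^sup>2 - z3\<^sup>2 = (z1 - z3) * (z1 + z3)"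
    by (simp_all add: power2_eq_square algebra_simps)
  then show ?thesis using z by (simp add: k_sq s_al_sq)
qed

lemma c_al_sq: "c_al\<^sup>2 = (z2 + z3) / (z1 + z2)"
proof -
  have "c_al\<^sup>2 = 1 - (z1 - z3) / (z1 + z2)" using real_sn_cn_sq[of al] s_al_sq by simp
  also have "\<dots> = (z2 + z3) / (z1 + z2)" using z by (simp add: field_simps)
  finally show ?thesis .
qed

lemma d_al_sq: "d_al\<^sup>2 = (z2 + z3) / (z1 + z3)"
proof -
  have "d_al\<^sup>2 = 1 - (z1 - z2) / (z1 + z3)" using real_dn_sn_sq[of al] k_s_al_sq by simp
  also have "\<dots> = (z2 + z3) / (z1 + z3)" using z by (simp add: field_simps)
  finally show ?thesis .
qed

lemma scd_al_pos: "0 < s_al" "0 < c_al" "0 < d_al"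
  using al z real_cn_pos[of al] real_dn_pos[of al] by (simp_all add: sn_al)

text \<open>Only the squares of the factors are known explicitly; \<open>0 < al < K\<close> makes
  all of them positive and so selects the root.\<close>

lemma nu_scd_al: "nu * (s_al * c_al * d_al) = (z2 + z3) * (z1 - z3) / (z1 + z2)"
proof (rule power2_eq_imp_eq)
  have "(nu * (s_al * c_al * d_al))\<^sup>2 = ((z1 - z3) * (z1 + z3)) * ((z1 - z3) / (z1 + z2) * ((z2 + z3) / (z1 + z2)) * ((z2 + z3) / (z1 + z3)))"
    unfolding power_mult_distrib nu_sq s_al_sq c_al_sq d_al_sq by (simp add: power2_eq_square algebra_simps)
  also have "\<dots> = ((z2 + z3) * (z1 - z3) / (z1 + z2))\<^sup>2"
    using z by (simp add: power2_eq_square)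
  finally show "(nu * (s_al * c_al * d_al))\<^sup>2 = ((z2 + z3) * (z1 - z3) / (z1 + z2))\<^sup>2" .
qed (use nu_pos scd_al_pos z in auto)

subsection \<open>The profile\<close>

abbreviation "snx x \<equiv> (jacobi_sn k (nu * x) :: real)"
abbreviation "cnx x \<equiv> (jacobi_cn k (nu * x) :: real)"
abbreviation "dnx x \<equiv> (jacobi_dn k (nu * x) :: real)"

definition profile :: "real \<Rightarrow> real" where
  "profile x = 2 * (z1 + z3) * (z2 + z3) / ((z1 + z3) - (z1 - z2) * (snx x)\<^sup>2) - z1 - z2 - z3"

definition den :: "real \<Rightarrow> real" where
  "den x = (z1 + z3) - (z1 - z2) * (snx x)\<^sup>2"

lemma den_ge: "z2 + z3 \<le> den x"
proof -
  have "(snx x)\<^sup>2 \<le> (1::real)"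
    using real_sn_cn_sq[of "nu * x"] by (metis le_add_same_cancel1 zero_le_power2)
  then have "(z1 - z2) * (snx x)\<^sup>2 \<le> (z1 - z2) * 1"
    using z by (intro mult_left_mono) auto
  then show ?thesis by (simp add: den_def)
qed

lemma den_pos: "0 < den x"
  using den_ge[of x] z by linarith

lemma profile_eq: "profile x = 2 * (z1 + z3) * (z2 + z3) / den x - z1 - z2 - z3"
  by (simp add: profile_def den_def)

lemma profile_0: "profile 0 = z2 + z3 - z1"
proof -
  have "2 * (z1 + z3) * (z2 + z3) = (2 * (z2 + z3)) * (z1 + z3)" by (simp add: algebra_simps)
  also have "(2 * (z2 + z3)) * (z1 + z3) / (z1 + z3) = 2 * (z2 + z3)"
    using z by (intro nonzero_mult_div_cancel_right) auto
  finally show ?thesis by (simp add: profile_def real_sn_0)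
qed

text \<open>Provides the growth bound \<open>M\<close> for the uniqueness argument in
  \<open>lax_travelling_wave\<close>.\<close>

lemma profile_bounded: "\<bar>profile x\<bar> \<le> 2 * (z1 + z3) + z1 + z2 + z3"
proof -
  let ?a = "2 * (z1 + z3) * (z2 + z3)"
  have "?a / den x \<le> ?a / (z2 + z3)"
    using den_ge[of x] z by (intro divide_left_mono mult_pos_pos den_pos) auto
  also have "\<dots> = 2 * (z1 + z3)" using z by (intro nonzero_mult_div_cancel_right) auto
  finally have "?a / den x \<le> 2 * (z1 + z3)" .
  moreover have "0 \<le> ?a / den x" using den_pos[of x] z by simp
  ultimately show ?thesis using z unfolding profile_eq by linarith
qed

definition profile1 :: "real \<Rightarrow> real" where
  "profile1 x = 4 * (z1 + z3) * (z2 + z3) * (z1 - z2) * nu *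
     (snx x * cnx x * dnx x) / (den x)\<^sup>2"

definition wave_speed :: real where "wave_speed = 2 * (z1\<^sup>2 + z2\<^sup>2 + z3\<^sup>2)"

lemmas sn_chain = DERIV_chain2[OF real_sn_DERIV]
lemmas cn_chain = DERIV_chain2[OF real_cn_DERIV]
lemmas dn_chain = DERIV_chain2[OF real_dn_DERIV]

lemma den_DERIV: "(den has_real_derivative - 2 * (z1 - z2) * nu *
    (snx x * cnx x * dnx x)) (at x)"
  unfolding den_def[abs_def]
  by (rule derivative_eq_intros sn_chain refl)+ (simp add: algebra_simps)

lemma profile_DERIV: "(profile has_real_derivative profile1 x) (at x)"
proof -
  let ?N = "2 * (z1 + z3) * (z2 + z3)"
  have nz: "den x \<noteq> 0" using den_pos[of x] by simp
  have "((\<lambda>x. ?N / den x - z1 - z2 - z3) has_real_derivative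
      (- ?N * (- 2 * (z1 - z2) * nu * (snx x * cnx x * dnx x))) / (den x)\<^sup>2) (at x)"
    by (rule den_DERIV derivative_eq_intros nz refl)+ (simp add: power2_eq_square)
  moreover have "- ?N * (- 2 * (z1 - z2) * nu * w) = 4 * (z1 + z3) * (z2 + z3) * (z1 - z2) * nu * w" for w
    by (simp add: algebra_simps)
  ultimately show ?thesis
    unfolding profile_eq[abs_def] profile1_def by (simp only:)
qed

text \<open>With \<open>P\<close> in place of \<open>sn^2\<close> both sides are rational, and
  multiplication by \<open>D ^ 3\<close> leaves a polynomial identity. The value
  \<open>4 * z1 * z2 * z3\<close> is the integration constant that arises when the mKdV equation for
  a travelling wave is integrated once.\<close>

lemma profile_ode_aux:
  fixes P :: real
  defines "D \<equiv> (z1 + z3) - (z1 - z2) * P"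
  assumes "D \<noteq> 0"
  defines "f \<equiv> 2 * (z1 + z3) * (z2 + z3) / D - z1 - z2 - z3"
  shows "4 * (z1 + z3) * (z2 + z3) * (z1 - z2) *
      ((nu\<^sup>2 - 2 * nu\<^sup>2 * P - 2 * (k\<^sup>2 * nu\<^sup>2) * P + 3 * (k\<^sup>2 * nu\<^sup>2) * P\<^sup>2) / D\<^sup>2 +
       4 * (z1 - z2) * (P * (1 - P) * (nu\<^sup>2 - (k\<^sup>2 * nu\<^sup>2) * P)) / D ^ 3) =
    4 * z1 * z2 * z3 - wave_speed * f + 2 * f ^ 3" (is "?L = ?R")
proof -
  let ?N = "2 * (z1 + z3) * (z2 + z3)" and ?S = "z1 + z2 + z3"
  have fD: "f * D = ?N - ?S * D"
    using \<open>D \<noteq> 0\<close> by (simp add: f_def field_simps)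
  have "?L * D ^ 3 = 4 * (z1 + z3) * (z2 + z3) * (z1 - z2) *
      ((nu\<^sup>2 - 2 * nu\<^sup>2 * P - 2 * (k\<^sup>2 * nu\<^sup>2) * P + 3 * (k\<^sup>2 * nu\<^sup>2) * P\<^sup>2) * D +
       4 * (z1 - z2) * (P * (1 - P) * (nu\<^sup>2 - (k\<^sup>2 * nu\<^sup>2) * P)))"
    using \<open>D \<noteq> 0\<close> by (simp add: field_simps power2_eq_square power3_eq_cube)
  also have "\<dots> = 4 * z1 * z2 * z3 * D ^ 3 - wave_speed * D\<^sup>2 * (?N - ?S * D) + 2 * (?N - ?S * D) ^ 3"
    unfolding k_nu_sq unfolding nu_sq D_def wave_speed_def by algebra
  also have "\<dots> = ?R * D ^ 3"
    unfolding fD[symmetric] by (simp add: algebra_simps power2_eq_square power3_eq_cube)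
  finally show ?thesis using \<open>D \<noteq> 0\<close> by simp
qed

lemma profile1_DERIV:
  "(profile1 has_real_derivative 4 * z1 * z2 * z3 - wave_speed * profile x + 2 * profile x ^ 3) (at x)"
proof -
  let ?s = "snx x" and ?c = "cnx x" and ?d = "dnx x"
  let ?K = "4 * (z1 + z3) * (z2 + z3) * (z1 - z2)"
  have nz: "den x \<noteq> 0" "(den x)\<^sup>2 \<noteq> 0" using den_pos[of x] by auto
  have c: "?c\<^sup>2 = 1 - ?s\<^sup>2" and d: "?d\<^sup>2 = 1 - k\<^sup>2 * ?s\<^sup>2"
    using real_sn_cn_sq[of "nu * x"] real_dn_sn_sq[of "nu * x"] by (simp_all add: algebra_simps)
  have s: "((\<lambda>x. snx x * cnx x * dnx x) has_real_derivative
      nu * (?c\<^sup>2 * ?d\<^sup>2 - ?s\<^sup>2 * ?d\<^sup>2 - k\<^sup>2 * ?s\<^sup>2 * ?c\<^sup>2)) (at x)"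
    by (rule derivative_eq_intros sn_chain cn_chain dn_chain refl)+ (simp add: algebra_simps power2_eq_square)
  let ?w = "?s * ?c * ?d" and ?w' = "nu * (?c\<^sup>2 * ?d\<^sup>2 - ?s\<^sup>2 * ?d\<^sup>2 - k\<^sup>2 * ?s\<^sup>2 * ?c\<^sup>2)"
  have "((\<lambda>x. snx x * cnx x * dnx x / (den x)\<^sup>2) has_real_derivative
      (?w' * (den x)\<^sup>2 - ?w * (2 * den x * (- 2 * (z1 - z2) * nu * ?w))) / ((den x)\<^sup>2 * (den x)\<^sup>2)) (at x)"
    by (rule s den_DERIV derivative_eq_intros nz refl)+ simp
  from DERIV_cmult[OF this, of "?K * nu"]
  have "((\<lambda>x. ?K * nu * (snx x * cnx x * dnx x) / (den x)\<^sup>2) has_real_derivative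
      ?K * nu * ((?w' * (den x)\<^sup>2 - ?w * (2 * den x * (- 2 * (z1 - z2) * nu * ?w))) / ((den x)\<^sup>2 * (den x)\<^sup>2))) (at x)"
    by simp
  moreover have "?K * nu * ((?w' * (den x)\<^sup>2 - ?w * (2 * den x * (- 2 * (z1 - z2) * nu * ?w))) / ((den x)\<^sup>2 * (den x)\<^sup>2)) =
      ?K * (nu\<^sup>2 * (?c\<^sup>2 * ?d\<^sup>2 - ?s\<^sup>2 * ?d\<^sup>2 - k\<^sup>2 * ?s\<^sup>2 * ?c\<^sup>2) / (den x)\<^sup>2 +
        4 * (z1 - z2) * nu\<^sup>2 * (?s\<^sup>2 * ?c\<^sup>2 * ?d\<^sup>2) / (den x) ^ 3)"
  proof -
    have "K * nu * ((nu * Q * D\<^sup>2 - w * (2 * D * (- 2 * b * nu * w))) / (D\<^sup>2 * D\<^sup>2)) =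
        K * (nu\<^sup>2 * Q / D\<^sup>2 + 4 * b * nu\<^sup>2 * w\<^sup>2 / D ^ 3)" if "D \<noteq> 0" for K Q D w b :: real
      using that by (simp add: field_simps power2_eq_square power3_eq_cube)
    from this[OF nz(1)] show ?thesis by (simp only: power_mult_distrib)
  qed
  moreover have "?K * (nu\<^sup>2 * (?c\<^sup>2 * ?d\<^sup>2 - ?s\<^sup>2 * ?d\<^sup>2 - k\<^sup>2 * ?s\<^sup>2 * ?c\<^sup>2) / (den x)\<^sup>2 +
        4 * (z1 - z2) * nu\<^sup>2 * (?s\<^sup>2 * ?c\<^sup>2 * ?d\<^sup>2) / (den x) ^ 3) =
      4 * z1 * z2 * z3 - wave_speed * profile x + 2 * profile x ^ 3"
  proof -
    have "nu\<^sup>2 * (?c\<^sup>2 * ?d\<^sup>2 - ?s\<^sup>2 * ?d\<^sup>2 - k\<^sup>2 * ?s\<^sup>2 * ?c\<^sup>2) =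
        nu\<^sup>2 - 2 * nu\<^sup>2 * ?s\<^sup>2 - 2 * (k\<^sup>2 * nu\<^sup>2) * ?s\<^sup>2 + 3 * (k\<^sup>2 * nu\<^sup>2) * (?s\<^sup>2)\<^sup>2"
      unfolding c d by (simp add: algebra_simps power2_eq_square)
    moreover have "4 * (z1 - z2) * nu\<^sup>2 * (?s\<^sup>2 * ?c\<^sup>2 * ?d\<^sup>2) =
        4 * (z1 - z2) * (?s\<^sup>2 * (1 - ?s\<^sup>2) * (nu\<^sup>2 - (k\<^sup>2 * nu\<^sup>2) * ?s\<^sup>2))"
      unfolding c d by (simp add: algebra_simps)
    moreover have "(z1 + z3) - (z1 - z2) * ?s\<^sup>2 \<noteq> 0" using nz(1) by (simp add: den_def)
    note profile_ode_aux[OF this]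
    ultimately show ?thesis
      by (simp only: den_def profile_def)
  qed
  ultimately show ?thesis by (simp only: profile1_def[abs_def])
qed

subsection \<open>The eigenfunctions\<close>

lemma scd_cal: "scd cal = of_real (s_al * c_al * d_al)"
  by (simp add: scd_def sn_of_real cn_of_real dn_of_real)

lemma TT_cal: "TT cal \<noteq> 0" "TT (2 * cal) \<noteq> 0"
  using TT_real_nonzero[of al] TT_real_nonzero[of "2 * al"] by simp_all

lemma scd_cal_nonzero: "scd cal \<noteq> 0"
  using scd_al_pos by (simp add: scd_cal)

lemma HH_2cal: "HH (2 * cal) \<noteq> 0"
  by (rule HH_double_log_deriv(1)[OF TT_cal(1) scd_cal_nonzero])

text \<open>The duplication formula at \<alpha>. It converts the factor
  \<open>nu / sn (2 * cal)\<close> that comes out of \<open>lame_step\<close> into the factor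
  \<open>z1\<close> of the claimed solutions.\<close>

lemma sn_2al: "of_real z1 * sn (2 * cal) = of_real nu"
proof -
  have "1 - k\<^sup>2 * s_al ^ 4 = 1 - (k\<^sup>2 * s_al\<^sup>2) * s_al\<^sup>2"
    by (simp add: power2_eq_square power4_eq_xxxx)
  also have "\<dots> = 2 * z1 * (z2 + z3) / ((z1 + z3) * (z1 + z2))"
    unfolding k_s_al_sq unfolding s_al_sq using z by (simp add: divide_simps) (simp add: algebra_simps)
  finally have w: "1 - k\<^sup>2 * s_al ^ 4 = 2 * z1 * (z2 + z3) / ((z1 + z3) * (z1 + z2))" .
  have "nu * (2 * z1 * (s_al * c_al * d_al)) = nu * (nu * (1 - k\<^sup>2 * s_al ^ 4))"
  proof -
    have "nu * (2 * z1 * (s_al * c_al * d_al)) = 2 * z1 * (nu * (s_al * c_al * d_al))"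
      by (simp only: mult_ac)
    also have "\<dots> = 2 * z1 * ((z2 + z3) * (z1 - z3) / (z1 + z2))"
      unfolding nu_scd_al ..
    also have "\<dots> = (z1\<^sup>2 - z3\<^sup>2) * (2 * z1 * (z2 + z3) / ((z1 + z3) * (z1 + z2)))"
      using z by (simp add: divide_simps) (simp add: power2_eq_square algebra_simps)
    finally show ?thesis unfolding w[symmetric] nu_sq[symmetric] by (simp only: power2_eq_square[of nu] mult.assoc)
  qed
  then have r: "2 * z1 * (s_al * c_al * d_al) = nu * (1 - k\<^sup>2 * s_al ^ 4)" using nu_pos by simp
  have w0: "1 - k\<^sup>2 * s_al ^ 4 \<noteq> 0" unfolding w using z by simp
  have "sn (2 * cal) * (1 - of_real (k\<^sup>2) * (sn cal) ^ 4) = 2 * scd cal"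
    using sn_double[OF TT_cal(1)] TT_cal(2) by (simp add: mult.assoc mult.commute)
  then have "of_real z1 * sn (2 * cal) * of_real (1 - k\<^sup>2 * s_al ^ 4) = of_real (2 * z1 * (s_al * c_al * d_al))"
    by (simp add: sn_of_real scd_cal mult_ac)
  then have "of_real z1 * sn (2 * cal) * of_real (1 - k\<^sup>2 * s_al ^ 4) = of_real nu * complex_of_real (1 - k\<^sup>2 * s_al ^ 4)"
    unfolding r of_real_mult .
  moreover have "complex_of_real (1 - k\<^sup>2 * s_al ^ 4) \<noteq> 0" using w0 by (simp only: of_real_eq_0_iff not_False_eq_True)
  ultimately show ?thesis using mult_right_cancel by blast
qed

text \<open>\<open>ZZ_add_diff\<close> contributes the part depending on \<open>x\<close> together
  with \<open>- 2 * ZZ cal\<close>, which the logarithmic derivative at \<open>2 * cal\<close>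
  compensates. What is left is a rational function of \<open>sn^2\<close>.\<close>

lemma profile_zeta:
  fixes x :: real
  defines "X \<equiv> complex_of_real (nu * x)"
  shows "of_real nu * (ZZ (X - cal) - ZZ (X + cal) + deriv HH (2 * cal) / HH (2 * cal)) = of_real (profile x)"
proof -
  let ?S = "(snx x)\<^sup>2" and ?\<sigma> = "s_al * c_al * d_al"
  have nz: "TT X \<noteq> 0" "TT (X + cal) \<noteq> 0" "TT (X - cal) \<noteq> 0"
    using TT_real_nonzero[of "nu * x"] TT_real_nonzero[of "nu * x + al"] TT_real_nonzero[of "nu * x - al"]
    by (simp_all add: X_def)
  have "ZZ (X - cal) - ZZ (X + cal) + deriv HH (2 * cal) / HH (2 * cal) =
      2 * of_real (k\<^sup>2) * scd cal * (sn X)\<^sup>2 / (1 - of_real (k\<^sup>2) * (sn X)\<^sup>2 * (sn cal)\<^sup>2) +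
      ((cn cal)\<^sup>2 * (dn cal)\<^sup>2 - (sn cal)\<^sup>2 * (dn cal)\<^sup>2 - of_real (k\<^sup>2) * (sn cal)\<^sup>2 * (cn cal)\<^sup>2) / (2 * scd cal)"
    using ZZ_add_diff(2)[OF nz(1) TT_cal(1) nz(2,3)] HH_double_log_deriv(2)[OF TT_cal(1) scd_cal_nonzero]
    by (simp add: algebra_simps)
  also have "sn X = of_real (snx x)" unfolding X_def by (rule sn_of_real)
  also have "2 * of_real (k\<^sup>2) * scd cal * (of_real (snx x))\<^sup>2 / (1 - of_real (k\<^sup>2) * (of_real (snx x))\<^sup>2 * (sn cal)\<^sup>2) +
      ((cn cal)\<^sup>2 * (dn cal)\<^sup>2 - (sn cal)\<^sup>2 * (dn cal)\<^sup>2 - of_real (k\<^sup>2) * (sn cal)\<^sup>2 * (cn cal)\<^sup>2) / (2 * scd cal) =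
      of_real (2 * k\<^sup>2 * ?\<sigma> * ?S / (1 - k\<^sup>2 * ?S * s_al\<^sup>2) +
      (c_al\<^sup>2 * d_al\<^sup>2 - s_al\<^sup>2 * d_al\<^sup>2 - k\<^sup>2 * s_al\<^sup>2 * c_al\<^sup>2) / (2 * ?\<sigma>))"
    by (simp add: scd_def sn_of_real cn_of_real dn_of_real)
  finally have 1: "of_real nu * (ZZ (X - cal) - ZZ (X + cal) + deriv HH (2 * cal) / HH (2 * cal)) =
    of_real (nu * (2 * k\<^sup>2 * ?\<sigma> * ?S / (1 - k\<^sup>2 * ?S * s_al\<^sup>2) +
      (c_al\<^sup>2 * d_al\<^sup>2 - s_al\<^sup>2 * d_al\<^sup>2 - k\<^sup>2 * s_al\<^sup>2 * c_al\<^sup>2) / (2 * ?\<sigma>)))"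
    by simp
  have D: "den x > 0" by (rule den_pos)
  have "1 - k\<^sup>2 * ?S * s_al\<^sup>2 = 1 - (k\<^sup>2 * s_al\<^sup>2) * ?S" by simp
  also have "\<dots> = den x / (z1 + z3)"
    unfolding k_s_al_sq den_def using z by (simp add: field_simps)
  finally have e1: "1 - k\<^sup>2 * ?S * s_al\<^sup>2 = den x / (z1 + z3)" .
  have e2: "nu * (2 * k\<^sup>2 * ?\<sigma> * ?S) = 2 * (z1 - z2) * (z2 + z3) / (z1 + z3) * ?S"
  proof -
    have "nu * (2 * k\<^sup>2 * ?\<sigma> * ?S) = 2 * (k\<^sup>2 * ((z2 + z3) * (z1 - z3) / (z1 + z2))) * ?S"
      unfolding nu_scd_al[symmetric] by (simp add: mult_ac)
    also have "k\<^sup>2 * ((z2 + z3) * (z1 - z3) / (z1 + z2)) = (k\<^sup>2 * s_al\<^sup>2) * (z2 + z3)"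
      unfolding s_al_sq by simp
    also have "\<dots> = (z1 - z2) * (z2 + z3) / (z1 + z3)" unfolding k_s_al_sq by simp
    finally show ?thesis by simp
  qed
  \<comment> \<open>This constant is the value of the whole expression at \<open>x = 0\<close>, in
    agreement with \<open>profile_0\<close>.\<close>
  have e3: "nu * ((c_al\<^sup>2 * d_al\<^sup>2 - s_al\<^sup>2 * d_al\<^sup>2 - k\<^sup>2 * s_al\<^sup>2 * c_al\<^sup>2) / (2 * ?\<sigma>)) = z2 + z3 - z1"
  proof -
    have "c_al\<^sup>2 * d_al\<^sup>2 - s_al\<^sup>2 * d_al\<^sup>2 - k\<^sup>2 * s_al\<^sup>2 * c_al\<^sup>2 =
        2 * (z2 + z3) * (z2 + z3 - z1) / ((z1 + z2) * (z1 + z3))"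
      unfolding k_s_al_sq unfolding s_al_sq c_al_sq d_al_sq using z
      by (simp add: divide_simps) (simp add: algebra_simps)
    moreover have "nu * (nu * (2 * (z2 + z3) * (z2 + z3 - z1) / ((z1 + z2) * (z1 + z3)))) =
        (z2 + z3 - z1) * (2 * (nu * ?\<sigma>))"
      unfolding nu_scd_al mult.assoc[symmetric, of nu nu] power2_eq_square[symmetric] nu_sq using z
      by (simp add: divide_simps) (simp add: power2_eq_square algebra_simps)
    ultimately have "nu * (nu * (c_al\<^sup>2 * d_al\<^sup>2 - s_al\<^sup>2 * d_al\<^sup>2 - k\<^sup>2 * s_al\<^sup>2 * c_al\<^sup>2)) =
        nu * ((z2 + z3 - z1) * (2 * ?\<sigma>))"
      by (simp only: mult_ac)
    then have "nu * (c_al\<^sup>2 * d_al\<^sup>2 - s_al\<^sup>2 * d_al\<^sup>2 - k\<^sup>2 * s_al\<^sup>2 * c_al\<^sup>2) = (z2 + z3 - z1) * (2 * ?\<sigma>)"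
      using nu_pos by (subst (asm) mult_left_cancel) auto
    then show ?thesis
      unfolding times_divide_eq_right using scd_al_pos by simp
  qed
  have "nu * (2 * k\<^sup>2 * ?\<sigma> * ?S / (1 - k\<^sup>2 * ?S * s_al\<^sup>2) +
      (c_al\<^sup>2 * d_al\<^sup>2 - s_al\<^sup>2 * d_al\<^sup>2 - k\<^sup>2 * s_al\<^sup>2 * c_al\<^sup>2) / (2 * ?\<sigma>)) =
      (2 * (z1 - z2) * (z2 + z3) / (z1 + z3) * ?S) / (den x / (z1 + z3)) + (z2 + z3 - z1)"
    unfolding distrib_left e3 times_divide_eq_right[of nu "2 * k\<^sup>2 * ?\<sigma> * ?S"] e2 e1 ..
  also have "\<dots> = profile x"
  proof -
    have "(z1 - z2) * ?S = (z1 + z3) - den x" by (simp add: den_def)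
    moreover have "(2 * (z1 - z2) * (z2 + z3) / (z1 + z3) * ?S) / (den x / (z1 + z3)) = (2 * (z1 - z2) * (z2 + z3) * ?S) / den x"
      using z by simp
    moreover have "2 * (z1 - z2) * (z2 + z3) * ?S = 2 * (z2 + z3) * ((z1 - z2) * ?S)" by (simp only: mult_ac)
    ultimately have "(2 * (z1 - z2) * (z2 + z3) / (z1 + z3) * ?S) / (den x / (z1 + z3)) = 2 * (z2 + z3) * ((z1 + z3) - den x) / den x"
      by (simp only:)
    then show ?thesis using D unfolding profile_eq by (simp add: field_simps)
  qed
  finally show ?thesis using 1 by simp
qed

text \<open>The constant C as a function of \<gamma>: the spatial system couples its two components
  through \<open>coeff \<gamma>\<close> and \<open>coeff (- \<gamma>)\<close>.\<close>

definition coeff :: "complex \<Rightarrow> complex" where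
  "coeff \<gamma> = of_real z1 * (TT 0 * TT (2 * cal + \<gamma>) / (TT \<gamma> * TT (2 * cal)))"

lemma coeff_eq:
  assumes "TT \<gamma> \<noteq> 0"
  shows "coeff \<gamma> = of_real nu * (deriv HH 0 * TT (\<gamma> + 2 * cal) / (HH (2 * cal) * TT \<gamma>))"
proof -
  have k: "complex_of_real (sqrt k) \<noteq> 0" using k_pos by simp
  have z1: "complex_of_real z1 \<noteq> 0" using z by simp
  have s: "sn (2 * cal) \<noteq> 0" using sn_2al nu_pos by auto
  show ?thesis
    unfolding coeff_def deriv_HH_0 HH_sn[OF TT_cal(2)] sn_2al[symmetric]
    using assms TT_cal k s by (simp add: add.commute field_simps)
qed

lemma coeff_mult:
  assumes "TT \<gamma> \<noteq> 0"
  shows "coeff \<gamma> * coeff (- \<gamma>) = of_real (z1\<^sup>2) - of_real (k\<^sup>2 * nu\<^sup>2) * (sn \<gamma>)\<^sup>2"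
proof -
  have "coeff \<gamma> * coeff (- \<gamma>) = (of_real z1)\<^sup>2 * ((TT 0)\<^sup>2 * (TT (2 * cal + \<gamma>) * TT (2 * cal - \<gamma>))) / ((TT (2 * cal))\<^sup>2 * (TT \<gamma>)\<^sup>2)"
    by (simp add: coeff_def power2_eq_square mult_ac)
  also have "\<dots> = (of_real z1)\<^sup>2 * (1 - of_real (k\<^sup>2) * (sn (2 * cal))\<^sup>2 * (sn \<gamma>)\<^sup>2)"
    unfolding TT_add_diff_sn[OF TT_cal(2) assms] using TT_cal assms by simp
  also have "\<dots> = (of_real z1)\<^sup>2 - of_real (k\<^sup>2) * (of_real z1 * sn (2 * cal))\<^sup>2 * (sn \<gamma>)\<^sup>2"
    by (simp add: algebra_simps power_mult_distrib)
  finally show ?thesis unfolding sn_2al by simp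
qed

text \<open>At \<open>x = 0\<close> the derivative of the profile vanishes, and the time equation
  reduces to a linear relation between \<open>HH (\<gamma> + cal)\<close> and
  \<open>HH (\<gamma> - cal)\<close>. It follows by evaluating \<open>B\<close> twice, through the
  addition formula and through the spatial equation at 0.\<close>

lemma time_equation_0:
  fixes \<gamma> w :: complex
  assumes nz: "TT \<gamma> \<noteq> 0" and w: "w = of_real (z1\<^sup>2) - of_real (k\<^sup>2 * nu\<^sup>2) * (sn \<gamma>)\<^sup>2"
  shows "(- 4 * of_real (nu ^ 3 * k\<^sup>2) * scd \<gamma> + (of_real (4 * z1 * z2 * z3) - 4 * w * of_real (profile 0))) * HH (\<gamma> + cal) =
    (of_real wave_speed - 4 * w - 2 * (of_real (profile 0))\<^sup>2) * coeff \<gamma> * HH (\<gamma> - cal)"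
proof -
  define hp hm B where "hp = HH (\<gamma> + cal)" and "hm = HH (\<gamma> - cal)"
    and "B = deriv HH (\<gamma> + cal) - HH (\<gamma> + cal) * (ZZ \<gamma> + ZZ cal)"
  let ?\<kappa> = "of_real k * (TT \<gamma>)\<^sup>2 * (TT cal)\<^sup>2" and ?n = "complex_of_real nu" and ?u = "complex_of_real (profile 0)"
  let ?ds = "scd \<gamma> - scd cal" and ?dS = "(sn \<gamma>)\<^sup>2 - (sn cal)\<^sup>2"
  let ?m = "complex_of_real (k\<^sup>2 * nu\<^sup>2)"
  have k: "?\<kappa> \<noteq> 0" using k_pos nz TT_cal by simp
  have "(TT 0)\<^sup>2 * (hm * B) = ?\<kappa> * ?ds"
    unfolding hm_def B_def by (rule HH_add[OF nz TT_cal(1)])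
  moreover have "(TT 0)\<^sup>2 * (hp * hm) = ?\<kappa> * ?dS"
    unfolding hm_def hp_def by (rule HH_add_diff_sn[OF nz TT_cal(1)])
  \<comment> \<open>Cross multiplication instead of division by \<open>hm\<close>, which may
    vanish.\<close>
  moreover have "(TT 0)\<^sup>2 * (hm * B) * hp = (TT 0)\<^sup>2 * (hp * hm) * B" by (simp only: mult_ac)
  ultimately have "?\<kappa> * (?ds * hp) = ?\<kappa> * (?dS * B)" by (simp only: mult.assoc)
  then have dd: "?ds * hp = ?dS * B" using k mult_left_cancel by blast
  have nuB: "?n * B = ?u * hp - coeff \<gamma> * hm"
  proof -
    have m: "TT (0 - cal) \<noteq> 0" using TT_cal by simp
    have "B = (ZZ (0 - cal) - ZZ (0 + cal) + deriv HH (2 * cal) / HH (2 * cal)) * hp -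
        deriv HH 0 * TT (\<gamma> + 2 * cal) / (HH (2 * cal) * TT \<gamma>) * hm"
      using lame_step[OF nz m HH_2cal] TT_cal by (simp add: B_def hp_def hm_def add.commute)
    then have "?n * B = (?n * (ZZ (0 - cal) - ZZ (0 + cal) + deriv HH (2 * cal) / HH (2 * cal))) * hp -
        (?n * (deriv HH 0 * TT (\<gamma> + 2 * cal) / (HH (2 * cal) * TT \<gamma>))) * hm"
      by (simp only: right_diff_distrib mult.assoc)
    then show ?thesis
      using profile_zeta[of 0] coeff_eq[OF nz] by simp
  qed
  have kns: "(k\<^sup>2 * nu\<^sup>2) * s_al\<^sup>2 = (z1 - z2) * (z1 - z3)"
    unfolding k_nu_sq s_al_sq using z by (simp add: divide_simps) (simp add: power2_eq_square algebra_simps)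
  \<comment> \<open>Both sides are affine in the square of \<open>sn \<gamma>\<close> with the same
    slope; the identity checked is their value where \<open>sn \<gamma> = 0\<close>, that is at
    \<open>w = z1^2\<close>. The equation \<open>a\<close> below is obtained in the same
    way.\<close>
  have d: "of_real wave_speed - 4 * w - 2 * ?u\<^sup>2 = 4 * ?m * ?dS"
  proof -
    have "wave_speed - 4 * z1\<^sup>2 - 2 * (profile 0)\<^sup>2 = - 4 * ((k\<^sup>2 * nu\<^sup>2) * s_al\<^sup>2)"
      unfolding kns profile_0 wave_speed_def by (simp add: power2_eq_square algebra_simps)
    from arg_cong[OF this, of complex_of_real]
    have "of_real wave_speed - 4 * of_real (z1\<^sup>2) - 2 * ?u\<^sup>2 = - 4 * (?m * (sn cal)\<^sup>2)"
      by (simp add: sn_of_real)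
    then show ?thesis unfolding w by (simp add: algebra_simps)
  qed
  have a: "of_real (4 * z1 * z2 * z3) - 4 * w * ?u = 4 * of_real (nu ^ 3 * k\<^sup>2) * scd cal + ?u * (4 * ?m * ?dS)"
  proof -
    have "4 * z1 * z2 * z3 - 4 * z1\<^sup>2 * profile 0 = 4 * (nu ^ 3 * k\<^sup>2) * (s_al * c_al * d_al) - profile 0 * (4 * (k\<^sup>2 * nu\<^sup>2) * s_al\<^sup>2)"
    proof -
      have "(nu ^ 3 * k\<^sup>2) * (s_al * c_al * d_al) = (z1 - z2) * (z2 + z3) * (z1 - z3)"
      proof -
        have "(nu ^ 3 * k\<^sup>2) * (s_al * c_al * d_al) = (k\<^sup>2 * nu\<^sup>2) * (nu * (s_al * c_al * d_al))"
          by (simp add: power2_eq_square power3_eq_cube)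
        also have "\<dots> = (z1 - z2) * (z2 + z3) * (z1 - z3)"
          unfolding nu_scd_al k_nu_sq using z by (simp add: divide_simps) (simp add: power2_eq_square algebra_simps)
        finally show ?thesis .
      qed
      with kns have "4 * (nu ^ 3 * k\<^sup>2) * (s_al * c_al * d_al) - profile 0 * (4 * (k\<^sup>2 * nu\<^sup>2) * s_al\<^sup>2) =
          4 * ((z1 - z2) * (z2 + z3) * (z1 - z3)) - profile 0 * (4 * ((z1 - z2) * (z1 - z3)))"
        by (simp only: mult.assoc[of 4])
      then show ?thesis unfolding profile_0 by (simp add: power2_eq_square algebra_simps)
    qed
    from arg_cong[OF this, of complex_of_real]
    have "of_real (4 * z1 * z2 * z3) - 4 * of_real (z1\<^sup>2) * ?u =
        4 * of_real (nu ^ 3 * k\<^sup>2) * scd cal - ?u * (4 * ?m * (sn cal)\<^sup>2)"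
      by (simp add: sn_of_real scd_cal)
    then show ?thesis unfolding w by (simp add: algebra_simps)
  qed
  have "(- 4 * of_real (nu ^ 3 * k\<^sup>2) * scd \<gamma> + (of_real (4 * z1 * z2 * z3) - 4 * w * ?u)) * hp =
      ?u * (4 * ?m * ?dS) * hp - 4 * of_real (nu ^ 3 * k\<^sup>2) * (?ds * hp)"
    unfolding a by (simp add: algebra_simps)
  also have "\<dots> = 4 * ?m * ?dS * (?u * hp - ?n * B)"
    unfolding dd by (simp add: algebra_simps power2_eq_square power3_eq_cube)
  also have "?u * hp - ?n * B = coeff \<gamma> * hm" unfolding nuB by simp
  finally show ?thesis unfolding d hp_def hm_def by (simp only: mult.assoc)
qed

section \<open>The eigenfunctions and their linear system\<close>

lemma HH_TT_exp_DERIV: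
  assumes "TT (X + b) \<noteq> 0"
  shows "((\<lambda>X. HH (X + a) / TT (X + b) * exp (- X * Z)) has_field_derivative
    (deriv HH (X + a) - HH (X + a) * (ZZ (X + b) + Z)) / TT (X + b) * exp (- X * Z)) (at X)"
proof -
  have "((\<lambda>X. HH (X + a) / TT (X + b)) has_field_derivative
      (deriv HH (X + a) * TT (X + b) - HH (X + a) * deriv TT (X + b)) / (TT (X + b) * TT (X + b))) (at X)"
    using assms by (auto intro!: derivative_eq_intros)
  moreover have "((\<lambda>X. exp (- X * Z)) has_field_derivative exp (- X * Z) * (- Z)) (at X)"
    by (auto intro!: derivative_eq_intros)
  ultimately have "((\<lambda>X. HH (X + a) / TT (X + b) * exp (- X * Z)) has_field_derivative
      (deriv HH (X + a) * TT (X + b) - HH (X + a) * deriv TT (X + b)) / (TT (X + b) * TT (X + b)) * exp (- X * Z) +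
      exp (- X * Z) * (- Z) * (HH (X + a) / TT (X + b))) (at X)"
    by (rule DERIV_mult)
  also have "(deriv HH (X + a) * TT (X + b) - HH (X + a) * deriv TT (X + b)) / (TT (X + b) * TT (X + b)) * exp (- X * Z) +
      exp (- X * Z) * (- Z) * (HH (X + a) / TT (X + b)) =
      (deriv HH (X + a) - HH (X + a) * (ZZ (X + b) + Z)) / TT (X + b) * exp (- X * Z)"
    unfolding deriv_TT_eq[OF assms] using assms by (simp add: field_simps)
  finally show ?thesis .
qed

text \<open>Hermite's solution of Lame's equation, translated by \<open>b\<close>, which will be
  \<alpha> or \<open>- \<alpha>\<close>. The exponential is not translated; this changes only a
  constant factor.\<close>

definition wave :: "complex \<Rightarrow> complex \<Rightarrow> real \<Rightarrow> complex" where
  "wave \<gamma> b x = HH (of_real (nu * x) + (b + \<gamma>)) / TT (of_real (nu * x) + b) * exp (- of_real (nu * x) * ZZ \<gamma>)"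

lemma wave_DERIV:
  fixes x :: real
  defines "X \<equiv> complex_of_real (nu * x)"
  assumes "TT (X + b) \<noteq> 0"
  shows "(wave \<gamma> b has_vector_derivative
    of_real nu * (deriv HH (X + \<gamma> + b) - HH (X + \<gamma> + b) * (ZZ (X + b) + ZZ \<gamma>)) / TT (X + b) * exp (- X * ZZ \<gamma>)) (at x)"
proof -
  have "((\<lambda>X. HH (X + (b + \<gamma>)) / TT (X + b) * exp (- X * ZZ \<gamma>)) has_field_derivative
      (deriv HH (X + (b + \<gamma>)) - HH (X + (b + \<gamma>)) * (ZZ (X + b) + ZZ \<gamma>)) / TT (X + b) * exp (- X * ZZ \<gamma>)) (at (of_real nu * of_real x))"
    using HH_TT_exp_DERIV[OF assms(2), of "b + \<gamma>" "ZZ \<gamma>"] by (simp add: X_def)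
  from DERIV_chain2[OF this DERIV_cmult_Id[of "of_real nu"]]
  have "((\<lambda>z. HH (of_real nu * z + (b + \<gamma>)) / TT (of_real nu * z + b) * exp (- (of_real nu * z) * ZZ \<gamma>)) has_field_derivative
      (deriv HH (X + (b + \<gamma>)) - HH (X + (b + \<gamma>)) * (ZZ (X + b) + ZZ \<gamma>)) / TT (X + b) * exp (- X * ZZ \<gamma>) * of_real nu) (at (of_real x))" .
  from has_vector_derivative_real_field[OF this]
  show ?thesis
    by (simp add: wave_def[abs_def] add_ac mult_ac)
qed

text \<open>The two equations are \<open>lame_step\<close> for \<alpha> and for
  \<open>- \<alpha>\<close>; reversing the sign of \<alpha> negates the bracket that represents the
  profile.\<close>

lemma wave_system:
  assumes nz: "TT \<gamma> \<noteq> 0"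
  shows "(wave \<gamma> cal has_vector_derivative of_real (profile x) * wave \<gamma> cal x - coeff \<gamma> * wave \<gamma> (- cal) x) (at x)"
    and "(wave \<gamma> (- cal) has_vector_derivative coeff (- \<gamma>) * wave \<gamma> cal x - of_real (profile x) * wave \<gamma> (- cal) x) (at x)"
proof -
  let ?X = "complex_of_real (nu * x)" and ?n = "complex_of_real nu"
  have t: "TT (?X + cal) \<noteq> 0" "TT (?X - cal) \<noteq> 0"
    using TT_real_nonzero[of "nu * x + al"] TT_real_nonzero[of "nu * x - al"] by simp_all
  have t': "TT (?X + - cal) \<noteq> 0" "TT (?X - - cal) \<noteq> 0" "HH (2 * - cal) \<noteq> 0" using t HH_2cal by simp_all
  have e: "?n * (deriv HH (?X + \<gamma> + cal) - HH (?X + \<gamma> + cal) * (ZZ (?X + cal) + ZZ \<gamma>)) / TT (?X + cal) =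
      of_real (profile x) * (HH (?X + \<gamma> + cal) / TT (?X + cal)) - coeff \<gamma> * (HH (?X + \<gamma> - cal) / TT (?X - cal))"
    unfolding lame_step[OF nz t(2) HH_2cal] coeff_eq[OF nz] profile_zeta[symmetric]
    using t by (simp add: diff_divide_distrib right_diff_distrib mult_ac)
  show "(wave \<gamma> cal has_vector_derivative of_real (profile x) * wave \<gamma> cal x - coeff \<gamma> * wave \<gamma> (- cal) x) (at x)"
    using wave_DERIV[of x cal \<gamma>, OF t(1)] unfolding e
    by (simp add: wave_def algebra_simps)
  have "?n * (deriv HH (?X + \<gamma> - cal) - HH (?X + \<gamma> - cal) * (ZZ (?X - cal) + ZZ \<gamma>)) =
      - (?n * (ZZ (?X - cal) - ZZ (?X + cal) + deriv HH (2 * cal) / HH (2 * cal))) * HH (?X + \<gamma> - cal) +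
      (?n * (deriv HH 0 * TT (\<gamma> - 2 * cal) / (HH (2 * cal) * TT \<gamma>))) * HH (?X + \<gamma> + cal) * TT (?X - cal) / TT (?X + cal)"
  proof -
    have "deriv HH (?X + \<gamma> - cal) - HH (?X + \<gamma> - cal) * (ZZ (?X - cal) + ZZ \<gamma>) =
      - (ZZ (?X - cal) - ZZ (?X + cal) + deriv HH (2 * cal) / HH (2 * cal)) * HH (?X + \<gamma> - cal) +
      (deriv HH 0 * TT (\<gamma> - 2 * cal) / (HH (2 * cal) * TT \<gamma>)) * HH (?X + \<gamma> + cal) * TT (?X - cal) / TT (?X + cal)"
      using lame_step[OF nz t'(2,3)] by (simp add: algebra_simps)
    moreover have "?n * (- A * h + K * p * t / t2) = - (?n * A) * h + (?n * K) * p * t / t2"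
      for A h K p t t2 :: complex
      by (simp add: algebra_simps)
    ultimately show ?thesis by (simp only:)
  qed
  moreover have "?n * (deriv HH 0 * TT (\<gamma> - 2 * cal) / (HH (2 * cal) * TT \<gamma>)) = coeff (- \<gamma>)"
    using coeff_eq[of "- \<gamma>"] nz TT_minus[of "\<gamma> - 2 * cal"] by simp
  ultimately have "?n * (deriv HH (?X + \<gamma> - cal) - HH (?X + \<gamma> - cal) * (ZZ (?X - cal) + ZZ \<gamma>)) =
      - of_real (profile x) * HH (?X + \<gamma> - cal) + coeff (- \<gamma>) * HH (?X + \<gamma> + cal) * TT (?X - cal) / TT (?X + cal)"
    by (simp only: profile_zeta)
  moreover have "(- p * h + c * h' * m / n) / m = c * (h' / n) - p * (h / m)"
    if "m \<noteq> 0" "n \<noteq> 0" for p h c h' m n :: complex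
    using that by (simp add: field_simps)
  note this[OF t(2,1)]
  ultimately have e': "?n * (deriv HH (?X + \<gamma> - cal) - HH (?X + \<gamma> - cal) * (ZZ (?X - cal) + ZZ \<gamma>)) / TT (?X - cal) =
      coeff (- \<gamma>) * (HH (?X + \<gamma> + cal) / TT (?X + cal)) - of_real (profile x) * (HH (?X + \<gamma> - cal) / TT (?X - cal))"
    by (simp only:)
  show "(wave \<gamma> (- cal) has_vector_derivative coeff (- \<gamma>) * wave \<gamma> cal x - of_real (profile x) * wave \<gamma> (- cal) x) (at x)"
    using wave_DERIV[of x "- cal" \<gamma>, OF t'(1)] unfolding add_uminus_conv_diff e'
    by (simp add: wave_def algebra_simps)
qed

text \<open>The factors \<open>- 2 * \<i> * \<zeta>\<close> and \<open>2 * coeff \<gamma>\<close>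
  turn the unequal couplings of \<open>wave_system\<close> into \<open>\<i> * \<zeta>\<close> in
  both equations, because \<open>coeff \<gamma> * coeff (- \<gamma>)\<close> is
  \<open>\<zeta>^2\<close>. The free scalar \<open>w\<close> allows the normalisation of the second
  solution.\<close>

lemma wave_lax_solution:
  fixes \<zeta> :: real and \<gamma> w :: complex and u :: "real \<Rightarrow> real \<Rightarrow> real"
  assumes nz: "TT \<gamma> \<noteq> 0" and zeta: "of_real (\<zeta>\<^sup>2) = coeff \<gamma> * coeff (- \<gamma>)"
    and u: "\<And>x t. u x t = profile (x + wave_speed * t)"
  defines "F \<equiv> \<lambda>x. w * (- 2 * \<i> * of_real \<zeta> * wave \<gamma> cal x)"
  defines "G \<equiv> \<lambda>x. w * (2 * coeff \<gamma> * wave \<gamma> (- cal) x)"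
  defines "\<mu> \<equiv> - 4 * of_real (nu ^ 3 * k\<^sup>2) * scd \<gamma>"
  shows "lax_solution (of_real \<zeta>) u (\<lambda>x t. exp (\<mu> * of_real t) *s
    vector [(F (x + wave_speed * t) + G (x + wave_speed * t)) / 2, (F (x + wave_speed * t) - G (x + wave_speed * t)) / 2])"
proof (rule lax_travelling_wave[OF profile_DERIV profile1_DERIV refl profile_bounded _ _ _ _ u])
  let ?z = "complex_of_real \<zeta>" and ?w2 = "complex_of_real (\<zeta>\<^sup>2)"
  let ?hp = "HH (\<gamma> + cal)" and ?hm = "HH (\<gamma> - cal)"
  let ?a = "complex_of_real (4 * z1 * z2 * z3 - 4 * \<zeta>\<^sup>2 * profile 0)"
  let ?b = "complex_of_real (wave_speed - 4 * \<zeta>\<^sup>2 - 2 * (profile 0)\<^sup>2)"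
  show "(F has_vector_derivative of_real (profile x) * F x + \<i> * ?z * G x) (at x)" for x
    using has_vector_derivative_mult_right[OF wave_system(1)[OF nz, of x], of "w * (- 2 * \<i> * ?z)"]
    by (simp add: F_def G_def algebra_simps)
  have zz: "?z * ?z = coeff \<gamma> * coeff (- \<gamma>)" using zeta by (simp add: power2_eq_square)
  show "(G has_vector_derivative \<i> * ?z * F x - of_real (profile x) * G x) (at x)" for x
  proof -
    have "\<i> * ?z * F x = w * (2 * (?z * ?z) * wave \<gamma> cal x)" by (simp add: F_def mult_ac)
    then show ?thesis
      unfolding zz using has_vector_derivative_mult_right[OF wave_system(2)[OF nz, of x], of "w * (2 * coeff \<gamma>)"]
      by (simp add: G_def algebra_simps)
  qed
  have p0: "profile1 0 = 0" by (simp add: profile1_def real_sn_0)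
  have w0: "wave \<gamma> cal 0 = ?hp / TT cal" "wave \<gamma> (- cal) 0 = ?hm / TT cal"
    by (simp_all add: wave_def add.commute)
  have w2: "?w2 = of_real (z1\<^sup>2) - of_real (k\<^sup>2 * nu\<^sup>2) * (sn \<gamma>)\<^sup>2"
    unfolding zeta by (rule coeff_mult[OF nz])
  have t1: "(\<mu> + ?a) * ?hp = ?b * coeff \<gamma> * ?hm"
    using time_equation_0[OF nz w2] by (simp add: \<mu>_def)
  \<comment> \<open>The second condition is the first one for \<open>- \<gamma>\<close>, multiplied
    by \<open>coeff \<gamma>\<close>: reflection exchanges the two values of \<open>HH\<close> up to
    sign and negates \<mu>.\<close>
  have t2: "(\<mu> - ?a) * (coeff \<gamma> * ?hm) = - (?b * (?z * ?z) * ?hp)"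
  proof -
    have nz': "TT (- \<gamma>) \<noteq> 0" and w2': "?w2 = of_real (z1\<^sup>2) - of_real (k\<^sup>2 * nu\<^sup>2) * (sn (- \<gamma>))\<^sup>2"
      using nz w2 by simp_all
    have h: "HH (- \<gamma> + cal) = - ?hm" "HH (- \<gamma> - cal) = - ?hp"
      using HH_minus[of "\<gamma> - cal"] HH_minus[of "\<gamma> + cal"] by simp_all
    have s: "scd (- \<gamma>) = - scd \<gamma>" by (simp add: scd_def)
    have "(- \<mu> + ?a) * (- ?hm) = ?b * coeff (- \<gamma>) * (- ?hp)"
      using time_equation_0[OF nz' w2'] unfolding h s by (simp add: \<mu>_def)
    from arg_cong[OF this, of "\<lambda>y. coeff \<gamma> * y"] show ?thesis
      unfolding zz by (simp add: algebra_simps)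
  qed
  have "(\<mu> + ?a) * F 0 + \<i> * ?z * ?b * G 0 = 2 * w * \<i> * ?z / TT cal * (?b * coeff \<gamma> * ?hm - (\<mu> + ?a) * ?hp)"
    unfolding F_def G_def w0 by (simp add: algebra_simps diff_divide_distrib add_divide_distrib)
  then show "(\<mu> + ?a) * F 0 + \<i> * ?z * of_real (wave_speed - 4 * \<zeta>\<^sup>2 - 2 * (profile 0)\<^sup>2 - 2 * profile1 0) * G 0 = 0"
    unfolding p0 t1 by simp
  have "(\<mu> - ?a) * G 0 + \<i> * ?z * ?b * F 0 = 2 * w / TT cal * ((\<mu> - ?a) * (coeff \<gamma> * ?hm) + ?b * (?z * ?z) * ?hp)"
    unfolding F_def G_def w0 by (simp add: algebra_simps diff_divide_distrib add_divide_distrib)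
  then show "(\<mu> - ?a) * G 0 + \<i> * ?z * of_real (wave_speed - 4 * \<zeta>\<^sup>2 - 2 * (profile 0)\<^sup>2 + 2 * profile1 0) * F 0 = 0"
    unfolding p0 t2 by simp
qed

end

theorem theorem1:
  fixes \<zeta>1 \<zeta>2 \<zeta>3 c \<nu> k \<alpha> \<zeta> :: real
    and \<phi> :: "real \<Rightarrow> real" and u :: "real \<Rightarrow> real \<Rightarrow> real"
    and \<gamma> C \<mu> :: complex
    and p1 q1 p2 q2 :: "real \<Rightarrow> complex"
  assumes "0 < \<zeta>3" and "\<zeta>3 < \<zeta>2" and "\<zeta>2 < \<zeta>1"
    and "c = 2 * (\<zeta>1\<^sup>2 + \<zeta>2\<^sup>2 + \<zeta>3\<^sup>2)"
    and "\<nu> = sqrt (\<zeta>1\<^sup>2 - \<zeta>3\<^sup>2)"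
    and "k = sqrt ((\<zeta>1\<^sup>2 - \<zeta>2\<^sup>2) / (\<zeta>1\<^sup>2 - \<zeta>3\<^sup>2))"
    and "\<And>x. \<phi> x = 2 * (\<zeta>1 + \<zeta>3) * (\<zeta>2 + \<zeta>3)
              / ((\<zeta>1 + \<zeta>3) - (\<zeta>1 - \<zeta>2) * (jacobi_sn k (\<nu> * x))\<^sup>2) - \<zeta>1 - \<zeta>2 - \<zeta>3"
    and "\<And>x t. u x t = \<phi> (x + c * t)"
    and "0 < \<alpha>" and "\<alpha> < ellK k"
    and "jacobi_sn k \<alpha> = sqrt ((\<zeta>1 - \<zeta>3) / (\<zeta>1 + \<zeta>2))"
    and "\<zeta> \<in> {0<..<\<zeta>3} \<union> {\<zeta>3<..<\<zeta>2} \<union> {\<zeta>2<..<\<zeta>1} \<union> {\<zeta>1<..}"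
    and "0 \<le> Re \<gamma>" and "Re \<gamma> \<le> ellK k"
    and "0 \<le> Im \<gamma>" and "Im \<gamma> \<le> ellK (compl_modulus k)"
    and "complex_of_real (\<zeta>\<^sup>2) =
           complex_of_real (\<zeta>3\<^sup>2) + complex_of_real (\<zeta>1\<^sup>2 - \<zeta>3\<^sup>2) * (jacobi_dn k \<gamma>)\<^sup>2"
    and "C = complex_of_real \<zeta>1 *
           (jacobi_Theta k 0 * jacobi_Theta k (complex_of_real (2 * \<alpha>) + \<gamma>)
            / (jacobi_Theta k \<gamma> * jacobi_Theta k (complex_of_real (2 * \<alpha>))))"
    and "\<And>x. p1 x =
           (- \<i> * complex_of_real \<zeta> *
              (jacobi_H k (complex_of_real (\<nu> * x + \<alpha>) + \<gamma>) / jacobi_Theta k (complex_of_real (\<nu> * x + \<alpha>)))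
            + C * (jacobi_H k (complex_of_real (\<nu> * x - \<alpha>) + \<gamma>) / jacobi_Theta k (complex_of_real (\<nu> * x - \<alpha>))))
           * exp (- complex_of_real (\<nu> * x) * jacobi_Z k \<gamma>)"
    and "\<And>x. q1 x =
           (- \<i> * complex_of_real \<zeta> *
              (jacobi_H k (complex_of_real (\<nu> * x + \<alpha>) + \<gamma>) / jacobi_Theta k (complex_of_real (\<nu> * x + \<alpha>)))
            - C * (jacobi_H k (complex_of_real (\<nu> * x - \<alpha>) + \<gamma>) / jacobi_Theta k (complex_of_real (\<nu> * x - \<alpha>))))
           * exp (- complex_of_real (\<nu> * x) * jacobi_Z k \<gamma>)"
    and "\<And>x. p2 x =
           (C * (jacobi_H k (complex_of_real (\<nu> * x + \<alpha>) - \<gamma>) / jacobi_Theta k (complex_of_real (\<nu> * x + \<alpha>)))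
            + \<i> * complex_of_real \<zeta> *
              (jacobi_H k (complex_of_real (\<nu> * x - \<alpha>) - \<gamma>) / jacobi_Theta k (complex_of_real (\<nu> * x - \<alpha>))))
           * exp (complex_of_real (\<nu> * x) * jacobi_Z k \<gamma>)"
    and "\<And>x. q2 x =
           (C * (jacobi_H k (complex_of_real (\<nu> * x + \<alpha>) - \<gamma>) / jacobi_Theta k (complex_of_real (\<nu> * x + \<alpha>)))
            - \<i> * complex_of_real \<zeta> *
              (jacobi_H k (complex_of_real (\<nu> * x - \<alpha>) - \<gamma>) / jacobi_Theta k (complex_of_real (\<nu> * x - \<alpha>))))
           * exp (complex_of_real (\<nu> * x) * jacobi_Z k \<gamma>)"
    and "\<mu> = - 4 * complex_of_real (\<nu>^3 * k\<^sup>2) * jacobi_sn k \<gamma> * jacobi_cn k \<gamma> * jacobi_dn k \<gamma>"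
  shows "\<exists>\<phi>1 \<phi>2 :: real \<Rightarrow> real \<Rightarrow> complex^2.
           lax_solution (complex_of_real \<zeta>) u \<phi>1 \<and>
           lax_solution (complex_of_real \<zeta>) u \<phi>2 \<and>
           lin_indep2 \<phi>1 \<phi>2 \<and>
           (\<forall>x t. \<phi>1 x t = exp (\<mu> * complex_of_real t) *s vector [p1 (x + c * t), q1 (x + c * t)]) \<and>
           (\<forall>x t. \<phi>2 x t = exp (- \<mu> * complex_of_real t) *s vector [p2 (x + c * t), q2 (x + c * t)])"
proof -
  have mk: "mkdv_wave \<zeta>1 \<zeta>2 \<zeta>3 \<nu> k \<alpha>"
    using assms(1-3,5,6,9-11) by unfold_locales
  interpret mkdv_wave \<zeta>1 \<zeta>2 \<zeta>3 \<nu> k \<alpha> by (rule mk)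
  note mem = assms(12) and dn_eq' = assms(17) and C = assms(18) and p1 = assms(19) and q1 = assms(20)
    and p2 = assms(21) and q2 = assms(22) and mu = assms(23)
  have zeta: "0 < \<zeta>" "\<zeta> \<noteq> \<zeta>1" "\<zeta> \<noteq> \<zeta>2" "\<zeta> \<noteq> \<zeta>3" using mem z by auto
  have sq_neq: "\<zeta>\<^sup>2 \<noteq> y\<^sup>2" if "0 < y" "\<zeta> \<noteq> y" for y
    using that zeta(1) by (simp add: power2_eq_iff)
  \<comment> \<open>At a zero of the denominator \<open>jacobi_dn\<close> is 0 by the convention for
    division, which would force the excluded value \<zeta>3.\<close>
  have nz: "TT \<gamma> \<noteq> 0"
  proof
    assume "TT \<gamma> = 0"
    then have "complex_of_real (\<zeta>\<^sup>2) = of_real (\<zeta>3\<^sup>2)"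
      using dn_eq' by (simp add: jacobi_dn_def)
    then show False using sq_neq[of \<zeta>3] z zeta by (simp only: of_real_eq_iff) simp
  qed
  have dn2: "(dn \<gamma>)\<^sup>2 = 1 - of_real (k\<^sup>2) * (sn \<gamma>)\<^sup>2" and cn2: "(cn \<gamma>)\<^sup>2 = 1 - (sn \<gamma>)\<^sup>2"
    using dn_sn_sq[OF nz] sn_cn_sq[OF nz] by (simp_all add: algebra_simps)
  have zz: "complex_of_real (\<zeta>\<^sup>2) = of_real (\<zeta>1\<^sup>2) - of_real (k\<^sup>2 * \<nu>\<^sup>2) * (sn \<gamma>)\<^sup>2"
    using dn_eq' unfolding dn2 nu_sq[symmetric] by (simp add: algebra_simps nu_sq)
  have C_eq: "C = coeff \<gamma>" using C by (simp add: coeff_def)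
  have cc: "of_real (\<zeta>\<^sup>2) = coeff \<gamma> * coeff (- \<gamma>)"
    unfolding coeff_mult[OF nz] by (rule zz)
  then have C_nz: "coeff \<gamma> \<noteq> 0" using zeta(1) by auto
  have mu_eq: "\<mu> = - 4 * of_real (\<nu> ^ 3 * k\<^sup>2) * scd \<gamma>"
    using mu by (simp add: scd_def mult.assoc)
  \<comment> \<open>Zeros of \<open>sn\<close>, \<open>cn\<close>, \<open>dn\<close> at \<gamma>
    correspond to \<zeta> being \<zeta>1, \<zeta>2, \<zeta>3 respectively.\<close>
  have "scd \<gamma> \<noteq> 0"
  proof
    assume "scd \<gamma> = 0"
    then consider "sn \<gamma> = 0" | "cn \<gamma> = 0" | "dn \<gamma> = 0" by (auto simp: scd_def)
    then have "complex_of_real (\<zeta>\<^sup>2) = of_real (\<zeta>1\<^sup>2) \<or> complex_of_real (\<zeta>\<^sup>2) = of_real (\<zeta>2\<^sup>2) \<or>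
        complex_of_real (\<zeta>\<^sup>2) = of_real (\<zeta>3\<^sup>2)"
    proof cases
      case 1 then show ?thesis using zz by simp
    next
      case 2
      then have "(sn \<gamma>)\<^sup>2 = 1" using cn2 by simp
      then show ?thesis using zz unfolding k_nu_sq by simp
    next
      case 3 then show ?thesis using dn_eq' by simp
    qed
    then show False
      unfolding of_real_eq_iff using sq_neq[of \<zeta>1] sq_neq[of \<zeta>2] sq_neq[of \<zeta>3] z zeta by auto
  qed
  then have mu_nz: "\<mu> \<noteq> 0" unfolding mu_eq using nu_pos k_pos by simp
  have c: "c = wave_speed" using assms(4) by (simp add: wave_speed_def)
  have u: "u x t = profile (x + wave_speed * t)" for x t
    using assms(7,8) by (simp add: profile_def c)
  let ?z = "complex_of_real \<zeta>"
  let ?F1 = "\<lambda>x. 1 * (- 2 * \<i> * ?z * wave \<gamma> cal x)" and ?G1 = "\<lambda>x. 1 * (2 * coeff \<gamma> * wave \<gamma> (- cal) x)"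
  \<comment> \<open>Chosen so that \<open>?w * (- 2 * \<i> * \<zeta>)\<close> is
    \<open>2 * C\<close>; then \<open>?w * 2 * coeff (- \<gamma>)\<close> is
    \<open>2 * \<i> * \<zeta>\<close>, because \<open>C * coeff (- \<gamma>)\<close> is
    \<open>\<zeta>^2\<close>.\<close>
  let ?w = "\<i> * C / ?z"
  let ?F2 = "\<lambda>x. ?w * (- 2 * \<i> * ?z * wave (- \<gamma>) cal x)" and ?G2 = "\<lambda>x. ?w * (2 * coeff (- \<gamma>) * wave (- \<gamma>) (- cal) x)"
  have s1: "p1 x = (?F1 x + ?G1 x) / 2" "q1 x = (?F1 x - ?G1 x) / 2" for x
    unfolding p1 q1 C_eq by (simp_all add: wave_def algebra_simps)
  have s2: "p2 x = (?F2 x + ?G2 x) / 2" "q2 x = (?F2 x - ?G2 x) / 2" for x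
  proof -
    have "?F2 x = 2 * (C * wave (- \<gamma>) cal x)" using zeta by (simp add: field_simps)
    moreover have "?G2 x = 2 * (\<i> * ?z * wave (- \<gamma>) (- cal) x)"
    proof -
      have "?G2 x = 2 * \<i> * (coeff \<gamma> * coeff (- \<gamma>)) / ?z * wave (- \<gamma>) (- cal) x"
        by (simp add: C_eq)
      then show ?thesis unfolding cc[symmetric] using zeta by (simp add: power2_eq_square)
    qed
    ultimately show "p2 x = (?F2 x + ?G2 x) / 2" "q2 x = (?F2 x - ?G2 x) / 2"
      unfolding p2 q2 by (simp_all add: wave_def algebra_simps)
  qed
  have L1: "lax_solution ?z u (\<lambda>x t. exp (\<mu> * of_real t) *s vector [p1 (x + c * t), q1 (x + c * t)])"
    unfolding s1 c mu_eq by (rule wave_lax_solution[OF nz cc u])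
  have L2: "lax_solution ?z u (\<lambda>x t. exp (- \<mu> * of_real t) *s vector [p2 (x + c * t), q2 (x + c * t)])"
  proof -
    have nz': "TT (- \<gamma>) \<noteq> 0" and cc': "of_real (\<zeta>\<^sup>2) = coeff (- \<gamma>) * coeff (- (- \<gamma>))"
      using nz cc by (simp_all add: mult.commute)
    have "- \<mu> = - 4 * of_real (\<nu> ^ 3 * k\<^sup>2) * scd (- \<gamma>)" by (simp add: mu_eq scd_def)
    then show ?thesis
      unfolding s2 c using wave_lax_solution[OF nz' cc' u, of ?w] by (simp only:)
  qed
  have pos: "TT (of_real (\<nu> * x) + cal) \<noteq> 0" for x
    using TT_real_nonzero[of "\<nu> * x + \<alpha>"] by simp
  \<comment> \<open>Each of \<open>p1 + q1\<close> and \<open>p2 + q2\<close> is a nonzero multiple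
    of a single \<open>wave\<close>, so a real point where its numerator does not vanish is
    enough.\<close>
  obtain X1 :: real where X1: "HH (of_real X1 + (cal + \<gamma>)) \<noteq> 0" using HH_line_nonzero by blast
  obtain X2 :: real where X2: "HH (of_real X2 + (cal + - \<gamma>)) \<noteq> 0" using HH_line_nonzero by blast
  have n: "\<nu> * (X / \<nu>) = X" for X using nu_pos by simp
  have "p1 (X1 / \<nu>) + q1 (X1 / \<nu>) = ?F1 (X1 / \<nu>)" unfolding s1 by (simp add: field_simps)
  also have "\<dots> \<noteq> 0" using X1 pos[of "X1 / \<nu>"] zeta unfolding wave_def n by simp
  finally have i1: "p1 (X1 / \<nu>) + q1 (X1 / \<nu>) \<noteq> 0" .
  have "p2 (X2 / \<nu>) + q2 (X2 / \<nu>) = ?F2 (X2 / \<nu>)" unfolding s2 by (simp add: field_simps)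
  also have "\<dots> \<noteq> 0" using X2 pos[of "X2 / \<nu>"] zeta C_nz unfolding wave_def n C_eq by simp
  finally have i2: "p2 (X2 / \<nu>) + q2 (X2 / \<nu>) \<noteq> 0" .
  show ?thesis
    using L1 L2 lin_indep2_travelling_waves[of \<mu> p1 "X1 / \<nu>" q1 p2 "X2 / \<nu>" q2 c, OF mu_nz i1 i2] by blast
qed

end
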